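(* Let $\nu\ge1$, $m\ge\ell\ge n$ be integers with $\mu=m-n-\nu\ge1$. Let $U$ be an $m\times m$ Haar distributed random unitary matrix and let $T$ be the $(n+\nu)\times\ell$ truncation of $U$. Let $X$ be an $\ell\times n$ random complex matrix, independent of $T$, whose squared singular values $x_1,\ldots,x_n$ (the eigenvalues of $X^*X$) follow the polynomial ensemble on $[0,\infty)$ with density $\frac1{Z_n}\Delta_n(x)\det[f_{k-1}(x_j)]_{j,k=1}^n$. Let $p_0,\ldots,p_{n-1}$, $q_0,\ldots,q_{n-1}$ be a biorthogonal system, $k_n$ the correlation kernel and $p_n$ the average characteristic polynomial of this ensemble. Let $$F_k(y)=\int_0^1 t^\nu(1-t)^{\mu-1}f_k\left(\frac yt\right)\frac{dt}t,\qquad y>0,\quad k=0,\ldots,n-1.$$ Let $\Sigma$ be a simple counter-clockwise contour around $0$ but not containing $1$. Then: (a) a biorthogonal system for the polynomial ensemble $\frac1{Z_n'}\Delta_n(y)\det[F_{k-1}(y_j)]_{j,k=1}^n$ on $[0,\infty)$ of the squared singular values of $TX$ is given, for $k=0,\ldots,n-1$, by $$P_k(x)=\frac{\mu}{2\pi i}\oint_\Sigma s^{-\nu}(1-s)^{-\mu-1}p_k\left(\frac xs\right)\frac{ds}s,\qquad Q_k(y)=\int_0^1t^\nu(1-t)^{\mu-1}q_k\left(\frac yt\right)\frac{dt}t;$$ (b) the correlation kernel for the squared singular values of $TX$ is given by $$K_n(x,y)=\frac{\mu}{2\pi i}\oint_\Sigma\frac{ds}s\int_0^1\frac{dt}t\left(\frac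 ts\right)^\nu k_n\left(\frac xs,\frac yt\right)(1-s)^{-\mu-1}(1-t)^{\mu-1};$$ (c) the average characteristic polynomial $P_n$ of $X^*T^*TX$ is $$P_n(x)=\frac{\mu!\,(n+\nu)!}{2\pi i\,(n+\nu+\mu)!}\oint_\Sigma s^{-\nu}(1-s)^{-\mu-1}p_n\left(\frac xs\right)\frac{ds}s.$$
   Context: $\Delta_n(x)=\prod_{1\le j<k\le n}(x_k-x_j)$. A polynomial ensemble is a probability density for $n$ particles of the form $\frac1{Z_n}\Delta_n(x)\det[f_{k-1}(x_j)]_{j,k=1}^n$; it is on $[0,\infty)$ if all $f_k$ vanish outside $[0,\infty)$. A biorthogonal system for it consists of polynomials $p_j$ of degree $j$ and functions $q_j$ (dual functions) in the linear span of $f_0,\ldots,f_{n-1}$, $j=0,\ldots,n-1$, with $\int p_j(x)q_k(x)\,dx=\delta_{j,k}$ (not unique). The ensemble is a determinantal point process with correlation kernel $k_n(x,y)=\sum_{j=0}^{n-1}p_j(x)q_j(y)$, independent of the choice of biorthogonal system and extended polynomially to complex first argument. The average characteristic polynomial is $p_n(x)=\mathbb E\left[\prod_{j=1}^n(x-x_j)\right]$, the unique monic polynomial of degree $n$ with $\int p_nf_k\,dx=0$, $k=0,\ldots,n-1$; the average characteristic polynomial of $X^*T^*TX$ is $\mathbb E\det(xI-X^*T^*TX)$. The $a\times b$ truncation of a matrix is its upper-left $a\times b$ block. It is known (Kieburg–Kuijlaars–Stivigny) that the squared singular values of $TX$ follow the polynomial ensemble on $[0,\infty)$ with density $\frac1{Z_n'}\Delta_n(y)\det[F_{k-1}(y_j)]$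 for some constant $Z_n'$. *)

theory Defs
  imports
    "HOL-Probability.Probability"
    "HOL-Complex_Analysis.Complex_Analysis"
    "Jordan_Normal_Form.Schur_Decomposition"
begin

hide_const (open) Determinants.det Finite_Cartesian_Product.mat

text \<open>Matrices are those of the Jordan-Normal-Form library, with dimensions given by natural
  numbers and indices counted from 0. They carry the \<open>\<sigma>\<close>-algebra generated by the entries.\<close>

definition mat_borel :: "nat \<Rightarrow> nat \<Rightarrow> complex mat measure" where
  "mat_borel r c =
     vimage_algebra (carrier_mat r c)
       (\<lambda>A. \<lambda>ij\<in>{..<r} \<times> {..<c}. A $$ ij) (PiM ({..<r} \<times> {..<c}) (\<lambda>_. borel))"

definition unitary_group :: "nat \<Rightarrow> complex mat set" where
  "unitary_group m =
     {U \<in> carrier_mat m m. mat_adjoint U * U = 1\<^sub>m m \<and> U * mat_adjoint U = 1\<^sub>m m}"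

definition unitary_space :: "nat \<Rightarrow> complex mat measure" where
  "unitary_space m = restrict_space (mat_borel m m) (unitary_group m)"

text \<open>Haar measure is the left-invariant probability measure on the unitary group.\<close>

definition haar_distributed :: "'w measure \<Rightarrow> nat \<Rightarrow> ('w \<Rightarrow> complex mat) \<Rightarrow> bool" where
  "haar_distributed M m U \<longleftrightarrow>
     prob_space M \<and> U \<in> measurable M (unitary_space m) \<and>
     (\<forall>V\<in>unitary_group m.
        distr M (unitary_space m) (\<lambda>\<omega>. V * U \<omega>) = distr M (unitary_space m) U)"

definition truncation :: "nat \<Rightarrow> nat \<Rightarrow> complex mat \<Rightarrow> complex mat" where
  "truncation a b U = mat a b (\<lambda>(i, j). U $$ (i, j))"

text \<open>The eigenvalues of \<open>X\<^sup>* X\<close>, with multiplicity, in increasing order. They are real, so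
  \<^const>\<open>Re\<close> only changes the type.\<close>

definition sq_sing_vals :: "complex mat \<Rightarrow> real list" where
  "sq_sing_vals X =
     sorted_list_of_multiset (image_mset Re (proots (char_poly (mat_adjoint X * X))))"

definition vandermonde :: "nat \<Rightarrow> (nat \<Rightarrow> real) \<Rightarrow> real" where
  "vandermonde n x = (\<Prod>k<n. \<Prod>j<k. x k - x j)"

definition polynomial_ensemble_density ::
    "nat \<Rightarrow> (nat \<Rightarrow> real \<Rightarrow> real) \<Rightarrow> real \<Rightarrow> (nat \<Rightarrow> real) \<Rightarrow> real" where
  "polynomial_ensemble_density n f Z x =
     1 / Z * vandermonde n x * det (mat n n (\<lambda>(j, k). f k (x j)))"

text \<open>Weights on \<open>[0, \<infinity>)\<close>. The moments up to order \<open>n - 1\<close> enter biorthogonality, the one of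
  order \<open>n\<close> is needed for the average characteristic polynomial to exist.\<close>

definition ensemble_weights :: "nat \<Rightarrow> (nat \<Rightarrow> real \<Rightarrow> real) \<Rightarrow> bool" where
  "ensemble_weights n f \<longleftrightarrow>
     (\<forall>k<n. f k \<in> borel_measurable borel \<and> (\<forall>x<0. f k x = 0) \<and>
            (\<forall>j\<le>n. integrable lborel (\<lambda>x. x ^ j * f k x)))"

text \<open>The \<open>n\<close> random points \<open>xs \<omega>\<close> come in a fixed (increasing) order, whereas the density of a
  polynomial ensemble is a symmetric function on \<open>\<real>\<^sup>n\<close>: it is the joint density of the points after
  relabelling them by an independent uniformly random permutation.\<close>

definition follows_polynomial_ensemble ::
    "'w measure \<Rightarrow> nat \<Rightarrow> ('w \<Rightarrow> real list) \<Rightarrow> (nat \<Rightarrow> real \<Rightarrow> real) \<Rightarrow> real \<Rightarrow> bool" where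
  "follows_polynomial_ensemble M n xs f Z \<longleftrightarrow>
     Z \<noteq> 0 \<and>
     (AE x in PiM {..<n} (\<lambda>_. lborel). 0 \<le> polynomial_ensemble_density n f Z x) \<and>
     distributed (M \<Otimes>\<^sub>M uniform_count_measure {\<sigma>. \<sigma> permutes {..<n}})
       (PiM {..<n} (\<lambda>_. lborel)) (\<lambda>(\<omega>, \<sigma>). \<lambda>i\<in>{..<n}. xs \<omega> ! \<sigma> i)
       (\<lambda>x. ennreal (polynomial_ensemble_density n f Z x))"

text \<open>The \<open>p j\<close> are polynomial functions of a complex variable; the linear span is taken over
  \<open>\<complex>\<close>, which covers real biorthogonal systems.\<close>

definition biorthogonal_system ::
    "nat \<Rightarrow> (nat \<Rightarrow> real \<Rightarrow> real) \<Rightarrow> (nat \<Rightarrow> complex \<Rightarrow> complex) \<Rightarrow> (nat \<Rightarrow> real \<Rightarrow> complex) \<Rightarrow> bool"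
  where
  "biorthogonal_system n f p q \<longleftrightarrow>
     (\<forall>j<n. \<exists>r. degree r = j \<and> (\<forall>z. p j z = poly r z)) \<and>
     (\<forall>j<n. \<exists>c. \<forall>x. q j x = (\<Sum>i<n. c i * complex_of_real (f i x))) \<and>
     (\<forall>j<n. \<forall>k<n.
        integrable lborel (\<lambda>x. p j (of_real x) * q k x) \<and>
        (LINT x|lborel. p j (of_real x) * q k x) = (if j = k then 1 else 0))"

definition correlation_kernel ::
    "nat \<Rightarrow> (nat \<Rightarrow> complex \<Rightarrow> complex) \<Rightarrow> (nat \<Rightarrow> real \<Rightarrow> complex) \<Rightarrow> complex \<Rightarrow> real \<Rightarrow> complex" where
  "correlation_kernel n p q x y = (\<Sum>j<n. p j x * q j y)"

text \<open>The \<open>r\<close>-point correlation function of the \<open>n\<close> random points \<open>xs \<omega>\<close> is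
  \<open>det [K(x\<^sub>a, x\<^sub>b)]\<close> for every \<open>r\<close>. Correlation functions are characterised as usual by the
  expectation of sums over \<open>r\<close>-tuples of distinct points; since there are only \<open>n\<close> points,
  bounded test functions are admissible.\<close>

definition determinantal ::
    "'w measure \<Rightarrow> nat \<Rightarrow> ('w \<Rightarrow> real list) \<Rightarrow> (complex \<Rightarrow> real \<Rightarrow> complex) \<Rightarrow> bool" where
  "determinantal M n xs K \<longleftrightarrow>
     (\<forall>r. \<forall>g :: (nat \<Rightarrow> real) \<Rightarrow> complex.
        g \<in> borel_measurable (PiM {..<r} (\<lambda>_. lborel)) \<longrightarrow> bounded (range g) \<longrightarrow>
        integrable (PiM {..<r} (\<lambda>_. lborel))
          (\<lambda>x. g x * det (mat r r (\<lambda>(a, b). K (of_real (x a)) (x b)))) \<and>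
        (LINT \<omega>|M. (\<Sum>i\<in>{i \<in> {..<r} \<rightarrow>\<^sub>E {..<n}. inj_on i {..<r}}.
                      g (\<lambda>a\<in>{..<r}. xs \<omega> ! i a))) =
        (LINT x|PiM {..<r} (\<lambda>_. lborel).
           g x * det (mat r r (\<lambda>(a, b). K (of_real (x a)) (x b)))))"

text \<open>The transform \<open>f \<mapsto> F\<close>, used for the (real) weights and for the (complex) dual functions.\<close>

definition mellin_convolution ::
    "nat \<Rightarrow> nat \<Rightarrow> (real \<Rightarrow> 'a :: {banach, second_countable_topology}) \<Rightarrow> real \<Rightarrow> 'a" where
  "mellin_convolution \<nu> \<mu> f y =
     (LINT t:{0<..<1}|lborel. (t ^ \<nu> * (1 - t) ^ (\<mu> - 1) * (1 / t)) *\<^sub>R f (y / t))"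

definition admissible_contour :: "(real \<Rightarrow> complex) \<Rightarrow> bool" where
  "admissible_contour \<gamma> \<longleftrightarrow>
     valid_path \<gamma> \<and> simple_path \<gamma> \<and> pathfinish \<gamma> = pathstart \<gamma> \<and>
     0 \<in> inside (path_image \<gamma>) \<and> 1 \<in> outside (path_image \<gamma>) \<and>
     winding_number \<gamma> 0 = 1"

end

theory Submission
  imports Defs
begin

text \<open>
  Both transforms are diagonal on monomials. The contour integral multiplies \<open>x\<^sup>j\<close> by
  \<open>\<mu> * ((\<nu> + j + \<mu>) choose \<mu>)\<close>; the integrals involved obey Pascal's rule because
  \<open>s + (1 - s) = 1\<close>. The Mellin convolution multiplies the \<open>j\<close>-th moment by the beta integral
  \<open>B(\<nu> + j + 1, \<mu>)\<close>, which is the reciprocal. Hence biorthogonality is preserved, and the kernel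
  formula follows by linearity. That a biorthogonal system yields a determinantal kernel is Andreief's
  argument: the density is \<open>1 / n!\<close> times the product of the determinants of the two systems,
  and the variables are integrated out in the Leibniz expansions.

  The average characteristic polynomial is computed without the distribution of \<open>T X\<close>. Write
  \<open>A\<close> for the product of the first \<open>l\<close> columns of \<open>U\<close> with \<open>X\<close>, so that \<open>A\<^sup>* A = X\<^sup>* X\<close>, while
  \<open>T X\<close> consists of the first \<open>n + \<nu>\<close> rows of \<open>A\<close>. Haar measure is invariant under permutation
  matrices, so these rows may be replaced by any \<open>n + \<nu>\<close> rows. By Cauchy-Binet the coefficient of
  \<open>z\<^sup>n\<^sup>-\<^sup>k\<close> is a sum over sets of \<open>k\<close> rows, and averaging over the choice of the rows multiplies
  it by \<open>((m - k) choose (n + \<nu> - k)) / (m choose (n + \<nu>))\<close>.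
\<close>

section \<open>The contour integral\<close>

text \<open>Characterising P_n by orthogonality would require the law of \<open>T X\<close>. The
  averaging over rows avoids this and needs Haar invariance only under permutation matrices. With
  \<open>N = n + \<nu>\<close> and \<open>j = n - k\<close>, the numerator
  \<open>(m - k) choose (N - k)\<close> equals \<open>(\<nu> + j + \<mu>) choose \<mu>\<close>, the
  multiplier that the contour integral produces on \<open>x ^ j\<close>, and the denominator
  \<open>m choose N\<close> is the source of the constant in (c). The obstacle is integrability:
  integrating over \<open>T\<close> with \<open>X\<close> frozen needs a bound on the determinant of
  the chosen rows that is uniform in \<open>U\<close>. It comes from the eigenvalues being
  nonnegative. At the point \<open>- norm z\<close> all row sets contribute with the same sign, so
  each of them is bounded by the sum over all, which depends on \<open>X\<close> alone. The factor
  \<open>1 / n!\<close> in Andreief's argument is not computed from \<open>Z\<close>. It is found by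
  comparing total masses, which is the case of no points at all.\<close>

lemma path_image_admissible_contour:
  assumes "admissible_contour \<gamma>" "s \<in> path_image \<gamma>"
  shows "s \<noteq> 0" "s \<noteq> 1"
  using assms inside_no_overlap[of "path_image \<gamma>"] outside_no_overlap[of "path_image \<gamma>"]
  unfolding admissible_contour_def by (metis disjoint_iff)+

text \<open>The value is 2 pi i times the residue at 0, the coefficient of
  \<open>s ^ (a - 1)\<close> in \<open>(1 - s) powi (- int b)\<close>; the pole at 1 lies outside.
  Lowering one exponent at a time ends with a single pole, where first powers are settled by winding
  numbers and higher ones by primitives. The case \<open>a = 0\<close> is separated because
  truncated subtraction would give the binomial the value 1, while for \<open>a = 1\<close>,
  \<open>b = 0\<close> it correctly turns \<open>a + b - 2\<close> into 0.\<close>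

lemma has_contour_integral_binomial_kernel:
  assumes adm: "admissible_contour \<gamma>" and "a + b > 0"
  shows "((\<lambda>s. s powi (- int a) * (1 - s) powi (- int b)) has_contour_integral
            (if a = 0 then 0 else 2 * of_real pi * \<i> * of_nat ((a + b - 2) choose (a - 1)))) \<gamma>"
  using \<open>a + b > 0\<close>
proof (induction "a + b" arbitrary: a b rule: less_induct)
  case less
  have path: "valid_path \<gamma>" "pathfinish \<gamma> = pathstart \<gamma>"
    using adm by (auto simp: admissible_contour_def)
  have nz: "s \<noteq> 0" "s \<noteq> 1" if "s \<in> path_image \<gamma>" for s
    using path_image_admissible_contour[OF adm that] .
  have prim: "(f has_contour_integral 0) \<gamma>"
    if "\<And>s. s \<in> path_image \<gamma> \<Longrightarrow> (g has_field_derivative f s) (at s within path_image \<gamma>)" for f g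
    using contour_integral_primitive[of "path_image \<gamma>" g f \<gamma>] that path by simp
  consider (pole0) "a \<ge> 1" "b \<ge> 1" | (b0) "a = 1" "b = 0" | (b0') "a \<ge> 2" "b = 0"
    | (a0) "a = 0" "b = 1" | (a0') "a = 0" "b \<ge> 2"
    using less.prems by linarith
  then show ?case
  proof cases
    case pole0
    obtain c d where cd: "a = Suc c" "b = Suc d"
      using pole0 by (metis Suc_le_D One_nat_def)
    have "((\<lambda>s. s powi (- int c) * (1 - s) powi (- int b) + s powi (- int a) * (1 - s) powi (- int d))
      has_contour_integral
        ((if c = 0 then 0 else 2 * of_real pi * \<i> * of_nat ((c + b - 2) choose (c - 1)))
        + (if a = 0 then 0 else 2 * of_real pi * \<i> * of_nat ((a + d - 2) choose (a - 1))))) \<gamma>"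
      by (intro has_contour_integral_add less.hyps) (use cd in auto)
    also have "(if c = 0 then 0 else 2 * of_real pi * \<i> * of_nat ((c + b - 2) choose (c - 1)))
        + (if a = 0 then 0 else 2 * of_real pi * \<i> * of_nat ((a + d - 2) choose (a - 1)))
      = (if a = 0 then 0 else 2 * of_real pi * \<i> * of_nat ((a + b - 2) choose (a - 1)))"
    \<comment> \<open>For \<open>c = 0\<close> the first term has no pole at 0 and the other
      binomials have lower index 0. Otherwise this is Pascal's rule.\<close>
    proof (cases "c = 0")
      case False
      then obtain c' where "c = Suc c'" by (cases c) auto
      then show ?thesis by (cases d) (auto simp: cd algebra_simps)
    qed (auto simp: cd)
    finally show ?thesis
    proof (rule has_contour_integral_eq)
      fix s assume "s \<in> path_image \<gamma>"
      then have "s \<noteq> 0" "1 - s \<noteq> 0" using nz by auto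
      then show "s powi (- int c) * (1 - s) powi (- int b) + s powi (- int a) * (1 - s) powi (- int d)
        = s powi (- int a) * (1 - s) powi (- int b)"
        by (simp add: cd power_int_minus field_simps del: of_nat_Suc)
    qed
  next
    case b0
    have "((\<lambda>s. 1 / (s - 0)) has_contour_integral (2 * pi * \<i> * winding_number \<gamma> 0)) \<gamma>"
      by (rule has_contour_integral_winding_number) (use path nz in auto)
    moreover have "winding_number \<gamma> 0 = 1" using adm by (simp add: admissible_contour_def)
    ultimately show ?thesis using b0
      by (simp add: power_int_minus field_simps)
  next
    case b0'
    obtain c where c: "a = Suc (Suc c)" using b0' by (metis add_2_eq_Suc le_Suc_ex)
    have "((\<lambda>s. s powi (- int a)) has_contour_integral 0) \<gamma>"
    proof (rule prim[where g = "\<lambda>s. - (s powi (- int (Suc c))) / of_nat (Suc c)"])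
      fix s assume "s \<in> path_image \<gamma>"
      then have "s \<noteq> 0" using nz by auto
      have "of_nat (Suc c) \<noteq> (0::complex)" by (metis of_nat_neq_0)
      have "((\<lambda>s. - (s powi (- int (Suc c))) / of_nat (Suc c)) has_field_derivative
        - (of_int (- int (Suc c)) * s powi (- int (Suc c) - 1) * 1) / of_nat (Suc c)) (at s within path_image \<gamma>)"
        by (intro DERIV_cdivide DERIV_minus DERIV_power_int derivative_intros) (use \<open>s \<noteq> 0\<close> in simp)
      also have "- (of_int (- int (Suc c)) * s powi (- int (Suc c) - 1) * 1) / of_nat (Suc c) = s powi (- int a)"
        using \<open>of_nat (Suc c) \<noteq> (0::complex)\<close> by (simp add: c field_simps del: of_nat_Suc)
          (simp add: algebra_simps)
      finally show "((\<lambda>s. - (s powi (- int (Suc c))) / of_nat (Suc c)) has_field_derivative s powi (- int a))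
        (at s within path_image \<gamma>)" .
    qed
    with b0' c show ?thesis by (simp add: binomial_eq_0)
  next
    case a0
    have "((\<lambda>s. 1 / (s - 1)) has_contour_integral (2 * pi * \<i> * winding_number \<gamma> 1)) \<gamma>"
      by (rule has_contour_integral_winding_number) (use path nz in auto)
    moreover have "winding_number \<gamma> 1 = 0"
      using adm by (intro winding_number_zero_in_outside) (auto simp: admissible_contour_def valid_path_imp_path)
    ultimately have "((\<lambda>s. - (1 / (s - 1))) has_contour_integral - 0) \<gamma>"
      by (intro has_contour_integral_neg) simp
    then have "((\<lambda>s. s powi (- int a) * (1 - s) powi (- int b)) has_contour_integral - 0) \<gamma>"
    proof (rule has_contour_integral_eq)
      fix s assume "s \<in> path_image \<gamma>"
      then have "s - 1 \<noteq> 0" "1 - s \<noteq> 0" using nz by auto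
      then show "- (1 / (s - 1)) = s powi (- int a) * (1 - s) powi (- int b)"
        using a0 by (simp add: power_int_minus field_simps)
    qed
    then show ?thesis using a0 by simp
  next
    case a0'
    obtain c where c: "b = Suc (Suc c)" using a0' by (metis add_2_eq_Suc le_Suc_ex)
    have "((\<lambda>s. (1 - s) powi (- int b)) has_contour_integral 0) \<gamma>"
    proof (rule prim[where g = "\<lambda>s. (1 - s) powi (- int (Suc c)) / of_nat (Suc c)"])
      fix s assume "s \<in> path_image \<gamma>"
      then have s: "1 - s \<noteq> 0" using nz by auto
      have "of_nat (Suc c) \<noteq> (0::complex)" by (metis of_nat_neq_0)
      have "((\<lambda>s. (1 - s) powi (- int (Suc c)) / of_nat (Suc c)) has_field_derivative
        (of_int (- int (Suc c)) * (1 - s) powi (- int (Suc c) - 1) * (0 - 1)) / of_nat (Suc c)) (at s within path_image \<gamma>)"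
        by (intro DERIV_cdivide DERIV_power_int derivative_intros) (use s in simp)
      also have "(of_int (- int (Suc c)) * (1 - s) powi (- int (Suc c) - 1) * (0 - 1)) / of_nat (Suc c) = (1 - s) powi (- int b)"
        using \<open>of_nat (Suc c) \<noteq> (0::complex)\<close> by (simp add: c field_simps del: of_nat_Suc)
          (simp add: algebra_simps)
      finally show "((\<lambda>s. (1 - s) powi (- int (Suc c)) / of_nat (Suc c)) has_field_derivative (1 - s) powi (- int b))
        (at s within path_image \<gamma>)" .
    qed
    with a0' show ?thesis by simp
  qed
qed

text \<open>Expanding \<open>r\<close> leads to the kernels with exponents
  \<open>\<nu> + j + 1\<close> and \<open>\<mu> + 1\<close>: both \<open>(x / s) ^ j\<close> and the
  factor \<open>1 / s\<close> of the measure raise the order of the pole at 0. The residue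
  \<open>(\<nu> + j + \<mu>) choose (\<nu> + j)\<close> is rewritten by symmetry.\<close>

lemma has_contour_integral_mult_convolution_poly:
  assumes adm: "admissible_contour \<gamma>"
  shows "((\<lambda>s. s powi (- int \<nu>) * (1 - s) powi (- int \<mu> - 1) * poly r (x / s) * (1 / s))
           has_contour_integral
           2 * of_real pi * \<i> * (\<Sum>j\<le>degree r. coeff r j * of_nat ((\<nu> + j + \<mu>) choose \<mu>) * x ^ j)) \<gamma>"
proof -
  have "((\<lambda>s. \<Sum>j\<le>degree r. coeff r j * x ^ j * (s powi (- int (\<nu> + j + 1)) * (1 - s) powi (- int (\<mu> + 1))))
           has_contour_integral (\<Sum>j\<le>degree r. coeff r j * x ^ j *
           (if \<nu> + j + 1 = 0 then 0 else 2 * of_real pi * \<i> *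
              of_nat (((\<nu> + j + 1) + (\<mu> + 1) - 2) choose ((\<nu> + j + 1) - 1))))) \<gamma>"
    by (intro has_contour_integral_sum has_contour_integral_lmul has_contour_integral_binomial_kernel adm) auto
  also have "(\<Sum>j\<le>degree r. coeff r j * x ^ j *
           (if \<nu> + j + 1 = 0 then 0 else 2 * of_real pi * \<i> *
              of_nat (((\<nu> + j + 1) + (\<mu> + 1) - 2) choose ((\<nu> + j + 1) - 1)))) =
     2 * of_real pi * \<i> * (\<Sum>j\<le>degree r. coeff r j * of_nat ((\<nu> + j + \<mu>) choose \<mu>) * x ^ j)"
    unfolding sum_distrib_left
    by (intro sum.cong refl) (simp add: binomial_symmetric[of "\<mu>" "\<nu> + _ + \<mu>"] mult_ac)
  finally show ?thesis
  proof (rule has_contour_integral_eq)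
    fix s assume "s \<in> path_image \<gamma>"
    then have s: "s \<noteq> 0" using path_image_admissible_contour[OF adm] by auto
    have "- int (\<mu> + 1) = - int \<mu> - 1" by simp
    moreover have "s powi (- int (\<nu> + j + 1)) = s powi (- int \<nu>) * (1 / s) ^ j * (1 / s)" for j
      using s by (simp add: power_int_minus power_add field_simps flip: of_nat_Suc of_nat_add del: of_nat_add of_nat_Suc)
    ultimately show "(\<Sum>j\<le>degree r. coeff r j * x ^ j * (s powi (- int (\<nu> + j + 1)) * (1 - s) powi (- int (\<mu> + 1))))
      = s powi (- int \<nu>) * (1 - s) powi (- int \<mu> - 1) * poly r (x / s) * (1 / s)"
      by (simp only:) (simp add: poly_altdef sum_distrib_left sum_distrib_right power_divide mult_ac)
  qed
qed

section \<open>Mellin convolution with a beta weight\<close>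

text \<open>The weight of the transform with respect to Lebesgue measure, with the
  \<open>1 / t\<close> of the measure \<open>dt / t\<close> included. It is real, so weights and
  dual functions can share it.\<close>

definition beta_weight :: "nat \<Rightarrow> nat \<Rightarrow> real \<Rightarrow> real" where
  "beta_weight \<nu> \<mu> t = t ^ \<nu> * (1 - t) ^ (\<mu> - 1) * (1 / t)"

lemma borel_measurable_beta_weight [measurable]: "beta_weight \<nu> \<mu> \<in> borel_measurable borel"
  unfolding beta_weight_def[abs_def] by measurable

text \<open>The positive exponent \<open>\<nu>\<close> absorbs \<open>1 / t\<close>. Boundedness is
  what makes the transform converge at every \<open>y\<close>.\<close>

lemma beta_weight_bounds:
  assumes "1 \<le> \<nu>" "t \<in> {0<..<1}"
  shows "0 \<le> beta_weight \<nu> \<mu> t" "beta_weight \<nu> \<mu> t \<le> 1"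
proof -
  obtain k where k: "\<nu> = Suc k" using assms by (cases \<nu>) auto
  have eq: "beta_weight \<nu> \<mu> t = t ^ k * (1 - t) ^ (\<mu> - 1)" using assms k by (simp add: beta_weight_def)
  show "0 \<le> beta_weight \<nu> \<mu> t" unfolding eq using assms by simp
  have "t ^ k \<le> 1" "(1 - t) ^ (\<mu> - 1) \<le> 1" using assms by (simp_all add: power_le_one)
  then show "beta_weight \<nu> \<mu> t \<le> 1" unfolding eq
    by (intro mult_le_one) (use assms in auto)
qed

lemma set_integrable_lborel_bounded:
  fixes h :: "real \<Rightarrow> real"
  assumes [measurable]: "h \<in> borel_measurable borel"
    and "\<And>t. t \<in> {0<..<1} \<Longrightarrow> \<bar>h t\<bar> \<le> C"
  shows "set_integrable lborel {0<..<1} h"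
  unfolding set_integrable_def
proof (rule Bochner_Integration.integrable_bound)
  show "integrable lborel (\<lambda>t::real. C * indicator {0<..<1} t)"
    by (intro integrable_mult_right integrable_real_indicator) auto
qed (use assms in \<open>auto split: split_indicator intro: order_trans[OF _ abs_ge_self]\<close>)

text \<open>Convergence is wanted at every \<open>y\<close>, since the dual functions are later
  expanded pointwise. For \<open>y > 0\<close> the substitution \<open>u = y / t\<close> maps the
  unit interval onto \<open>{y<..}\<close> with Jacobian \<open>y / t\<^sup>2\<close>, and the
  transformed integrand dominates because the weight is at most
  \<open>1 \<le> 1 / t\<^sup>2\<close>. For the other \<open>y\<close> the integrand is
  bounded.\<close>

lemma set_integrable_mellin_convolution:
  fixes f :: "real \<Rightarrow> real"
  assumes [measurable]: "f \<in> borel_measurable borel"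
    and int: "integrable lborel f" and neg: "\<And>x. x < 0 \<Longrightarrow> f x = 0" and \<nu>: "1 \<le> \<nu>"
  shows "set_integrable lborel {0<..<1} (\<lambda>t. beta_weight \<nu> \<mu> t * f (y / t))"
proof -
  consider "y < 0" | "y = 0" | "y > 0" by linarith
  then show ?thesis
  proof cases
    assume y: "y < 0"
    show ?thesis
    proof (rule set_integrable_lborel_bounded)
      fix t :: real assume "t \<in> {0<..<1}"
      then show "\<bar>beta_weight \<nu> \<mu> t * f (y / t)\<bar> \<le> 0"
        using y neg[of "y / t"] by (simp add: divide_neg_pos)
    qed measurable
  next
    assume y: "y = 0"
    show ?thesis
    proof (rule set_integrable_lborel_bounded)
      fix t :: real assume t: "t \<in> {0<..<1}"
      show "\<bar>beta_weight \<nu> \<mu> t * f (y / t)\<bar> \<le> \<bar>f 0\<bar>"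
        using beta_weight_bounds[OF \<nu> t, of \<mu>] y
        by (simp add: abs_mult mult_left_le_one_le)
    qed measurable
  next
    assume y: "y > 0"
    let ?S = "{0<..<1::real}" and ?g = "\<lambda>t. y / t"
    have img: "?g ` ?S = {y<..}"
    proof safe
      fix u assume "u > y"
      with y show "u \<in> ?g ` ?S" by (intro image_eqI[of _ _ "y / u"]) auto
    qed (use y in \<open>auto simp: field_simps\<close>)
    \<comment> \<open>The substitution rule speaks of Lebesgue integrability; the way back to
      \<open>lborel\<close> uses that the integrand is Borel measurable.\<close>
    have "integrable lebesgue f"
      using int by (simp add: integrable_completion)
    then have "f absolutely_integrable_on ?g ` ?S"
      unfolding img set_integrable_def by (intro integrable_mult_indicator) auto
    then have "(\<lambda>t. \<bar>- y / t\<^sup>2\<bar> * f (y / t)) absolutely_integrable_on ?S"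
      by (subst (asm) absolutely_integrable_change_of_variables_1'[where h = "\<lambda>t. - y / t\<^sup>2"])
        (use y in \<open>auto intro!: derivative_eq_intros inj_onI simp: power2_eq_square\<close>)
    then have "integrable lebesgue (\<lambda>t. indicator ?S t *\<^sub>R (\<bar>- y / t\<^sup>2\<bar> * f (y / t)))"
      by (simp add: set_integrable_def)
    then have "integrable lborel (\<lambda>t. indicator ?S t *\<^sub>R (\<bar>- y / t\<^sup>2\<bar> * f (y / t)))"
      by (subst (asm) integrable_completion) auto
    then have dom: "integrable lborel (\<lambda>t. (1 / y) * (indicator ?S t *\<^sub>R (\<bar>- y / t\<^sup>2\<bar> * f (y / t))))"
      by (rule integrable_mult_right)
    show ?thesis unfolding set_integrable_def
    proof (rule Bochner_Integration.integrable_bound[OF dom], goal_cases)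
      case 2
      have "\<bar>beta_weight \<nu> \<mu> t * f (y / t)\<bar> \<le> (1 / y) * (\<bar>- y / t\<^sup>2\<bar> * \<bar>f (y / t)\<bar>)" if t: "t \<in> ?S" for t
      proof -
        have "beta_weight \<nu> \<mu> t \<le> 1" using beta_weight_bounds[OF \<nu> t] by simp
        also have "1 \<le> 1 / t\<^sup>2" using t by (simp add: power_le_one)
        also have "1 / t\<^sup>2 = (1 / y) * \<bar>- y / t\<^sup>2\<bar>" using y by (simp add: field_simps)
        finally have "beta_weight \<nu> \<mu> t * \<bar>f (y / t)\<bar> \<le> (1 / y) * \<bar>- y / t\<^sup>2\<bar> * \<bar>f (y / t)\<bar>"
          by (intro mult_right_mono) auto
        then show ?thesis using beta_weight_bounds[OF \<nu> t, of \<mu>] by (simp add: abs_mult mult_ac)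
      qed
      then show ?case using y
        by (intro AE_I2) (auto split: split_indicator simp: abs_mult)
    qed measurable
  qed
qed

lemma set_lebesgue_integral_beta:
  assumes "1 \<le> \<mu>"
  shows "set_integrable lborel {0<..<1} (\<lambda>t::real. t ^ k * (1 - t) ^ (\<mu> - 1))"
    and "(LINT t:{0<..<1}|lborel. t ^ k * (1 - t) ^ (\<mu> - 1)) =
           fact k * fact (\<mu> - 1) / (fact (k + \<mu>) :: real)"
proof -
  have "set_integrable lborel {0..1} (\<lambda>t::real. t ^ k * (1 - t) ^ (\<mu> - 1))"
    by (intro borel_integrable_atLeastAtMost' continuous_intros)
  then show si: "set_integrable lborel {0<..<1} (\<lambda>t::real. t ^ k * (1 - t) ^ (\<mu> - 1))"
    by (rule set_integrable_subset) auto
  \<comment> \<open>The endpoints are removed because \<open>powr\<close> differs there from the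
    natural power at exponent 0: \<open>0 powr 0\<close> is 0, whereas \<open>0 ^ 0\<close> is
    1.\<close>
  have "((\<lambda>t. t powr ((real k + 1) - 1) * (1 - t) powr (real \<mu> - 1)) has_integral
            Beta (real k + 1) (real \<mu>)) {0<..<1}"
    using has_integral_Beta_real[of "real k + 1" "real \<mu>"] assms
    by (simp add: has_integral_Icc_iff_Ioo)
  then have "((\<lambda>t. t ^ k * (1 - t) ^ (\<mu> - 1)) has_integral Beta (real k + 1) (real \<mu>)) {0<..<1}"
  proof (rule has_integral_eq[rotated])
    fix t :: real assume "t \<in> {0<..<1}"
    moreover have "real \<mu> - 1 = real (\<mu> - 1)" using assms by simp
    ultimately show "t powr ((real k + 1) - 1) * (1 - t) powr (real \<mu> - 1) = t ^ k * (1 - t) ^ (\<mu> - 1)"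
      by (simp add: powr_realpow del: of_nat_diff)
  qed
  then have "(LINT t:{0<..<1}|lborel. t ^ k * (1 - t) ^ (\<mu> - 1)) = Beta (real k + 1) (real \<mu>)"
    using set_borel_integral_eq_integral(2)[OF si] by (simp add: integral_unique)
  also have "\<dots> = fact k * fact (\<mu> - 1) / (fact (k + \<mu>) :: real)"
  proof -
    obtain d where d: "\<mu> = Suc d" using assms by (cases \<mu>) auto
    show ?thesis
      using Gamma_fact[of k, where 'a = real] Gamma_fact[of d, where 'a = real]
        Gamma_fact[of "k + Suc d", where 'a = real]
      by (simp add: Beta_def d add_ac)
  qed
  finally show "(LINT t:{0<..<1}|lborel. t ^ k * (1 - t) ^ (\<mu> - 1)) =
           fact k * fact (\<mu> - 1) / (fact (k + \<mu>) :: real)" .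
qed

lemma mellin_convolution_real:
  "mellin_convolution \<nu> \<mu> f y = (LINT t:{0<..<1}|lborel. beta_weight \<nu> \<mu> t * f (y / t))" for f :: "real \<Rightarrow> real"
  by (simp add: mellin_convolution_def beta_weight_def)

lemma borel_measurable_mellin_convolution [measurable]:
  fixes f :: "real \<Rightarrow> real"
  assumes [measurable]: "f \<in> borel_measurable borel"
  shows "mellin_convolution \<nu> \<mu> f \<in> borel_measurable borel"
  unfolding mellin_convolution_real[abs_def] set_lebesgue_integral_def by measurable

text \<open>By Fubini: for fixed \<open>t\<close> the scaling \<open>y = t * x\<close> turns the
  inner integral into \<open>t ^ (i + 1)\<close> times the moment of \<open>f\<close>, and the
  powers of \<open>t\<close> left over form the beta integral.\<close>

lemma moment_mellin_convolution:
  fixes f :: "real \<Rightarrow> real"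
  assumes [measurable]: "f \<in> borel_measurable borel"
    and int: "integrable lborel (\<lambda>x. x ^ i * f x)" and \<nu>: "1 \<le> \<nu>" and \<mu>: "1 \<le> \<mu>"
  shows "integrable lborel (\<lambda>y. y ^ i * mellin_convolution \<nu> \<mu> f y)"
    and "(LINT y|lborel. y ^ i * mellin_convolution \<nu> \<mu> f y) =
           fact (\<nu> + i) * fact (\<mu> - 1) / fact (\<nu> + i + \<mu>) * (LINT x|lborel. x ^ i * f x)"
proof -
  define G where "G = (\<lambda>(t::real, y::real). indicator {0<..<1} t * (beta_weight \<nu> \<mu> t * (y ^ i * f (y / t))))"
  define m where "m = (\<lambda>g :: real \<Rightarrow> real. LINT x|lborel. x ^ i * g x)"
  have scale: "integrable lborel (\<lambda>y. y ^ i * g (y / t))"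
    "(LINT y|lborel. y ^ i * g (y / t)) = t ^ (i + 1) * m g"
    if g: "integrable lborel (\<lambda>x. x ^ i * g x)" and t: "t > 0" for g :: "real \<Rightarrow> real" and t
  proof -
    have e: "y ^ i * g (y / t) = t ^ i * ((0 + (1 / t) * y) ^ i * g (0 + (1 / t) * y))" for y
      using t by (simp add: power_divide)
    show "integrable lborel (\<lambda>y. y ^ i * g (y / t))"
      unfolding e by (intro integrable_mult_right lborel_integrable_real_affine[OF g]) (use t in auto)
    have "m g = \<bar>1 / t\<bar> *\<^sub>R (LINT y|lborel. (0 + (1 / t) * y) ^ i * g (0 + (1 / t) * y))"
      unfolding m_def by (rule lborel_integral_real_affine) (use t in auto)
    then have *: "(LINT y|lborel. (0 + (1 / t) * y) ^ i * g (0 + (1 / t) * y)) = t * m g"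
      using t by (simp add: field_simps)
    show "(LINT y|lborel. y ^ i * g (y / t)) = t ^ (i + 1) * m g"
      unfolding e integral_mult_right_zero * by simp
  qed
  have ex: "beta_weight \<nu> \<mu> t * t ^ (i + 1) = t ^ (\<nu> + i) * (1 - t) ^ (\<mu> - 1)" if "t > 0" for t :: real
    using that by (simp add: beta_weight_def power_add)
  have inner: "(LINT y|lborel. indicator {0<..<1} t * (beta_weight \<nu> \<mu> t * (y ^ i * g (y / t)))) =
      indicator {0<..<1} t *\<^sub>R (t ^ (\<nu> + i) * (1 - t) ^ (\<mu> - 1)) * m g"
    if g: "integrable lborel (\<lambda>x. x ^ i * g x)" for t and g :: "real \<Rightarrow> real"
  proof (cases "t \<in> {0<..<1}")
    case True
    then have "t > 0" by simp
    have "(LINT y|lborel. indicator {0<..<1} t * (beta_weight \<nu> \<mu> t * (y ^ i * g (y / t)))) =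
      beta_weight \<nu> \<mu> t * t ^ (i + 1) * m g"
      using True by (simp only: integral_mult_right_zero scale(2)[OF g \<open>t > 0\<close>]) simp
    then show ?thesis unfolding ex[OF \<open>t > 0\<close>] using True by simp
  qed simp
  \<comment> \<open>Fubini also needs the integral of the norm. The factor
    \<open>\<bar>y\<bar> ^ i\<close> is not of the form treated by \<open>inner\<close>, but
    \<open>y ^ i * sgn y ^ i\<close> is, as \<open>sgn (y / t) = sgn y\<close>. So
    \<open>inner\<close> is applied to the function
    \<open>sgn x ^ i * \<bar>f x\<bar>\<close>.\<close>
  have sgn_pow: "y ^ i * (sgn y ^ i * z) = \<bar>y\<bar> ^ i * z" for y z :: real
    by (simp add: abs_sgn power_mult_distrib)
  have absint: "integrable lborel (\<lambda>x. x ^ i * (sgn x ^ i * \<bar>f x\<bar>))"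
  proof -
    have "x ^ i * (sgn x ^ i * \<bar>f x\<bar>) = \<bar>x ^ i * f x\<bar>" for x :: real
      by (simp add: sgn_pow abs_mult power_abs)
    then show ?thesis using integrable_abs[OF int] by simp
  qed
  have Gint: "integrable (lborel \<Otimes>\<^sub>M lborel) G"
  proof (rule lborel_pair.Fubini_integrable)
    show "G \<in> borel_measurable (lborel \<Otimes>\<^sub>M lborel)" unfolding G_def by measurable
    have "(LINT y|lborel. norm (G (t, y))) =
      indicator {0<..<1} t *\<^sub>R (t ^ (\<nu> + i) * (1 - t) ^ (\<mu> - 1)) * m (\<lambda>x. sgn x ^ i * \<bar>f x\<bar>)" for t
    proof -
      have "norm (G (t, y)) = indicator {0<..<1} t * (beta_weight \<nu> \<mu> t * (y ^ i * (sgn (y / t) ^ i * \<bar>f (y / t)\<bar>)))" for y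
      proof (cases "t \<in> {0<..<1}")
        case True
        then have "sgn (y / t) = sgn y" by (simp add: sgn_divide)
        then show ?thesis using True beta_weight_bounds(1)[OF \<nu> True, of \<mu>]
          by (simp add: G_def sgn_pow abs_mult power_abs)
      qed (simp add: G_def)
      then show ?thesis using inner[OF absint] by simp
    qed
    then show "integrable lborel (\<lambda>t. LINT y|lborel. norm (G (t, y)))"
      using set_lebesgue_integral_beta(1)[OF \<mu>, of "\<nu> + i"] by (simp add: set_integrable_def)
    have "integrable lborel (\<lambda>y. G (t, y))" for t
    proof (cases "t \<in> {0<..<1}")
      case True
      then show ?thesis
        unfolding G_def case_prod_conv by (intro integrable_mult_right scale(1)[OF int]) auto
    qed (simp add: G_def)
    then show "AE t in lborel. integrable lborel (\<lambda>y. G (t, y))" by simp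
  qed
  then have Gint': "integrable (lborel \<Otimes>\<^sub>M lborel) (case_prod (\<lambda>t y. G (t, y)))" by simp
  have outer: "(LINT t|lborel. G (t, y)) = y ^ i * mellin_convolution \<nu> \<mu> f y" for y
  proof -
    have "G (t, y) = y ^ i * (indicator {0<..<1} t *\<^sub>R (beta_weight \<nu> \<mu> t * f (y / t)))" for t
      by (simp add: G_def mult_ac)
    then show ?thesis by (simp add: mellin_convolution_real set_lebesgue_integral_def)
  qed
  show "integrable lborel (\<lambda>y. y ^ i * mellin_convolution \<nu> \<mu> f y)"
    using lborel_pair.integrable_snd[OF Gint'] by (simp add: outer)
  have "(LINT y|lborel. y ^ i * mellin_convolution \<nu> \<mu> f y) = (LINT t|lborel. LINT y|lborel. G (t, y))"
    using lborel_pair.Fubini_integral[OF Gint'] by (simp add: outer)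
  also have "\<dots> = (LINT t|lborel. indicator {0<..<1} t *\<^sub>R (t ^ (\<nu> + i) * (1 - t) ^ (\<mu> - 1)) * m f)"
    unfolding G_def case_prod_conv inner[OF int] ..
  also have "\<dots> = (LINT t:{0<..<1}|lborel. t ^ (\<nu> + i) * (1 - t) ^ (\<mu> - 1)) * m f"
    by (simp add: set_lebesgue_integral_def)
  finally show "(LINT y|lborel. y ^ i * mellin_convolution \<nu> \<mu> f y) =
           fact (\<nu> + i) * fact (\<mu> - 1) / fact (\<nu> + i + \<mu>) * (LINT x|lborel. x ^ i * f x)"
    unfolding set_lebesgue_integral_beta(2)[OF \<mu>] m_def .
qed

text \<open>Linearity needs every summand to be integrable at the given \<open>y\<close>, because a
  divergent Bochner integral has the value 0 by convention. The integrability itself is used again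
  for the kernel formula.\<close>

lemma mellin_convolution_span:
  fixes f :: "nat \<Rightarrow> real \<Rightarrow> real"
  assumes "\<And>k. k < n \<Longrightarrow> f k \<in> borel_measurable borel" "\<And>k. k < n \<Longrightarrow> integrable lborel (f k)"
    and "\<And>k x. k < n \<Longrightarrow> x < 0 \<Longrightarrow> f k x = 0" and "1 \<le> \<nu>"
  shows "set_integrable lborel {0<..<1}
           (\<lambda>t. beta_weight \<nu> \<mu> t *\<^sub>R (\<Sum>i<n. c i * complex_of_real (f i (y / t))))"
    and "mellin_convolution \<nu> \<mu> (\<lambda>x. \<Sum>i<n. c i * complex_of_real (f i x)) y =
           (\<Sum>i<n. c i * complex_of_real (mellin_convolution \<nu> \<mu> (f i) y))"
proof -
  have eq: "indicator {0<..<1} t *\<^sub>R (beta_weight \<nu> \<mu> t *\<^sub>R (\<Sum>i<n. c i * complex_of_real (f i (y / t)))) =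
    (\<Sum>i<n. c i * complex_of_real (indicator {0<..<1} t *\<^sub>R (beta_weight \<nu> \<mu> t * f i (y / t))))" for t
    by (simp add: scaleR_conv_of_real sum_distrib_left ac_simps)
  have int: "integrable lborel (\<lambda>t. indicator {0<..<1} t *\<^sub>R (beta_weight \<nu> \<mu> t * f i (y / t)))" if "i < n" for i
    using set_integrable_mellin_convolution[of "f i" \<nu> \<mu> y] that assms by (simp add: set_integrable_def)
  have "has_bochner_integral lborel
      (\<lambda>t. \<Sum>i<n. c i * complex_of_real (indicator {0<..<1} t *\<^sub>R (beta_weight \<nu> \<mu> t * f i (y / t))))
      (\<Sum>i<n. c i * complex_of_real (mellin_convolution \<nu> \<mu> (f i) y))"
    unfolding mellin_convolution_real set_lebesgue_integral_def
    by (intro has_bochner_integral_sum has_bochner_integral_mult_right has_bochner_integral_of_real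
        has_bochner_integral_integrable int) auto
  then show "set_integrable lborel {0<..<1}
           (\<lambda>t. beta_weight \<nu> \<mu> t *\<^sub>R (\<Sum>i<n. c i * complex_of_real (f i (y / t))))"
    and "mellin_convolution \<nu> \<mu> (\<lambda>x. \<Sum>i<n. c i * complex_of_real (f i x)) y =
           (\<Sum>i<n. c i * complex_of_real (mellin_convolution \<nu> \<mu> (f i) y))"
    unfolding set_integrable_def mellin_convolution_def[of \<nu> \<mu> "\<lambda>x. \<Sum>i<n. c i * complex_of_real (f i x)"]
      set_lebesgue_integral_def beta_weight_def[symmetric] eq
    by (simp_all only: has_bochner_integral_iff)
qed

text \<open>Biorthogonality becomes a statement about finitely many moments, so the systems for
  \<open>f\<close> and \<open>F\<close> can be compared moment by moment.\<close>

lemma integral_poly_times_span: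
  fixes f :: "nat \<Rightarrow> real \<Rightarrow> real"
  assumes "\<And>i a. i < n \<Longrightarrow> a \<le> degree r \<Longrightarrow> integrable lborel (\<lambda>x. x ^ a * f i x)"
  shows "integrable lborel (\<lambda>x. poly r (complex_of_real x) * (\<Sum>i<n. c i * complex_of_real (f i x)))"
    and "(LINT x|lborel. poly r (complex_of_real x) * (\<Sum>i<n. c i * complex_of_real (f i x))) =
           (\<Sum>a\<le>degree r. \<Sum>i<n. coeff r a * c i * complex_of_real (LINT x|lborel. x ^ a * f i x))"
proof -
  have eq: "poly r (complex_of_real x) * (\<Sum>i<n. c i * complex_of_real (f i x)) =
    (\<Sum>a\<le>degree r. \<Sum>i<n. coeff r a * c i * complex_of_real (x ^ a * f i x))" for x
    unfolding poly_altdef sum_product by (simp add: mult_ac)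
  have "has_bochner_integral lborel
      (\<lambda>x. \<Sum>a\<le>degree r. \<Sum>i<n. coeff r a * c i * complex_of_real (x ^ a * f i x))
      (\<Sum>a\<le>degree r. \<Sum>i<n. coeff r a * c i * complex_of_real (LINT x|lborel. x ^ a * f i x))"
    by (intro has_bochner_integral_sum has_bochner_integral_mult_right has_bochner_integral_of_real
        has_bochner_integral_integrable assms) auto
  then show "integrable lborel (\<lambda>x. poly r (complex_of_real x) * (\<Sum>i<n. c i * complex_of_real (f i x)))"
    and "(LINT x|lborel. poly r (complex_of_real x) * (\<Sum>i<n. c i * complex_of_real (f i x))) =
           (\<Sum>a\<le>degree r. \<Sum>i<n. coeff r a * c i * complex_of_real (LINT x|lborel. x ^ a * f i x))"
    unfolding eq by (simp_all only: has_bochner_integral_iff)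
qed

section \<open>Determinants and permutations\<close>

lemma det_mat:
  "det (mat n n f) = (\<Sum>p | p permutes {..<n}. of_int (sign p) * (\<Prod>i<n. f (i, p i)))"
proof -
  have "(\<Prod>i<n. mat n n f $$ (i, p i)) = (\<Prod>i<n. f (i, p i))" if "p permutes {..<n}" for p
    using permutes_in_image[OF that] by (intro prod.cong) auto
  then show ?thesis
    by (subst det_def'[of _ n]) (auto simp: lessThan_atLeast0 intro!: sum.cong)
qed

lemma of_real_det:
  "of_real (det (mat n n f)) = (det (mat n n (\<lambda>ij. of_real (f ij))) :: 'a :: {real_algebra_1, comm_ring_1})"
  by (simp add: det_mat)

lemma borel_measurable_det [measurable (raw)]:
  fixes f :: "'a \<Rightarrow> nat \<times> nat \<Rightarrow> 'b :: {real_normed_field, second_countable_topology}"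
  assumes "\<And>i j. i < n \<Longrightarrow> j < n \<Longrightarrow> (\<lambda>x. f x (i, j)) \<in> borel_measurable M"
  shows "(\<lambda>x. det (mat n n (f x))) \<in> borel_measurable M"
  unfolding det_mat
proof (intro borel_measurable_sum borel_measurable_times borel_measurable_prod borel_measurable_const)
  fix p i assume "p \<in> {p. p permutes {..<n}}" "i \<in> {..<n}"
  then show "(\<lambda>x. f x (i, p i)) \<in> borel_measurable M"
    using permutes_in_image[of p "{..<n}" i] by (intro assms) auto
qed

lemma det_columns_span:
  fixes g :: "nat \<Rightarrow> nat \<Rightarrow> 'a :: comm_ring_1"
  shows "det (mat n n (\<lambda>(i, j). \<Sum>a<n. g i a * c a j)) =
           det (mat n n (\<lambda>(i, a). g i a)) * det (mat n n (\<lambda>(a, j). c a j))"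
proof -
  have "mat n n (\<lambda>(i, j). \<Sum>a<n. g i a * c a j) = mat n n (\<lambda>(i, a). g i a) * mat n n (\<lambda>(a, j). c a j)"
    by (rule eq_matI) (auto simp: scalar_prod_def lessThan_atLeast0)
  then show ?thesis by (simp add: det_mult[of _ n])
qed

text \<open>In the monomial basis the columns have an upper triangular coefficient matrix with the
  leading coefficients on its diagonal.\<close>

lemma det_poly_columns:
  assumes "\<And>j. j < n \<Longrightarrow> degree (r j) = j"
  shows "det (mat n n (\<lambda>(i, j). poly (r j) (x i))) =
           (\<Prod>j<n. lead_coeff (r j)) * det (mat n n (\<lambda>(i, j). x i ^ j :: 'a :: comm_ring_1))"
proof -
  have "poly (r j) (x i) = (\<Sum>a<n. x i ^ a * coeff (r j) a)" if "j < n" for i j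
  proof -
    have "poly (r j) (x i) = (\<Sum>a\<le>j. coeff (r j) a * x i ^ a)"
      using assms[OF that] by (simp add: poly_altdef)
    also have "\<dots> = (\<Sum>a<n. x i ^ a * coeff (r j) a)"
      using that assms[OF that] by (intro sum.mono_neutral_cong_left) (auto simp: coeff_eq_0 mult.commute)
    finally show ?thesis .
  qed
  then have "mat n n (\<lambda>(i, j). poly (r j) (x i)) = mat n n (\<lambda>(i, j). \<Sum>a<n. x i ^ a * coeff (r j) a)"
    by (intro eq_matI) auto
  then have "det (mat n n (\<lambda>(i, j). poly (r j) (x i))) =
      det (mat n n (\<lambda>(i, j). x i ^ j)) * det (mat n n (\<lambda>(a, j). coeff (r j) a))"
    by (simp add: det_columns_span)
  also have "det (mat n n (\<lambda>(a, j). coeff (r j) a)) = (\<Prod>j<n. lead_coeff (r j))"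
    using assms by (subst det_upper_triangular[of _ n])
      (auto simp: upper_triangular_def coeff_eq_0 prod_list_diag_prod lessThan_atLeast0 intro!: prod.cong)
  finally show ?thesis by (simp add: mult.commute)
qed

text \<open>By a triangular change of columns the last one may hold the monic polynomial whose roots
  are the earlier points. It vanishes in all rows but the last, so the expansion along this column
  has a single term, which supplies the new factors.\<close>

lemma det_vandermonde:
  "det (mat n n (\<lambda>(i, j). x i ^ j)) = (\<Prod>k<n. \<Prod>j<k. x k - x j :: 'a :: idom)"
proof (induction n)
  case (Suc n)
  define r where "r j = (if j < n then monom 1 j else (\<Prod>i<n. [:- x i, 1:]))" for j
  have deg: "degree (r j) = j" "lead_coeff (r j) = 1" if "j < Suc n" for j
  proof -
    have "degree (\<Prod>i<n. [:- x i, 1:]) = n" by (subst degree_prod_eq_sum_degree) auto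
    then show "degree (r j) = j" using that by (auto simp: r_def degree_monom_eq)
    show "lead_coeff (r j) = 1" by (auto simp: r_def degree_monom_eq lead_coeff_prod)
  qed
  let ?A = "mat (Suc n) (Suc n) (\<lambda>(i, j). poly (r j) (x i))"
  have "det ?A = det (mat (Suc n) (Suc n) (\<lambda>(i, j). x i ^ j))"
    by (subst det_poly_columns) (use deg in auto)
  moreover have "det ?A = (\<Sum>i<Suc n. ?A $$ (i, n) * cofactor ?A i n)"
    by (rule laplace_expansion_column) auto
  moreover have "\<dots> = ?A $$ (n, n) * cofactor ?A n n"
  proof -
    have "?A $$ (i, n) = 0" if "i < n" for i
      using that by (auto simp: r_def poly_prod)
    then show ?thesis by simp
  qed
  moreover have "mat_delete ?A n n = mat n n (\<lambda>(i, j). x i ^ j)"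
    by (rule eq_matI) (auto simp: mat_delete_def r_def poly_monom)
  then have "cofactor ?A n n = (\<Prod>k<n. \<Prod>j<k. x k - x j)"
    by (simp add: cofactor_def Suc.IH flip: mult_2)
  moreover have "?A $$ (n, n) = (\<Prod>j<n. x n - x j)"
    by (simp add: r_def poly_prod)
  ultimately show ?case by simp
qed simp

text \<open>Triangular column operations reduce the first determinant to the Vandermonde product,
  and the span relation reduces the second to the determinant of the weights. The constant
  \<open>c\<close> stays implicit, as comparing total masses determines it later.\<close>

lemma biorthogonal_det_density:
  assumes "biorthogonal_system n f p q" "Z \<noteq> 0"
  obtains c where "\<And>x. det (mat n n (\<lambda>(i, j). p j (of_real (x i)))) * det (mat n n (\<lambda>(i, j). q j (x i))) =
      c * of_real (polynomial_ensemble_density n f Z x)"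
proof -
  from assms obtain r where r: "\<And>j. j < n \<Longrightarrow> degree (r j) = j" "\<And>j z. j < n \<Longrightarrow> p j z = poly (r j) z"
    unfolding biorthogonal_system_def by metis
  from assms obtain C where C: "\<And>j x. j < n \<Longrightarrow> q j x = (\<Sum>i<n. C j i * complex_of_real (f i x))"
    unfolding biorthogonal_system_def by metis
  define c where "c = (\<Prod>j<n. lead_coeff (r j)) * det (mat n n (\<lambda>(a, j). C j a)) * of_real Z"
  have "det (mat n n (\<lambda>(i, j). p j (of_real (x i)))) * det (mat n n (\<lambda>(i, j). q j (x i))) =
      c * of_real (polynomial_ensemble_density n f Z x)" for x
  proof -
    have "mat n n (\<lambda>(i, j). p j (of_real (x i))) = mat n n (\<lambda>(i, j). poly (r j) (of_real (x i)))"
      using r by (intro eq_matI) auto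
    then have p: "det (mat n n (\<lambda>(i, j). p j (of_real (x i)))) =
        (\<Prod>j<n. lead_coeff (r j)) * of_real (vandermonde n x)"
      using r(1) by (simp add: det_poly_columns det_vandermonde vandermonde_def)
    have "mat n n (\<lambda>(i, j). q j (x i)) = mat n n (\<lambda>(i, j). \<Sum>a<n. of_real (f a (x i)) * C j a)"
      using C by (intro eq_matI) (auto simp: mult.commute)
    then have q: "det (mat n n (\<lambda>(i, j). q j (x i))) =
        of_real (det (mat n n (\<lambda>(i, k). f k (x i)))) * det (mat n n (\<lambda>(a, j). C j a))"
      by (simp only: det_columns_span of_real_det prod.case_distrib[of complex_of_real])
    show ?thesis unfolding p q c_def polynomial_ensemble_density_def using \<open>Z \<noteq> 0\<close> by simp
  qed
  then show thesis by (rule that)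
qed

text \<open>The kernel sum in every row is expanded over index functions \<open>\<phi>\<close>. If
  \<open>\<phi>\<close> repeats a value, two columns of the matrix of dual functions coincide. What
  remains are the injective tuples, the index set that also occurs in
  \<open>determinantal\<close>.\<close>

lemma det_correlation_kernel:
  "det (mat r r (\<lambda>(a, b). correlation_kernel n p q (of_real (x a)) (x b))) =
     (\<Sum>\<phi> | \<phi> \<in> {..<r} \<rightarrow>\<^sub>E {..<n} \<and> inj_on \<phi> {..<r}. \<Sum>\<rho> | \<rho> permutes {..<r}.
        of_int (sign \<rho>) * (\<Prod>i<r. p (\<phi> i) (of_real (x i)) * q (\<phi> (\<rho> i)) (x i)))"
    (is "_ = (\<Sum>\<phi> | ?inj \<phi>. ?S \<phi>)")
proof -
  have "det (mat r r (\<lambda>(a, b). correlation_kernel n p q (of_real (x a)) (x b))) =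
      (\<Sum>\<rho> | \<rho> permutes {..<r}. of_int (sign \<rho>) *
         (\<Sum>\<phi>\<in>{..<r} \<rightarrow>\<^sub>E {..<n}. \<Prod>i<r. p (\<phi> i) (of_real (x i)) * q (\<phi> i) (x (\<rho> i))))"
    unfolding det_mat correlation_kernel_def prod.case by (simp add: prod_sum_PiE)
  also have "\<dots> = (\<Sum>\<phi>\<in>{..<r} \<rightarrow>\<^sub>E {..<n}. \<Sum>\<rho> | \<rho> permutes {..<r}.
      of_int (sign \<rho>) * (\<Prod>i<r. p (\<phi> i) (of_real (x i)) * q (\<phi> i) (x (\<rho> i))))"
    unfolding sum_distrib_left by (rule sum.swap)
  also have "\<dots> = (\<Sum>\<phi>\<in>{..<r} \<rightarrow>\<^sub>E {..<n}. ?S \<phi>)"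
  proof (rule sum.cong[OF refl])
    fix \<phi>
    show "(\<Sum>\<rho> | \<rho> permutes {..<r}. of_int (sign \<rho>) * (\<Prod>i<r. p (\<phi> i) (of_real (x i)) * q (\<phi> i) (x (\<rho> i)))) = ?S \<phi>"
    \<comment> \<open>Replacing \<open>\<rho>\<close> by its inverse moves the permutation from the
      points to the indices of \<open>q\<close>. Then factor number \<open>i\<close> involves
      \<open>x i\<close> alone, as integration over a product measure demands.\<close>
    proof (subst sum_permutations_inverse, rule sum.cong[OF refl])
      fix \<rho> assume "\<rho> \<in> {\<rho>. \<rho> permutes {..<r}}"
      then have \<rho>: "\<rho> permutes {..<r}" by simp
      have "(\<Prod>i<r. q (\<phi> i) (x (Hilbert_Choice.inv \<rho> i))) = (\<Prod>i<r. q (\<phi> (\<rho> i)) (x (Hilbert_Choice.inv \<rho> (\<rho> i))))"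
        by (rule prod.permute[OF \<rho>, of "\<lambda>i. q (\<phi> i) (x (Hilbert_Choice.inv \<rho> i))", unfolded o_def])
      then show "of_int (sign (Hilbert_Choice.inv \<rho>)) * (\<Prod>i<r. p (\<phi> i) (of_real (x i)) * q (\<phi> i) (x (Hilbert_Choice.inv \<rho> i))) =
          of_int (sign \<rho>) * (\<Prod>i<r. p (\<phi> i) (of_real (x i)) * q (\<phi> (\<rho> i)) (x i))"
        using \<rho> by (simp add: sign_inverse permutes_imp_permutation[of "{..<r}"] prod.distrib permutes_inverses)
    qed
  qed
  also have "\<dots> = (\<Sum>\<phi> | ?inj \<phi>. ?S \<phi>)"
  proof (rule sum.mono_neutral_right)
    show "\<forall>\<phi>\<in>({..<r} \<rightarrow>\<^sub>E {..<n}) - {\<phi>. ?inj \<phi>}. ?S \<phi> = 0"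
    proof
      fix \<phi> assume "\<phi> \<in> ({..<r} \<rightarrow>\<^sub>E {..<n}) - {\<phi>. ?inj \<phi>}"
      then obtain a b where ab: "a < r" "b < r" "a \<noteq> b" "\<phi> a = \<phi> b" by (auto simp: inj_on_def)
      have "?S \<phi> = (\<Prod>i<r. p (\<phi> i) (of_real (x i))) * det (mat r r (\<lambda>(i, a). q (\<phi> a) (x i)))"
        unfolding det_mat sum_distrib_left prod.distrib prod.case by (simp add: mult_ac)
      also have "det (mat r r (\<lambda>(i, a). q (\<phi> a) (x i))) = 0"
      proof -
        let ?A = "mat r r (\<lambda>(i, a). q (\<phi> a) (x i))"
        have "det ?A = det (transpose_mat ?A)" by (rule det_transpose[symmetric]) auto
        also have "\<dots> = 0"
          by (rule det_identical_rows[of _ r a b]) (use ab in \<open>auto intro!: eq_vecI\<close>)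
        finally show ?thesis .
      qed
      finally show "?S \<phi> = 0" by simp
    qed
  qed (auto intro!: finite_PiE)
  finally show ?thesis .
qed

text \<open>The extensions form a coset. One extension \<open>\<sigma>\<^sub>0\<close> exists
  because the complements of domain and image have the same size, and the others are
  \<open>\<sigma>\<^sub>0 \<circ> \<pi>\<close> with \<open>\<pi>\<close> fixing
  \<open>{..<r}\<close> pointwise.\<close>

lemma card_permutes_extending:
  assumes \<phi>: "\<phi> \<in> {..<r} \<rightarrow>\<^sub>E {..<n}" "inj_on \<phi> {..<r}"
  shows "card {\<sigma>. \<sigma> permutes {..<n} \<and> restrict \<sigma> {..<r} = \<phi>} = fact (n - r)"
proof -
  have sub: "\<phi> ` {..<r} \<subseteq> {..<n}" using PiE_mem[OF \<phi>(1)] by blast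
  have rn: "r \<le> n" using card_mono[OF _ sub] card_image[OF \<phi>(2)] by simp
  have "card ({..<n} - {..<r}) = card ({..<n} - \<phi> ` {..<r})"
    using rn card_image[OF \<phi>(2)] card_Diff_subset[of "{..<r}" "{..<n}"]
      card_Diff_subset[OF finite_imageI[OF finite_lessThan] sub] by simp
  then obtain h where h: "bij_betw h ({..<n} - {..<r}) ({..<n} - \<phi> ` {..<r})"
    using finite_same_card_bij[of "{..<n} - {..<r}" "{..<n} - \<phi> ` {..<r}"] by auto
  have "bij_betw (\<lambda>i. if i \<in> {..<r} then \<phi> i else h i) ({..<r} \<union> ({..<n} - {..<r}))
      (\<phi> ` {..<r} \<union> ({..<n} - \<phi> ` {..<r}))"
    by (rule bij_betw_disjoint_Un[OF inj_on_imp_bij_betw[OF \<phi>(2)] h]) auto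
  moreover have "{..<r} \<union> ({..<n} - {..<r}) = {..<n}" "\<phi> ` {..<r} \<union> ({..<n} - \<phi> ` {..<r}) = {..<n}"
    using sub rn by auto
  ultimately have bij: "bij_betw (\<lambda>i. if i \<in> {..<r} then \<phi> i else h i) {..<n} {..<n}" by simp
  define \<sigma>\<^sub>0 where "\<sigma>\<^sub>0 = restrict_id (\<lambda>i. if i \<in> {..<r} then \<phi> i else h i) {..<n}"
  have \<sigma>\<^sub>0: "\<sigma>\<^sub>0 permutes {..<n}" unfolding \<sigma>\<^sub>0_def by (rule permutes_restrict_id[OF bij])
  have \<sigma>\<^sub>0\<phi>: "\<sigma>\<^sub>0 i = \<phi> i" if "i < r" for i using that rn by (simp add: \<sigma>\<^sub>0_def restrict_id_def)
  have "{\<sigma>. \<sigma> permutes {..<n} \<and> restrict \<sigma> {..<r} = \<phi>} = (\<lambda>\<pi>. \<sigma>\<^sub>0 \<circ> \<pi>) ` {\<pi>. \<pi> permutes {r..<n}}"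
  proof safe
    fix \<sigma> assume \<sigma>: "\<sigma> permutes {..<n}" "\<phi> = restrict \<sigma> {..<r}"
    have "Hilbert_Choice.inv \<sigma>\<^sub>0 \<circ> \<sigma> permutes {r..<n}"
    proof (rule permutes_superset)
      show "Hilbert_Choice.inv \<sigma>\<^sub>0 \<circ> \<sigma> permutes {..<n}" by (intro permutes_compose \<sigma> permutes_inv \<sigma>\<^sub>0)
      fix i assume "i \<in> {..<n} - {r..<n}"
      then have "\<sigma> i = \<sigma>\<^sub>0 i" using \<sigma>\<^sub>0\<phi>[of i] \<sigma>(2) by auto
      then show "(Hilbert_Choice.inv \<sigma>\<^sub>0 \<circ> \<sigma>) i = i" by (simp add: permutes_inverses[OF \<sigma>\<^sub>0])
    qed
    then show "\<sigma> \<in> (\<lambda>\<pi>. \<sigma>\<^sub>0 \<circ> \<pi>) ` {\<pi>. \<pi> permutes {r..<n}}"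
      by (intro image_eqI[of _ _ "Hilbert_Choice.inv \<sigma>\<^sub>0 \<circ> \<sigma>"]) (auto simp: fun_eq_iff permutes_inverses[OF \<sigma>\<^sub>0])
  next
    fix \<pi> assume \<pi>: "\<pi> permutes {r..<n}"
    then show "\<sigma>\<^sub>0 \<circ> \<pi> permutes {..<n}"
      by (intro permutes_compose \<sigma>\<^sub>0 permutes_subset[OF \<pi>]) auto
    show "restrict (\<sigma>\<^sub>0 \<circ> \<pi>) {..<r} = \<phi>"
      using \<phi>(1) \<sigma>\<^sub>0\<phi> permutes_not_in[OF \<pi>] by (intro ext) (auto simp: restrict_def PiE_def extensional_def)
  qed
  moreover have "inj_on (\<lambda>\<pi>. \<sigma>\<^sub>0 \<circ> \<pi>) {\<pi>. \<pi> permutes {r..<n}}"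
    using permutes_inj[OF \<sigma>\<^sub>0] by (auto simp: inj_on_def fun_eq_iff)
  ultimately show ?thesis by (simp add: card_image card_permutations)
qed

text \<open>This serves twice: for the random relabelling of the points and for the outer
  permutation of the two Leibniz expansions. In both cases only the first \<open>r\<close> values
  matter, and the common factor \<open>fact (n - r)\<close> cancels in the end.\<close>

lemma sum_permutes_restrict:
  fixes h :: "(nat \<Rightarrow> nat) \<Rightarrow> 'a :: comm_semiring_1"
  assumes "r \<le> n"
  shows "(\<Sum>\<sigma> | \<sigma> permutes {..<n}. h (restrict \<sigma> {..<r})) =
    of_nat (fact (n - r)) * (\<Sum>\<phi> | \<phi> \<in> {..<r} \<rightarrow>\<^sub>E {..<n} \<and> inj_on \<phi> {..<r}. h \<phi>)"
proof -
  let ?T = "{\<phi>. \<phi> \<in> {..<r} \<rightarrow>\<^sub>E {..<n} \<and> inj_on \<phi> {..<r}}" and ?P = "{\<sigma>. \<sigma> permutes {..<n}}"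
  have "(\<Sum>\<sigma>\<in>?P. h (restrict \<sigma> {..<r})) =
      (\<Sum>\<phi>\<in>?T. \<Sum>\<sigma> | \<sigma> \<in> ?P \<and> restrict \<sigma> {..<r} = \<phi>. h (restrict \<sigma> {..<r}))"
  proof (rule sum.group[of ?P ?T "\<lambda>\<sigma>. restrict \<sigma> {..<r}" "\<lambda>\<sigma>. h (restrict \<sigma> {..<r})", symmetric])
    show "(\<lambda>\<sigma>. restrict \<sigma> {..<r}) ` ?P \<subseteq> ?T"
    proof (rule image_subsetI)
      fix \<sigma> assume "\<sigma> \<in> ?P"
      then have \<sigma>: "\<sigma> permutes {..<n}" by simp
      have "\<sigma> i < n" if "i < r" for i
        using permutes_in_image[OF \<sigma>, of i] that assms by simp
      moreover have "inj_on (restrict \<sigma> {..<r}) {..<r}"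
        using permutes_inj[OF \<sigma>] by (auto simp: inj_on_def inj_def)
      ultimately show "restrict \<sigma> {..<r} \<in> ?T" by auto
    qed
    show "finite ?T" by (rule finite_subset[of _ "{..<r} \<rightarrow>\<^sub>E {..<n}"]) (auto intro: finite_PiE)
  qed (simp add: finite_permutations)
  also have "\<dots> = (\<Sum>\<phi>\<in>?T. of_nat (fact (n - r)) * h \<phi>)"
  proof (rule sum.cong[OF refl])
    fix \<phi> assume \<phi>: "\<phi> \<in> ?T"
    have "(\<Sum>\<sigma> | \<sigma> \<in> ?P \<and> restrict \<sigma> {..<r} = \<phi>. h (restrict \<sigma> {..<r})) =
      (\<Sum>\<sigma> | \<sigma> \<in> ?P \<and> restrict \<sigma> {..<r} = \<phi>. h \<phi>)" by (intro sum.cong) auto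
    then show "(\<Sum>\<sigma> | \<sigma> \<in> ?P \<and> restrict \<sigma> {..<r} = \<phi>. h (restrict \<sigma> {..<r})) = of_nat (fact (n - r)) * h \<phi>"
      using card_permutes_extending[of \<phi> r n] \<phi> by simp
  qed
  finally show ?thesis by (simp add: sum_distrib_left)
qed

section \<open>Polynomial ensembles\<close>

text \<open>Only \<open>g\<close> couples the variables, and only the first \<open>r\<close> of
  them. Its boundedness reduces integrability to that of a product of one-variable
  functions.\<close>

lemma product_integral_marginal:
  fixes h :: "nat \<Rightarrow> real \<Rightarrow> complex" and g :: "(nat \<Rightarrow> real) \<Rightarrow> complex"
  assumes g: "g \<in> borel_measurable (PiM {..<r} (\<lambda>_. lborel))" "bounded (range g)" and rn: "r \<le> n"
    and h: "\<And>i. i < n \<Longrightarrow> integrable lborel (h i)"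
  shows "integrable (PiM {..<r} (\<lambda>_. lborel)) (\<lambda>x. g x * (\<Prod>i<r. h i (x i)))"
    and "integrable (PiM {..<n} (\<lambda>_. lborel)) (\<lambda>x. g (restrict x {..<r}) * (\<Prod>i<n. h i (x i)))"
    and "(LINT x|PiM {..<n} (\<lambda>_. lborel). g (restrict x {..<r}) * (\<Prod>i<n. h i (x i))) =
           (LINT x|PiM {..<r} (\<lambda>_. lborel). g x * (\<Prod>i<r. h i (x i))) * (\<Prod>i=r..<n. integral\<^sup>L lborel (h i))"
proof -
  interpret product_sigma_finite "\<lambda>_ :: nat. lborel :: real measure" ..
  obtain C where C: "\<And>x. norm (g x) \<le> C" using g(2) by (auto simp: bounded_iff)
  have bnd: "integrable N (\<lambda>x. u x * v x)"
    if "u \<in> borel_measurable N" "\<And>x. norm (u x) \<le> C" "integrable N v" for N and u v :: "(nat \<Rightarrow> real) \<Rightarrow> complex"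
  proof (rule Bochner_Integration.integrable_bound)
    show "integrable N (\<lambda>x. C * norm (v x))" using that by (intro integrable_mult_right integrable_norm)
    show "AE x in N. norm (u x * v x) \<le> norm (C * norm (v x))"
      using that(2) order_trans[OF norm_ge_zero that(2)]
      by (intro AE_I2) (simp add: norm_mult abs_mult mult_right_mono)
  qed (use that in measurable)
  show "integrable (PiM {..<r} (\<lambda>_. lborel)) (\<lambda>x. g x * (\<Prod>i<r. h i (x i)))"
    by (intro bnd g C product_integrable_prod) (use h rn in auto)
  have [measurable]: "(\<lambda>x. g (restrict x {..<r})) \<in> borel_measurable (PiM {..<n} (\<lambda>_. lborel))"
    by (rule measurable_compose[OF measurable_restrict_subset g(1)]) (use rn in auto)
  show int: "integrable (PiM {..<n} (\<lambda>_. lborel)) (\<lambda>x. g (restrict x {..<r}) * (\<Prod>i<n. h i (x i)))"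
    by (intro bnd C product_integrable_prod) (use h in auto)
  have disj: "{..<r} \<inter> {r..<n} = {}" by auto
  have un: "{..<r} \<union> {r..<n} = {..<n}" using rn by auto
  have "(LINT x|PiM {..<n} (\<lambda>_. lborel). g (restrict x {..<r}) * (\<Prod>i<n. h i (x i))) =
    (LINT x|PiM {..<r} (\<lambda>_. lborel). LINT y|PiM {r..<n} (\<lambda>_. lborel).
      g (restrict (merge {..<r} {r..<n} (x, y)) {..<r}) * (\<Prod>i<n. h i (merge {..<r} {r..<n} (x, y) i)))"
    by (rule product_integral_fold[of "{..<r}" "{r..<n}", unfolded un, OF _ _ _ int]) auto
  also have "\<dots> = (LINT x|PiM {..<r} (\<lambda>_. lborel). g x * (\<Prod>i<r. h i (x i)) *
      (\<Prod>i=r..<n. integral\<^sup>L lborel (h i)))"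
  proof (rule Bochner_Integration.integral_cong[OF refl])
    fix x assume x: "x \<in> space (PiM {..<r} (\<lambda>_. lborel :: real measure))"
    have "restrict x {..<r} = x"
      using x by (intro extensional_restrict) (auto simp: space_PiM PiE_def)
    moreover have "(\<Prod>i<n. h i (merge {..<r} {r..<n} (x, y) i)) = (\<Prod>i<r. h i (x i)) * (\<Prod>i=r..<n. h i (y i))" for y
      unfolding un[symmetric]
      by (subst prod.union_disjoint) (auto simp: merge_def intro!: arg_cong2[of _ _ _ _ "(*)"] prod.cong)
    ultimately have "g (restrict (merge {..<r} {r..<n} (x, y)) {..<r}) * (\<Prod>i<n. h i (merge {..<r} {r..<n} (x, y) i)) =
        g x * (\<Prod>i<r. h i (x i)) * (\<Prod>i=r..<n. h i (y i))" for y
      by (simp only: restrict_merge(1)[OF disj] mult.assoc)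
    then show "(LINT y|PiM {r..<n} (\<lambda>_. lborel).
      g (restrict (merge {..<r} {r..<n} (x, y)) {..<r}) * (\<Prod>i<n. h i (merge {..<r} {r..<n} (x, y) i))) =
      g x * (\<Prod>i<r. h i (x i)) * (\<Prod>i=r..<n. integral\<^sup>L lborel (h i))"
      using product_integral_prod[of "{r..<n}" h] h by simp
  qed
  also have "\<dots> = (LINT x|PiM {..<r} (\<lambda>_. lborel). g x * (\<Prod>i<r. h i (x i))) * (\<Prod>i=r..<n. integral\<^sup>L lborel (h i))"
    by simp
  finally show "(LINT x|PiM {..<n} (\<lambda>_. lborel). g (restrict x {..<r}) * (\<Prod>i<n. h i (x i))) =
           (LINT x|PiM {..<r} (\<lambda>_. lborel). g x * (\<Prod>i<r. h i (x i))) * (\<Prod>i=r..<n. integral\<^sup>L lborel (h i))" .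
qed

text \<open>Agreement from \<open>r\<close> on means that the inverse of \<open>\<sigma>\<close>
  followed after \<open>\<tau>\<close> permutes the first \<open>r\<close> indices; its sign is
  \<open>sign \<sigma> * sign \<tau>\<close> since a permutation and its inverse have the same
  sign.\<close>

lemma sum_permutes_agreeing:
  fixes G :: "(nat \<Rightarrow> nat) \<Rightarrow> 'a :: comm_ring_1"
  assumes \<sigma>: "\<sigma> permutes {..<n}" and rn: "r \<le> n"
  shows "(\<Sum>\<tau> | \<tau> permutes {..<n} \<and> (\<forall>i\<in>{r..<n}. \<tau> i = \<sigma> i). of_int (sign \<sigma>) * of_int (sign \<tau>) * G \<tau>) =
         (\<Sum>\<rho> | \<rho> permutes {..<r}. of_int (sign \<rho>) * G (\<sigma> \<circ> \<rho>))"
proof (rule sum.reindex_bij_witness[where j = "\<lambda>\<tau>. Hilbert_Choice.inv \<sigma> \<circ> \<tau>" and i = "\<lambda>\<rho>. \<sigma> \<circ> \<rho>"])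
  fix \<tau> assume "\<tau> \<in> {\<tau>. \<tau> permutes {..<n} \<and> (\<forall>i\<in>{r..<n}. \<tau> i = \<sigma> i)}"
  then have \<tau>: "\<tau> permutes {..<n}" and eq: "\<And>i. i \<in> {r..<n} \<Longrightarrow> \<tau> i = \<sigma> i" by auto
  show s: "\<sigma> \<circ> (Hilbert_Choice.inv \<sigma> \<circ> \<tau>) = \<tau>" by (simp add: fun_eq_iff permutes_inverses[OF \<sigma>])
  show "Hilbert_Choice.inv \<sigma> \<circ> \<tau> \<in> {\<rho>. \<rho> permutes {..<r}}"
  proof (rule CollectI, rule permutes_superset)
    show "Hilbert_Choice.inv \<sigma> \<circ> \<tau> permutes {..<n}" by (intro permutes_compose \<tau> permutes_inv \<sigma>)
    fix i assume "i \<in> {..<n} - {..<r}"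
    then show "(Hilbert_Choice.inv \<sigma> \<circ> \<tau>) i = i" by (simp add: eq permutes_inverses[OF \<sigma>])
  qed
  have "permutation \<sigma>" "permutation \<tau>"
    using \<sigma> \<tau> permutes_imp_permutation[of "{..<n}"] by auto
  then have "sign (Hilbert_Choice.inv \<sigma> \<circ> \<tau>) = sign \<sigma> * sign \<tau>"
    by (simp add: sign_compose sign_inverse permutation_inverse)
  then show "of_int (sign (Hilbert_Choice.inv \<sigma> \<circ> \<tau>)) * G (\<sigma> \<circ> (Hilbert_Choice.inv \<sigma> \<circ> \<tau>)) =
      of_int (sign \<sigma>) * of_int (sign \<tau>) * G \<tau>" unfolding s by simp
next
  fix \<rho> assume "\<rho> \<in> {\<rho>. \<rho> permutes {..<r}}"
  then have \<rho>: "\<rho> permutes {..<r}" by simp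
  show "Hilbert_Choice.inv \<sigma> \<circ> (\<sigma> \<circ> \<rho>) = \<rho>" by (simp add: fun_eq_iff permutes_inverses[OF \<sigma>])
  have "\<rho> permutes {..<n}" by (rule permutes_subset[OF \<rho>]) (use rn in auto)
  then show "\<sigma> \<circ> \<rho> \<in> {\<tau>. \<tau> permutes {..<n} \<and> (\<forall>i\<in>{r..<n}. \<tau> i = \<sigma> i)}"
    using permutes_not_in[OF \<rho>] by (auto intro: permutes_compose \<sigma>)
qed

lemma has_bochner_integral_det_kernel:
  fixes p :: "nat \<Rightarrow> complex \<Rightarrow> complex" and q :: "nat \<Rightarrow> real \<Rightarrow> complex" and g :: "(nat \<Rightarrow> real) \<Rightarrow> complex"
  assumes g: "g \<in> borel_measurable (PiM {..<r} (\<lambda>_. lborel))" "bounded (range g)"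
    and int: "\<And>j k. j < n \<Longrightarrow> k < n \<Longrightarrow> integrable lborel (\<lambda>x. p j (of_real x) * q k x)"
  shows "has_bochner_integral (PiM {..<r} (\<lambda>_. lborel))
     (\<lambda>x. g x * det (mat r r (\<lambda>(a, b). correlation_kernel n p q (of_real (x a)) (x b))))
     (\<Sum>\<phi> | \<phi> \<in> {..<r} \<rightarrow>\<^sub>E {..<n} \<and> inj_on \<phi> {..<r}. \<Sum>\<rho> | \<rho> permutes {..<r}. of_int (sign \<rho>) *
        (LINT x|PiM {..<r} (\<lambda>_. lborel). g x * (\<Prod>i<r. p (\<phi> i) (of_real (x i)) * q (\<phi> (\<rho> i)) (x i))))"
    (is "has_bochner_integral ?M _ (\<Sum>\<phi>\<in>?I. \<Sum>\<rho>\<in>?R. of_int (sign \<rho>) * ?J \<phi> \<rho>)")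
proof -
  have eq: "g x * det (mat r r (\<lambda>(a, b). correlation_kernel n p q (of_real (x a)) (x b))) =
      (\<Sum>\<phi>\<in>?I. \<Sum>\<rho>\<in>?R. of_int (sign \<rho>) * (g x * (\<Prod>i<r. p (\<phi> i) (of_real (x i)) * q (\<phi> (\<rho> i)) (x i))))" for x
    unfolding det_correlation_kernel sum_distrib_left
    by (rule sum.cong[OF refl], rule sum.cong[OF refl], rule mult.left_commute)
  show ?thesis unfolding eq
  proof (intro has_bochner_integral_sum has_bochner_integral_mult_right has_bochner_integral_integrable
      product_integral_marginal(1)[OF g order_refl] int)
    fix \<phi> \<rho> i assume "\<phi> \<in> ?I" "\<rho> \<in> ?R" "i < r"
    then show "\<phi> i < n" "\<phi> (\<rho> i) < n"
      using permutes_in_image[of \<rho> "{..<r}" i] PiE_mem[of \<phi> "{..<r}" "\<lambda>_. {..<n}"] by auto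
  qed
qed

text \<open>Integrating out \<open>x\<^sub>r, \<dots>, x\<^sub>n\<^sub>-\<^sub>1\<close> in the Leibniz expansions of the two determinants leaves
  only the pairs of permutations that agree on \<open>r, \<dots>, n - 1\<close>.\<close>

lemma integral_biorthogonal_dets:
  fixes p :: "nat \<Rightarrow> complex \<Rightarrow> complex" and q :: "nat \<Rightarrow> real \<Rightarrow> complex" and g :: "(nat \<Rightarrow> real) \<Rightarrow> complex"
  assumes g: "g \<in> borel_measurable (PiM {..<r} (\<lambda>_. lborel))" "bounded (range g)" and rn: "r \<le> n"
    and int: "\<And>j k. j < n \<Longrightarrow> k < n \<Longrightarrow> integrable lborel (\<lambda>x. p j (of_real x) * q k x)"
    and orth: "\<And>j k. j < n \<Longrightarrow> k < n \<Longrightarrow> (LINT x|lborel. p j (of_real x) * q k x) = (if j = k then 1 else 0)"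
  shows "integrable (PiM {..<n} (\<lambda>_. lborel)) (\<lambda>x. g (restrict x {..<r}) *
             (det (mat n n (\<lambda>(i, j). p j (of_real (x i)))) * det (mat n n (\<lambda>(i, j). q j (x i)))))"
    and "(LINT x|PiM {..<n} (\<lambda>_. lborel). g (restrict x {..<r}) *
             (det (mat n n (\<lambda>(i, j). p j (of_real (x i)))) * det (mat n n (\<lambda>(i, j). q j (x i))))) =
         fact (n - r) * (LINT x|PiM {..<r} (\<lambda>_. lborel).
             g x * det (mat r r (\<lambda>(a, b). correlation_kernel n p q (of_real (x a)) (x b))))"
proof -
  let ?S = "{\<sigma>. \<sigma> permutes {..<n}}" and ?R = "{\<rho>. \<rho> permutes {..<r}}"
  let ?I = "{\<phi>. \<phi> \<in> {..<r} \<rightarrow>\<^sub>E {..<n} \<and> inj_on \<phi> {..<r}}"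
  let ?M = "\<lambda>k. PiM {..<k} (\<lambda>_. lborel) :: (nat \<Rightarrow> real) measure"
  define h where "h \<sigma> \<tau> i x = p (\<sigma> i) (of_real x) * q (\<tau> i) x" for \<sigma> \<tau> :: "nat \<Rightarrow> nat" and i and x :: real
  define J where "J \<sigma> \<tau> = (LINT x|?M r. g x * (\<Prod>i<r. h \<sigma> \<tau> i (x i)))" for \<sigma> \<tau>
  have h_int: "integrable lborel (h \<sigma> \<tau> i)" if "\<sigma> i < n" "\<tau> i < n" for \<sigma> \<tau> i
    unfolding h_def using that by (intro int)
  have perm_less: "\<sigma> i < n" if "\<sigma> \<in> ?S" "i < n" for \<sigma> i
    using permutes_in_image[of \<sigma> "{..<n}" i] that by simp
  have dets: "g (restrict x {..<r}) * (det (mat n n (\<lambda>(i, j). p j (of_real (x i)))) * det (mat n n (\<lambda>(i, j). q j (x i))))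
    = (\<Sum>\<sigma>\<in>?S. \<Sum>\<tau>\<in>?S. of_int (sign \<sigma>) * of_int (sign \<tau>) * (g (restrict x {..<r}) * (\<Prod>i<n. h \<sigma> \<tau> i (x i))))" for x
  proof -
    have "det (mat n n (\<lambda>(i, j). p j (of_real (x i)))) * det (mat n n (\<lambda>(i, j). q j (x i))) =
      (\<Sum>\<sigma>\<in>?S. \<Sum>\<tau>\<in>?S. of_int (sign \<sigma>) * of_int (sign \<tau>) * (\<Prod>i<n. h \<sigma> \<tau> i (x i)))"
      unfolding det_mat sum_product prod.case h_def prod.distrib
      by (rule sum.cong[OF refl], rule sum.cong[OF refl]) (simp add: mult_ac)
    then show ?thesis
      by (simp only: sum_distrib_left mult.left_commute[of "g (restrict x {..<r})"])
  qed
  have factor: "integrable (?M n) (\<lambda>x. g (restrict x {..<r}) * (\<Prod>i<n. h \<sigma> \<tau> i (x i)))"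
    "(LINT x|?M n. g (restrict x {..<r}) * (\<Prod>i<n. h \<sigma> \<tau> i (x i))) =
      (if \<forall>i\<in>{r..<n}. \<tau> i = \<sigma> i then J \<sigma> \<tau> else 0)"
    if "\<sigma> \<in> ?S" "\<tau> \<in> ?S" for \<sigma> \<tau>
  proof -
    have lt: "\<sigma> i < n" "\<tau> i < n" if "i < n" for i
      using perm_less[of \<sigma> i] perm_less[of \<tau> i] \<open>\<sigma> \<in> ?S\<close> \<open>\<tau> \<in> ?S\<close> that by blast+
    have hi: "integrable lborel (h \<sigma> \<tau> i)" if "i < n" for i
      using lt[OF that] by (rule h_int)
    show "integrable (?M n) (\<lambda>x. g (restrict x {..<r}) * (\<Prod>i<n. h \<sigma> \<tau> i (x i)))"
      by (rule product_integral_marginal[OF g rn hi])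
    have "(\<Prod>i=r..<n. integral\<^sup>L lborel (h \<sigma> \<tau> i)) = (\<Prod>i=r..<n. if \<tau> i = \<sigma> i then 1 else 0)"
      unfolding h_def using lt by (intro prod.cong refl) (auto simp: orth)
    also have "\<dots> = (if \<forall>i\<in>{r..<n}. \<tau> i = \<sigma> i then 1 else 0)"
      by (auto intro: prod.neutral)
    finally show "(LINT x|?M n. g (restrict x {..<r}) * (\<Prod>i<n. h \<sigma> \<tau> i (x i))) =
      (if \<forall>i\<in>{r..<n}. \<tau> i = \<sigma> i then J \<sigma> \<tau> else 0)"
      using product_integral_marginal(3)[OF g rn hi] by (simp add: J_def)
  qed
  show "integrable (?M n) (\<lambda>x. g (restrict x {..<r}) *
             (det (mat n n (\<lambda>(i, j). p j (of_real (x i)))) * det (mat n n (\<lambda>(i, j). q j (x i)))))"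
    unfolding dets by (intro Bochner_Integration.integrable_sum integrable_mult_right factor) auto
  have "(LINT x|?M n. g (restrict x {..<r}) *
             (det (mat n n (\<lambda>(i, j). p j (of_real (x i)))) * det (mat n n (\<lambda>(i, j). q j (x i))))) =
    (\<Sum>\<sigma>\<in>?S. \<Sum>\<tau>\<in>?S. of_int (sign \<sigma>) * of_int (sign \<tau>) * (if \<forall>i\<in>{r..<n}. \<tau> i = \<sigma> i then J \<sigma> \<tau> else 0))"
  proof -
    have "has_bochner_integral (?M n) (\<lambda>x. \<Sum>\<sigma>\<in>?S. \<Sum>\<tau>\<in>?S. of_int (sign \<sigma>) * of_int (sign \<tau>) *
        (g (restrict x {..<r}) * (\<Prod>i<n. h \<sigma> \<tau> i (x i))))
      (\<Sum>\<sigma>\<in>?S. \<Sum>\<tau>\<in>?S. of_int (sign \<sigma>) * of_int (sign \<tau>) * (if \<forall>i\<in>{r..<n}. \<tau> i = \<sigma> i then J \<sigma> \<tau> else 0))"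
      by (intro has_bochner_integral_sum has_bochner_integral_mult_right)
        (simp_all only: has_bochner_integral_iff factor)
    then show ?thesis unfolding dets by (rule has_bochner_integral_integral_eq)
  qed
  also have "\<dots> = (\<Sum>\<sigma>\<in>?S. \<Sum>\<tau> | \<tau> permutes {..<n} \<and> (\<forall>i\<in>{r..<n}. \<tau> i = \<sigma> i).
      of_int (sign \<sigma>) * of_int (sign \<tau>) * J \<sigma> \<tau>)"
  proof (rule sum.cong[OF refl])
    fix \<sigma>
    have "(\<Sum>\<tau>\<in>?S. of_int (sign \<sigma>) * of_int (sign \<tau>) * (if \<forall>i\<in>{r..<n}. \<tau> i = \<sigma> i then J \<sigma> \<tau> else 0)) =
      (\<Sum>\<tau>\<in>?S. if \<forall>i\<in>{r..<n}. \<tau> i = \<sigma> i then of_int (sign \<sigma>) * of_int (sign \<tau>) * J \<sigma> \<tau> else 0)"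
      by (intro sum.cong) auto
    also have "\<dots> = (\<Sum>\<tau> | \<tau> \<in> ?S \<and> (\<forall>i\<in>{r..<n}. \<tau> i = \<sigma> i). of_int (sign \<sigma>) * of_int (sign \<tau>) * J \<sigma> \<tau>)"
      by (intro sum.inter_filter[symmetric]) (simp add: finite_permutations)
    finally show "(\<Sum>\<tau>\<in>?S. of_int (sign \<sigma>) * of_int (sign \<tau>) * (if \<forall>i\<in>{r..<n}. \<tau> i = \<sigma> i then J \<sigma> \<tau> else 0)) =
      (\<Sum>\<tau> | \<tau> permutes {..<n} \<and> (\<forall>i\<in>{r..<n}. \<tau> i = \<sigma> i). of_int (sign \<sigma>) * of_int (sign \<tau>) * J \<sigma> \<tau>)"
      by simp
  qed
  also have "\<dots> = (\<Sum>\<sigma>\<in>?S. \<Sum>\<rho>\<in>?R. of_int (sign \<rho>) * J \<sigma> (\<sigma> \<circ> \<rho>))"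
    using rn by (intro sum.cong[OF refl] sum_permutes_agreeing) auto
  \<comment> \<open>\<open>J\<close> reads its arguments only at indices below \<open>r\<close>, so
    \<open>\<sigma>\<close> may be restricted, and the sum over \<open>\<sigma>\<close> can then be
    grouped by restrictions.\<close>
  also have "\<dots> = (\<Sum>\<sigma>\<in>?S. \<Sum>\<rho>\<in>?R. of_int (sign \<rho>) * J (restrict \<sigma> {..<r}) (restrict \<sigma> {..<r} \<circ> \<rho>))"
  proof (rule sum.cong[OF refl], rule sum.cong[OF refl])
    fix \<sigma> \<rho> assume "\<rho> \<in> ?R"
    then have "\<rho> i < r" if "i < r" for i using permutes_in_image[of \<rho> "{..<r}" i] that by simp
    then have "J \<sigma> (\<sigma> \<circ> \<rho>) = J (restrict \<sigma> {..<r}) (restrict \<sigma> {..<r} \<circ> \<rho>)"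
      by (simp add: J_def h_def)
    then show "of_int (sign \<rho>) * J \<sigma> (\<sigma> \<circ> \<rho>) =
      of_int (sign \<rho>) * J (restrict \<sigma> {..<r}) (restrict \<sigma> {..<r} \<circ> \<rho>)" by simp
  qed
  also have "\<dots> = fact (n - r) * (\<Sum>\<phi>\<in>?I. \<Sum>\<rho>\<in>?R. of_int (sign \<rho>) * J \<phi> (\<phi> \<circ> \<rho>))"
    using sum_permutes_restrict[OF rn, of "\<lambda>\<phi>. \<Sum>\<rho>\<in>?R. of_int (sign \<rho>) * J \<phi> (\<phi> \<circ> \<rho>)"] by simp
  also have "(\<Sum>\<phi>\<in>?I. \<Sum>\<rho>\<in>?R. of_int (sign \<rho>) * J \<phi> (\<phi> \<circ> \<rho>)) =
     (LINT x|?M r. g x * det (mat r r (\<lambda>(a, b). correlation_kernel n p q (of_real (x a)) (x b))))"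
    using has_bochner_integral_integral_eq[OF has_bochner_integral_det_kernel[OF g int]]
    unfolding J_def h_def by simp
  finally show "(LINT x|?M n. g (restrict x {..<r}) *
             (det (mat n n (\<lambda>(i, j). p j (of_real (x i)))) * det (mat n n (\<lambda>(i, j). q j (x i))))) =
         fact (n - r) * (LINT x|?M r.
             g x * det (mat r r (\<lambda>(a, b). correlation_kernel n p q (of_real (x a)) (x b))))" .
qed

lemma prob_space_uniform_permutations: "prob_space (uniform_count_measure {\<sigma>. \<sigma> permutes {..<n :: nat}})"
  by (intro prob_space_uniform_count_measure) (auto simp: finite_permutations intro: permutes_id)

lemma borel_measurable_polynomial_ensemble_density:
  assumes "\<And>k. k < n \<Longrightarrow> f k \<in> borel_measurable borel"
  shows "polynomial_ensemble_density n f Z \<in> borel_measurable (PiM {..<n} (\<lambda>_. lborel))"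
proof -
  have [measurable]: "(\<lambda>x. f k (x j)) \<in> borel_measurable (PiM {..<n} (\<lambda>_. lborel))" if "k < n" "j < n" for k j
    by (rule measurable_compose[OF measurable_component_singleton]) (use assms that in auto)
  have [measurable]: "(\<lambda>x. x j) \<in> borel_measurable (PiM {..<n} (\<lambda>_. lborel))" if "j < n" for j
    by (rule measurable_compose[OF measurable_component_singleton]) (use that in auto)
  show ?thesis
    unfolding polynomial_ensemble_density_def[abs_def] vandermonde_def by measurable auto
qed

context
  fixes M :: "'w measure" and n :: nat and xs :: "'w \<Rightarrow> real list" and f :: "nat \<Rightarrow> real \<Rightarrow> real" and Z :: real
  assumes M: "prob_space M" and f: "\<And>k. k < n \<Longrightarrow> f k \<in> borel_measurable borel"
    and follows: "follows_polynomial_ensemble M n xs f Z"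
begin

lemma follows_permuted_measurable:
  assumes "\<sigma> permutes {..<n}"
  shows "(\<lambda>\<omega>. \<lambda>i\<in>{..<n}. xs \<omega> ! \<sigma> i) \<in> measurable M (PiM {..<n} (\<lambda>_. lborel))"
proof -
  have "(\<lambda>(\<omega>, \<sigma>). \<lambda>i\<in>{..<n}. xs \<omega> ! \<sigma> i) \<in>
      measurable (M \<Otimes>\<^sub>M uniform_count_measure {\<sigma>. \<sigma> permutes {..<n}}) (PiM {..<n} (\<lambda>_. lborel))"
    using follows unfolding follows_polynomial_ensemble_def by (blast intro: distributed_measurable)
  from measurable_compose[OF measurable_Pair2'[of \<sigma>] this] assms show ?thesis
    by (simp add: space_uniform_count_measure)
qed

lemma follows_nth_measurable:
  assumes "i < n"
  shows "(\<lambda>\<omega>. xs \<omega> ! i) \<in> borel_measurable M"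
proof -
  have "(\<lambda>\<omega>. (\<lambda>i\<in>{..<n}. xs \<omega> ! id i) i) \<in> measurable M lborel"
    by (rule measurable_compose[OF follows_permuted_measurable[OF permutes_id] measurable_component_singleton])
      (use assms in auto)
  then show ?thesis using assms by simp
qed

text \<open>Fubini undoes the auxiliary randomisation: the average over a uniform permutation is a
  finite sum with weights \<open>1 / fact n\<close>. In this way the density, which describes
  relabelled points, gives information on the ordered list.\<close>

lemma follows_integral:
  fixes h :: "(nat \<Rightarrow> real) \<Rightarrow> complex"
  assumes h: "h \<in> borel_measurable (PiM {..<n} (\<lambda>_. lborel))"
    and int: "integrable (PiM {..<n} (\<lambda>_. lborel)) (\<lambda>x. polynomial_ensemble_density n f Z x *\<^sub>R h x)"
  shows "\<And>\<sigma>. \<sigma> permutes {..<n} \<Longrightarrow> integrable M (\<lambda>\<omega>. h (\<lambda>i\<in>{..<n}. xs \<omega> ! \<sigma> i))"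
    and "(\<Sum>\<sigma> | \<sigma> permutes {..<n}. LINT \<omega>|M. h (\<lambda>i\<in>{..<n}. xs \<omega> ! \<sigma> i)) =
           fact n * (LINT x|PiM {..<n} (\<lambda>_. lborel). polynomial_ensemble_density n f Z x *\<^sub>R h x)"
proof -
  interpret prob_space M by (rule M)
  let ?S = "{\<sigma>. \<sigma> permutes {..<n}}" and ?N = "PiM {..<n} (\<lambda>_. lborel) :: (nat \<Rightarrow> real) measure"
  define U where "U = uniform_count_measure ?S"
  interpret U: prob_space U unfolding U_def by (rule prob_space_uniform_permutations)
  interpret pair_sigma_finite M U ..
  let ?Y = "\<lambda>(\<omega>, \<sigma>). \<lambda>i\<in>{..<n}. xs \<omega> ! \<sigma> i"
  have nn: "AE x in ?N. 0 \<le> polynomial_ensemble_density n f Z x"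
    and dist: "distributed (M \<Otimes>\<^sub>M U) ?N ?Y (\<lambda>x. ennreal (polynomial_ensemble_density n f Z x))"
    using follows unfolding follows_polynomial_ensemble_def U_def by auto
  note d = borel_measurable_polynomial_ensemble_density[where Z = Z, OF f]
  have Y: "?Y \<in> measurable (M \<Otimes>\<^sub>M U) ?N" using dist by (rule distributed_measurable)
  have distr: "distr (M \<Otimes>\<^sub>M U) ?N ?Y = density ?N (\<lambda>x. ennreal (polynomial_ensemble_density n f Z x))"
    using dist by (rule distributed_distr_eq_density)
  have fin: "finite ?S" "card ?S = fact n" by (simp_all add: finite_permutations card_permutations)
  have "integrable (distr (M \<Otimes>\<^sub>M U) ?N ?Y) h"
    unfolding distr using int by (subst integrable_density[OF h d nn])
  then have int': "integrable (M \<Otimes>\<^sub>M U) (\<lambda>y. h (?Y y))"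
    by (subst (asm) integrable_distr_eq[OF Y h])
  have U_int: "(LINT \<sigma>|U. k \<sigma>) = (\<Sum>\<sigma>\<in>?S. (1 / fact n) *\<^sub>R k \<sigma>)" for k :: "_ \<Rightarrow> complex"
    unfolding U_def uniform_count_measure_def using fin
    by (subst lebesgue_integral_point_measure_finite) auto
  \<comment> \<open>Every permutation has positive mass, so what holds almost everywhere in
    \<open>U\<close> holds for each of them.\<close>
  have AE_S: "Q \<sigma>" if "AE \<sigma> in U. Q \<sigma>" "\<sigma> \<in> ?S" for Q and \<sigma> :: "nat \<Rightarrow> nat"
  proof -
    have "AE \<sigma> in point_measure ?S (\<lambda>_. ennreal (1 / real (card ?S))). Q \<sigma>"
      using that(1) unfolding U_def uniform_count_measure_def by simp
    then show ?thesis using that(2) fin by (subst (asm) AE_point_measure) auto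
  qed
  have "AE \<sigma> in U. integrable M (\<lambda>\<omega>. h (?Y (\<omega>, \<sigma>)))"
    using AE_integrable_snd[of "\<lambda>\<omega> \<sigma>. h (?Y (\<omega>, \<sigma>))"] int' by (simp add: case_prod_unfold)
  then show ints: "integrable M (\<lambda>\<omega>. h (\<lambda>i\<in>{..<n}. xs \<omega> ! \<sigma> i))" if "\<sigma> permutes {..<n}" for \<sigma>
    using AE_S[of "\<lambda>\<sigma>. integrable M (\<lambda>\<omega>. h (?Y (\<omega>, \<sigma>)))"] that by simp
  have "(LINT \<sigma>|U. LINT \<omega>|M. h (?Y (\<omega>, \<sigma>))) = (LINT y|(M \<Otimes>\<^sub>M U). h (?Y y))"
    using integral_snd[of "\<lambda>\<omega> \<sigma>. h (?Y (\<omega>, \<sigma>))"] int' by (simp add: case_prod_unfold)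
  also have "\<dots> = (LINT x|distr (M \<Otimes>\<^sub>M U) ?N ?Y. h x)"
    by (rule integral_distr[OF Y h, symmetric])
  also have "\<dots> = (LINT x|?N. polynomial_ensemble_density n f Z x *\<^sub>R h x)"
    unfolding distr by (rule integral_density[OF h d nn])
  finally have "(\<Sum>\<sigma>\<in>?S. (1 / fact n) *\<^sub>R (LINT \<omega>|M. h (?Y (\<omega>, \<sigma>)))) =
      (LINT x|?N. polynomial_ensemble_density n f Z x *\<^sub>R h x)" unfolding U_int .
  then show "(\<Sum>\<sigma> | \<sigma> permutes {..<n}. LINT \<omega>|M. h (\<lambda>i\<in>{..<n}. xs \<omega> ! \<sigma> i)) =
           fact n * (LINT x|PiM {..<n} (\<lambda>_. lborel). polynomial_ensemble_density n f Z x *\<^sub>R h x)"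
    unfolding scaleR_sum_right[symmetric] by (simp add: scaleR_conv_of_real field_simps)
qed

end

lemma determinantal_biorthogonal:
  assumes M: "prob_space M" and f: "\<And>k. k < n \<Longrightarrow> f k \<in> borel_measurable borel"
    and follows: "follows_polynomial_ensemble M n xs f Z"
    and bio: "biorthogonal_system n f p q"
  shows "determinantal M n xs (correlation_kernel n p q)"
  unfolding determinantal_def
proof (intro allI impI conjI)
  interpret prob_space M by (rule M)
  fix r :: nat and g :: "(nat \<Rightarrow> real) \<Rightarrow> complex"
  assume g: "g \<in> borel_measurable (PiM {..<r} (\<lambda>_. lborel))" "bounded (range g)"
  let ?K = "\<lambda>x. det (mat r r (\<lambda>(a, b). correlation_kernel n p q (of_real (x a)) (x b)))"
  let ?I = "{\<phi> \<in> {..<r} \<rightarrow>\<^sub>E {..<n}. inj_on \<phi> {..<r}}"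
  let ?N = "PiM {..<n} (\<lambda>_. lborel) :: (nat \<Rightarrow> real) measure"
  let ?D = "\<lambda>x. det (mat n n (\<lambda>(i, j). p j (of_real (x i)))) * det (mat n n (\<lambda>(i, j). q j (x i)))"
  let ?d = "polynomial_ensemble_density n f Z"
  have int: "integrable lborel (\<lambda>x. p j (of_real x) * q k x)"
    and orth: "(LINT x|lborel. p j (of_real x) * q k x) = (if j = k then 1 else 0)" if "j < n" "k < n" for j k
    using bio that unfolding biorthogonal_system_def by auto
  note marginal = integral_biorthogonal_dets[where n = n and p = p and q = q, OF _ _ _ int orth]
  show "integrable (PiM {..<r} (\<lambda>_. lborel)) (\<lambda>x. g x * ?K x)"
    using has_bochner_integral_det_kernel[OF g int] by (simp only: has_bochner_integral_iff)
  show "(LINT \<omega>|M. (\<Sum>i\<in>?I. g (\<lambda>a\<in>{..<r}. xs \<omega> ! i a))) = (LINT x|PiM {..<r} (\<lambda>_. lborel). g x * ?K x)"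
  proof (cases "r \<le> n")
    case False
    \<comment> \<open>More than \<open>n\<close> distinct indices do not exist. By the expansion of
      the kernel determinant both sides are then sums over the empty set.\<close>
    have I: "?I = {}"
    proof safe
      fix \<phi> assume "\<phi> \<in> {..<r} \<rightarrow>\<^sub>E {..<n}" "inj_on \<phi> {..<r}"
      then have "card {..<r} \<le> card {..<n}" using PiE_mem[of \<phi>] by (intro card_inj_on_le[of \<phi>]) auto
      with False show "\<phi> \<in> {}" by simp
    qed
    then show ?thesis unfolding det_correlation_kernel I by simp
  next
    case rn: True
    obtain c where c: "\<And>x. ?D x = c * of_real (?d x)"
      using biorthogonal_det_density[OF bio, of Z] follows
      unfolding follows_polynomial_ensemble_def by blast
    \<comment> \<open>This is the case \<open>r = 0\<close>: the space of the remaining variables is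
      a single point and the kernel determinant is 1.\<close>
    have total: "integrable ?N ?D" "(LINT x|?N. ?D x) = fact n"
      using marginal[of "\<lambda>_. 1" 0] by (simp_all add: space_PiM measure_def)
    have "c \<noteq> 0"
    proof
      assume "c = 0"
      then have "(LINT x|?N. ?D x) = 0" unfolding c by simp
      then show False using total(2) by simp
    qed
    then have d: "complex_of_real (?d x) = ?D x / c" for x unfolding c by simp
    \<comment> \<open>The test function 1 compares total masses: the probability 1 on one side,
      \<open>fact n / c\<close> on the other.\<close>
    have "(\<Sum>\<sigma> | \<sigma> permutes {..<n}. LINT \<omega>|M. 1) = fact n * (LINT x|?N. ?d x *\<^sub>R (1 :: complex))"
      by (rule follows_integral(2)[OF M f follows])
        (use total(1) in \<open>simp_all add: scaleR_conv_of_real d\<close>)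
    then have "fact n = fact n * (fact n / c)"
      using total(2) by (simp add: scaleR_conv_of_real d card_permutations prob_space)
    then have c_eq: "c = fact n" using \<open>c \<noteq> 0\<close> by (simp add: field_simps)
    define h where "h \<phi> = (LINT \<omega>|M. g (\<lambda>a\<in>{..<r}. xs \<omega> ! \<phi> a))" for \<phi>
    have gr: "(\<lambda>x. g (restrict x {..<r})) \<in> borel_measurable ?N"
      by (rule measurable_compose[OF measurable_restrict_subset g(1)]) (use rn in auto)
    have "of_nat (fact (n - r)) * (\<Sum>\<phi>\<in>?I. h \<phi>) = (\<Sum>\<sigma> | \<sigma> permutes {..<n}. h (restrict \<sigma> {..<r}))"
      by (rule sum_permutes_restrict[OF rn, symmetric])
    also have "\<dots> = (\<Sum>\<sigma> | \<sigma> permutes {..<n}. LINT \<omega>|M. g (restrict (\<lambda>i\<in>{..<n}. xs \<omega> ! \<sigma> i) {..<r}))"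
    proof (rule sum.cong[OF refl])
      fix \<sigma>
      have "(\<lambda>a\<in>{..<r}. xs \<omega> ! restrict \<sigma> {..<r} a) = restrict (\<lambda>i\<in>{..<n}. xs \<omega> ! \<sigma> i) {..<r}" for \<omega>
        using rn by (auto simp: fun_eq_iff)
      then show "h (restrict \<sigma> {..<r}) = (LINT \<omega>|M. g (restrict (\<lambda>i\<in>{..<n}. xs \<omega> ! \<sigma> i) {..<r}))"
        by (simp add: h_def)
    qed
    also have "\<dots> = fact n * (LINT x|?N. ?d x *\<^sub>R g (restrict x {..<r}))"
    proof (rule follows_integral(2)[OF M f follows gr])
      have "integrable ?N (\<lambda>x. (1 / c) * (g (restrict x {..<r}) * ?D x))"
        by (intro integrable_mult_right marginal(1) g rn)
      then show "integrable ?N (\<lambda>x. ?d x *\<^sub>R g (restrict x {..<r}))"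
        by (simp add: scaleR_conv_of_real d mult_ac)
    qed
    also have "(LINT x|?N. ?d x *\<^sub>R g (restrict x {..<r})) = (LINT x|?N. (1 / c) * (g (restrict x {..<r}) * ?D x))"
      by (simp add: scaleR_conv_of_real d mult_ac)
    also have "\<dots> = (1 / c) * (fact (n - r) * (LINT x|PiM {..<r} (\<lambda>_. lborel). g x * ?K x))"
      by (simp only: integral_mult_right_zero marginal(2)[OF g rn])
    finally have eq: "(\<Sum>\<phi>\<in>?I. h \<phi>) = (LINT x|PiM {..<r} (\<lambda>_. lborel). g x * ?K x)"
      unfolding c_eq by simp
    have "(LINT \<omega>|M. (\<Sum>\<phi>\<in>?I. g (\<lambda>a\<in>{..<r}. xs \<omega> ! \<phi> a))) = (\<Sum>\<phi>\<in>?I. h \<phi>)"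
      unfolding h_def
    proof (rule Bochner_Integration.integral_sum)
      fix \<phi> assume \<phi>: "\<phi> \<in> ?I"
      obtain C where C: "\<And>x. norm (g x) \<le> C" using g(2) by (auto simp: bounded_iff)
      have "(\<lambda>\<omega>. \<lambda>a\<in>{..<r}. xs \<omega> ! \<phi> a) \<in> measurable M (PiM {..<r} (\<lambda>_. lborel))"
      proof (rule measurable_restrict)
        fix a assume "a \<in> {..<r}"
        then have "\<phi> a < n" using \<phi> by (auto dest: PiE_mem)
        then show "(\<lambda>\<omega>. xs \<omega> ! \<phi> a) \<in> measurable M lborel"
          using follows_nth_measurable[OF M f follows] by simp
      qed
      then show "integrable M (\<lambda>\<omega>. g (\<lambda>a\<in>{..<r}. xs \<omega> ! \<phi> a))"
        by (intro integrable_const_bound[of _ C] measurable_compose[OF _ g(1)]) (use C in auto)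
    qed
    with eq show ?thesis by simp
  qed
qed

text \<open>This product dominates every coefficient of the characteristic polynomial. In the
  Leibniz expansions each variable carries a power of at most \<open>n - 1\<close> and a factor
  \<open>1 + \<bar>x\<bar>\<close>, so the moments up to order \<open>n\<close> in
  \<open>ensemble_weights\<close> are just enough.\<close>

lemma integrable_polynomial_ensemble_points:
  assumes M: "prob_space M" and f: "ensemble_weights n f"
    and follows: "follows_polynomial_ensemble M n xs f Z"
  shows "integrable M (\<lambda>\<omega>. \<Prod>i<n. 1 + \<bar>xs \<omega> ! i\<bar>)"
proof -
  interpret product_sigma_finite "\<lambda>_ :: nat. lborel :: real measure" ..
  let ?N = "PiM {..<n} (\<lambda>_. lborel) :: (nat \<Rightarrow> real) measure"
  have fm: "f k \<in> borel_measurable borel" and fi: "\<And>j. j \<le> n \<Longrightarrow> integrable lborel (\<lambda>x. x ^ j * f k x)"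
    if "k < n" for k
    using f that unfolding ensemble_weights_def by auto
  have factor: "integrable lborel (\<lambda>x. x ^ a * f b x * (1 + \<bar>x\<bar>))" if "a < n" "b < n" for a b
  proof (rule Bochner_Integration.integrable_bound)
    show "integrable lborel (\<lambda>x. \<bar>x ^ a * f b x\<bar> + \<bar>x ^ Suc a * f b x\<bar>)"
      using that by (intro Bochner_Integration.integrable_add integrable_abs fi) auto
    show "AE x in lborel. norm (x ^ a * f b x * (1 + \<bar>x\<bar>)) \<le> norm (\<bar>x ^ a * f b x\<bar> + \<bar>x ^ Suc a * f b x\<bar>)"
    proof (intro AE_I2)
      fix x
      have "\<bar>x ^ a * f b x * (1 + \<bar>x\<bar>)\<bar> = \<bar>x ^ a * f b x\<bar> * (1 + \<bar>x\<bar>)" by (simp add: abs_mult)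
      also have "\<dots> = \<bar>x ^ a * f b x\<bar> + \<bar>x ^ Suc a * f b x\<bar>" by (simp add: abs_mult algebra_simps)
      finally show "norm (x ^ a * f b x * (1 + \<bar>x\<bar>)) \<le> norm (\<bar>x ^ a * f b x\<bar> + \<bar>x ^ Suc a * f b x\<bar>)" by simp
    qed
  qed (use fm[OF that(2)] in measurable)
  have expand: "polynomial_ensemble_density n f Z x * (\<Prod>i<n. 1 + \<bar>x i\<bar>) =
    1 / Z * (\<Sum>\<sigma> | \<sigma> permutes {..<n}. \<Sum>\<tau> | \<tau> permutes {..<n}.
      of_int (sign \<sigma>) * of_int (sign \<tau>) * (\<Prod>i<n. x i ^ \<sigma> i * f (\<tau> i) (x i) * (1 + \<bar>x i\<bar>)))" for x
  proof -
    have "polynomial_ensemble_density n f Z x * (\<Prod>i<n. 1 + \<bar>x i\<bar>) =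
      1 / Z * (det (mat n n (\<lambda>(i, j). x i ^ j)) * det (mat n n (\<lambda>(j, k). f k (x j))) * (\<Prod>i<n. 1 + \<bar>x i\<bar>))"
      by (simp add: polynomial_ensemble_density_def det_vandermonde vandermonde_def)
    also have "det (mat n n (\<lambda>(i, j). x i ^ j)) * det (mat n n (\<lambda>(j, k). f k (x j))) * (\<Prod>i<n. 1 + \<bar>x i\<bar>) =
      (\<Sum>\<sigma> | \<sigma> permutes {..<n}. \<Sum>\<tau> | \<tau> permutes {..<n}.
      of_int (sign \<sigma>) * of_int (sign \<tau>) * (\<Prod>i<n. x i ^ \<sigma> i * f (\<tau> i) (x i) * (1 + \<bar>x i\<bar>)))"
      unfolding det_mat sum_product prod.case unfolding sum_distrib_right prod.distrib
      by (rule sum.cong[OF refl], rule sum.cong[OF refl]) (simp only: mult_ac)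
    finally show ?thesis .
  qed
  have "integrable ?N (\<lambda>x. polynomial_ensemble_density n f Z x * (\<Prod>i<n. 1 + \<bar>x i\<bar>))"
    unfolding expand
  proof (intro integrable_mult_right Bochner_Integration.integrable_sum product_integrable_prod factor)
    fix \<sigma> \<tau> i assume "\<sigma> \<in> {\<sigma>. \<sigma> permutes {..<n}}" "\<tau> \<in> {\<tau>. \<tau> permutes {..<n}}" "i \<in> {..<n}"
    then show "\<sigma> i < n" "\<tau> i < n"
      using permutes_in_image[of \<sigma> "{..<n}" i] permutes_in_image[of \<tau> "{..<n}" i] by auto
  qed auto
  from integrable_of_real[OF this, where 'a = complex]
  have int: "integrable ?N (\<lambda>x. polynomial_ensemble_density n f Z x *\<^sub>R complex_of_real (\<Prod>i<n. 1 + \<bar>x i\<bar>))"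
    by (simp add: scaleR_conv_of_real del: of_real_prod)
  \<comment> \<open>The identity relabelling returns the ordered points. The complex detour matches
    the type of the test functions in \<open>follows_integral\<close>.\<close>
  have "integrable M (\<lambda>\<omega>. complex_of_real (\<Prod>i<n. 1 + \<bar>(\<lambda>i\<in>{..<n}. xs \<omega> ! id i) i\<bar>))"
  proof (rule follows_integral(1)[OF M fm follows _ int permutes_id])
    have [measurable]: "(\<lambda>x. x j) \<in> borel_measurable ?N" if "j < n" for j
      by (rule measurable_compose[OF measurable_component_singleton]) (use that in auto)
    show "(\<lambda>x. complex_of_real (\<Prod>i<n. 1 + \<bar>x i\<bar>)) \<in> borel_measurable ?N"
      by measurable
  qed
  from integrable_norm[OF this] show ?thesis by (simp add: norm_of_real abs_prod del: of_real_prod)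
qed

section \<open>Sums over subsets of rows\<close>

text \<open>The characteristic polynomial at \<open>z\<close> of the Gram matrix of those rows of
  \<open>A\<close> that lie in \<open>S\<close>. Rows are selected by a set and entries are given by
  a function, so \<open>S\<close> can vary without reindexing submatrices.\<close>

definition gram_det :: "nat \<Rightarrow> (nat \<Rightarrow> nat \<Rightarrow> complex) \<Rightarrow> nat set \<Rightarrow> complex \<Rightarrow> complex" where
  "gram_det n A S z = det (mat n n (\<lambda>(i, j). (if i = j then z else 0) - (\<Sum>r\<in>S. cnj (A r i) * A r j)))"

lemma det_scale_rows:
  "det (mat n n (\<lambda>(i, j). c i * e i j)) = (\<Prod>i<n. c i) * det (mat n n (\<lambda>(i, j). e i j :: 'a :: comm_ring_1))"
  unfolding det_mat prod.case prod.distrib sum_distrib_left by (simp add: mult_ac)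

lemma card_subsets_containing:
  assumes "finite V" "K \<subseteq> V" "card K \<le> N"
  shows "card {S. S \<subseteq> V \<and> card S = N \<and> K \<subseteq> S} = (card V - card K) choose (N - card K)"
proof -
  have fin: "finite K" using assms finite_subset by blast
  have "bij_betw (\<lambda>S. S - K) {S. S \<subseteq> V \<and> card S = N \<and> K \<subseteq> S} {S. S \<subseteq> V - K \<and> card S = N - card K}"
  proof (rule bij_betw_byWitness[where f' = "\<lambda>S. S \<union> K"])
    show "(\<lambda>S. S - K) ` {S. S \<subseteq> V \<and> card S = N \<and> K \<subseteq> S} \<subseteq> {S. S \<subseteq> V - K \<and> card S = N - card K}"
      using fin by (auto simp: card_Diff_subset)
    show "(\<lambda>S. S \<union> K) ` {S. S \<subseteq> V - K \<and> card S = N - card K} \<subseteq> {S. S \<subseteq> V \<and> card S = N \<and> K \<subseteq> S}"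
    proof (rule image_subsetI)
      fix S assume "S \<in> {S. S \<subseteq> V - K \<and> card S = N - card K}"
      then have S: "S \<subseteq> V - K" "card S = N - card K" by auto
      then have "finite S" using assms(1) finite_subset by blast
      moreover have "S \<inter> K = {}" using S(1) by blast
      ultimately have "card (S \<union> K) = N" using S(2) assms(3) fin by (simp add: card_Un_disjoint)
      then show "S \<union> K \<in> {S. S \<subseteq> V \<and> card S = N \<and> K \<subseteq> S}" using S(1) assms(2) by auto
    qed
  qed auto
  then have "card {S. S \<subseteq> V \<and> card S = N \<and> K \<subseteq> S} = card {S. S \<subseteq> V - K \<and> card S = N - card K}"
    by (rule bij_betw_same_card)
  then show ?thesis using assms fin by (simp add: n_subsets card_Diff_subset)
qed

text \<open>Expanding all rows at once, a function \<open>\<phi>\<close> selects for row \<open>i\<close> either the term of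
  \<open>A\<close>'s row \<open>\<phi> i < m\<close> or, when \<open>\<phi> i = m\<close>, the diagonal term \<open>z\<close>. If \<open>\<phi>\<close> selects a row of \<open>A\<close>
  twice, the determinant vanishes, so a surviving \<open>\<phi>\<close> with \<open>k\<close> selected rows occurs in exactly
  \<open>(m - k) choose (N - k)\<close> of the summands.\<close>

lemma sum_gram_det_subsets:
  obtains w where "\<And>N z. n \<le> N \<Longrightarrow> N \<le> m \<Longrightarrow>
    (\<Sum>S | S \<subseteq> {..<m} \<and> card S = N. gram_det n A S z) =
    (\<Sum>k\<le>n. of_nat ((m - k) choose (N - k)) * w k * z ^ (n - k))"
proof -
  define I where "I \<phi> = {i\<in>{..<n}. \<phi> i \<noteq> m}" for \<phi> :: "nat \<Rightarrow> nat"
  define b where "b r i j = (if r = m then (if i = j then 1 else 0) else - cnj (A r i) * A r j)" for r i j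
  define W where "W \<phi> = det (mat n n (\<lambda>(i, j). b (\<phi> i) i j))" for \<phi>
  let ?\<Phi> = "{..<n} \<rightarrow>\<^sub>E {..m}"
  have finI: "finite (I \<phi>)" and cardI: "card (I \<phi>) \<le> n" for \<phi>
    unfolding I_def using card_mono[of "{..<n}" "{i\<in>{..<n}. \<phi> i \<noteq> m}"] by auto
  have subI: "I \<phi> \<subseteq> {..<n}" for \<phi> by (auto simp: I_def)
  have fin\<Phi>: "finite ?\<Phi>" by (intro finite_PiE) auto
  \<comment> \<open>A selected row of \<open>b\<close> is a scalar multiple of a row of
    \<open>A\<close>. Once the scalars are pulled out, selecting the same row of \<open>A\<close>
    twice gives two equal rows.\<close>
  have W0: "W \<phi> = 0" if ninj: "\<not> inj_on \<phi> (I \<phi>)" for \<phi>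
  proof -
    obtain i i' where ii: "i < n" "i' < n" "\<phi> i \<noteq> m" "\<phi> i = \<phi> i'" "i \<noteq> i'"
      using ninj unfolding inj_on_def I_def by blast
    define e where "e i j = (if \<phi> i = m then (if i = j then 1 else 0) else A (\<phi> i) j)" for i j
    define c where "c i = (if \<phi> i = m then 1 else - cnj (A (\<phi> i) i))" for i
    have "W \<phi> = (\<Prod>i<n. c i) * det (mat n n (\<lambda>(i, j). e i j))"
      unfolding W_def det_scale_rows[symmetric] by (intro arg_cong[of _ _ det] eq_matI) (auto simp: b_def c_def e_def)
    also have "det (mat n n (\<lambda>(i, j). e i j)) = 0"
      by (rule det_identical_rows[of _ n i i']) (use ii in \<open>auto simp: e_def intro!: eq_vecI\<close>)
    finally show ?thesis by simp
  qed
  have expand: "gram_det n A S z =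
      (\<Sum>\<phi>\<in>?\<Phi>. if \<phi> ` I \<phi> \<subseteq> S then W \<phi> * z ^ (n - card (I \<phi>)) else 0)" if S: "S \<subseteq> {..<m}" for S z
  proof -
    \<comment> \<open>All dependence on \<open>S\<close> and \<open>z\<close> goes into the weights
      \<open>c\<close>: \<open>z\<close> for the diagonal choice, the indicator of \<open>S\<close>
      for the rows of \<open>A\<close>. The determinant \<open>W \<phi>\<close> is free of
      both.\<close>
    define c where "c r = (if r = m then z else if r \<in> S then 1 else 0)" for r
    have entry: "(if i = j then z else 0) - (\<Sum>r\<in>S. cnj (A r i) * A r j) = (\<Sum>r\<in>{..m}. c r * b r i j)" for i j
    proof -
      have "(\<Sum>r\<in>{..m}. c r * b r i j) = c m * b m i j + (\<Sum>r<m. c r * b r i j)"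
        by (simp add: lessThan_Suc_atMost[symmetric])
      also have "(\<Sum>r<m. c r * b r i j) = (\<Sum>r\<in>S. - (cnj (A r i) * A r j))"
        by (rule sum.mono_neutral_cong_right) (use S in \<open>auto simp: c_def b_def\<close>)
      finally show ?thesis by (simp add: c_def b_def sum_negf)
    qed
    have "gram_det n A S z = (\<Sum>\<sigma> | \<sigma> permutes {..<n}. of_int (sign \<sigma>) *
        (\<Sum>\<phi>\<in>?\<Phi>. \<Prod>i<n. c (\<phi> i) * b (\<phi> i) i (\<sigma> i)))"
      unfolding gram_det_def entry det_mat prod.case by (simp add: prod_sum_PiE)
    also have "\<dots> = (\<Sum>\<phi>\<in>?\<Phi>. \<Sum>\<sigma> | \<sigma> permutes {..<n}. of_int (sign \<sigma>) * (\<Prod>i<n. c (\<phi> i) * b (\<phi> i) i (\<sigma> i)))"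
      unfolding sum_distrib_left by (rule sum.swap)
    also have "\<dots> = (\<Sum>\<phi>\<in>?\<Phi>. (\<Prod>i<n. c (\<phi> i)) * W \<phi>)"
      unfolding W_def det_mat prod.case prod.distrib sum_distrib_left by (simp only: mult.left_commute)
    also have "\<dots> = (\<Sum>\<phi>\<in>?\<Phi>. if \<phi> ` I \<phi> \<subseteq> S then W \<phi> * z ^ (n - card (I \<phi>)) else 0)"
    proof (rule sum.cong[OF refl])
      fix \<phi> assume "\<phi> \<in> ?\<Phi>"
      have split: "(\<Prod>i<n. c (\<phi> i)) = (\<Prod>i\<in>{..<n} - I \<phi>. c (\<phi> i)) * (\<Prod>i\<in>I \<phi>. c (\<phi> i))"
        by (rule prod.subset_diff) (auto simp: I_def)
      have "(\<Prod>i\<in>{..<n} - I \<phi>. c (\<phi> i)) = (\<Prod>i\<in>{..<n} - I \<phi>. z)"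
        by (rule prod.cong) (auto simp: I_def c_def)
      also have "\<dots> = z ^ (n - card (I \<phi>))"
        using card_Diff_subset[of "I \<phi>" "{..<n}"] finI[of \<phi>] subI[of \<phi>] by simp
      finally have 1: "(\<Prod>i\<in>{..<n} - I \<phi>. c (\<phi> i)) = z ^ (n - card (I \<phi>))" .
      have 2: "(\<Prod>i\<in>I \<phi>. c (\<phi> i)) = (if \<phi> ` I \<phi> \<subseteq> S then 1 else 0)"
      proof (cases "\<phi> ` I \<phi> \<subseteq> S")
        case True
        then show ?thesis by (auto intro!: prod.neutral simp: c_def I_def)
      next
        case False
        then obtain i where "i \<in> I \<phi>" "\<phi> i \<notin> S" by auto
        then show ?thesis using finI False by (auto intro!: prod_zero bexI[of _ i] simp: c_def I_def)
      qed
      show "(\<Prod>i<n. c (\<phi> i)) * W \<phi> = (if \<phi> ` I \<phi> \<subseteq> S then W \<phi> * z ^ (n - card (I \<phi>)) else 0)"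
        unfolding split 1 2 by simp
    qed
    finally show ?thesis .
  qed
  \<comment> \<open>Neither \<open>N\<close> nor \<open>z\<close> occurs in \<open>w\<close>. Hence
    the same coefficients govern every size \<open>N\<close> and the case \<open>N = m\<close>, in
    which they can be read off.\<close>
  define w where "w k = (\<Sum>\<phi> | \<phi> \<in> ?\<Phi> \<and> card (I \<phi>) = k. W \<phi>)" for k
  have "(\<Sum>S | S \<subseteq> {..<m} \<and> card S = N. gram_det n A S z) =
    (\<Sum>k\<le>n. of_nat ((m - k) choose (N - k)) * w k * z ^ (n - k))" if N: "n \<le> N" "N \<le> m" for N z
  proof -
    let ?SS = "{S. S \<subseteq> {..<m} \<and> card S = N}"
    let ?t = "\<lambda>\<phi>. of_nat ((m - card (I \<phi>)) choose (N - card (I \<phi>))) * W \<phi> * z ^ (n - card (I \<phi>))"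
    have finSS: "finite ?SS" by (rule finite_subset[of _ "Pow {..<m}"]) auto
    have "(\<Sum>S\<in>?SS. gram_det n A S z) =
        (\<Sum>S\<in>?SS. \<Sum>\<phi>\<in>?\<Phi>. if \<phi> ` I \<phi> \<subseteq> S then W \<phi> * z ^ (n - card (I \<phi>)) else 0)"
      by (rule sum.cong[OF refl], rule expand) auto
    also have "\<dots> = (\<Sum>\<phi>\<in>?\<Phi>. \<Sum>S\<in>?SS. if \<phi> ` I \<phi> \<subseteq> S then W \<phi> * z ^ (n - card (I \<phi>)) else 0)"
      by (rule sum.swap)
    also have "\<dots> = (\<Sum>\<phi>\<in>?\<Phi>. ?t \<phi>)"
    proof (rule sum.cong[OF refl])
      fix \<phi> assume \<phi>: "\<phi> \<in> ?\<Phi>"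
      have "(\<Sum>S\<in>?SS. if \<phi> ` I \<phi> \<subseteq> S then W \<phi> * z ^ (n - card (I \<phi>)) else 0) =
        (\<Sum>S | S \<in> ?SS \<and> \<phi> ` I \<phi> \<subseteq> S. W \<phi> * z ^ (n - card (I \<phi>)))"
        by (rule sum.inter_filter[OF finSS, symmetric])
      also have "\<dots> = of_nat (card {S. S \<subseteq> {..<m} \<and> card S = N \<and> \<phi> ` I \<phi> \<subseteq> S}) * (W \<phi> * z ^ (n - card (I \<phi>)))"
        by (simp add: conj_assoc)
      also have "\<dots> = ?t \<phi>"
      proof (cases "inj_on \<phi> (I \<phi>)")
        case False
        then show ?thesis by (simp add: W0)
      next
        case True
        have "\<phi> ` I \<phi> \<subseteq> {..<m}"
        proof (rule image_subsetI)
          fix i assume "i \<in> I \<phi>"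
          then have "i < n" "\<phi> i \<noteq> m" by (auto simp: I_def)
          moreover have "\<phi> i \<le> m" using PiE_mem[OF \<phi>, of i] \<open>i < n\<close> by simp
          ultimately show "\<phi> i \<in> {..<m}" by simp
        qed
        moreover have "card (\<phi> ` I \<phi>) = card (I \<phi>)" using True by (rule card_image)
        ultimately show ?thesis
          using card_subsets_containing[of "{..<m}" "\<phi> ` I \<phi>" N] cardI[of \<phi>] N by simp
      qed
      finally show "(\<Sum>S\<in>?SS. if \<phi> ` I \<phi> \<subseteq> S then W \<phi> * z ^ (n - card (I \<phi>)) else 0) = ?t \<phi>" .
    qed
    also have "\<dots> = (\<Sum>k\<le>n. \<Sum>\<phi> | \<phi> \<in> ?\<Phi> \<and> card (I \<phi>) = k. ?t \<phi>)"
      by (rule sum.group[of ?\<Phi> "{..n}" "\<lambda>\<phi>. card (I \<phi>)" ?t, symmetric]) (use fin\<Phi> cardI in auto)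
    also have "\<dots> = (\<Sum>k\<le>n. of_nat ((m - k) choose (N - k)) * w k * z ^ (n - k))"
      unfolding w_def by (rule sum.cong[OF refl]) (simp add: sum_distrib_left sum_distrib_right)
    finally show ?thesis .
  qed
  then show thesis by (rule that)
qed

section \<open>Gram matrices and squared singular values\<close>

lemma dim_mat_adjoint [simp]: "dim_row (mat_adjoint B) = dim_col B" "dim_col (mat_adjoint B) = dim_row B"
  by (simp_all add: mat_adjoint_def)

lemma index_mat_adjoint:
  assumes "i < dim_col B" "j < dim_row B"
  shows "mat_adjoint B $$ (i, j) = cnj (B $$ (j, i))"
  using assms by (simp add: mat_adjoint_def mat_of_rows_index)

lemma gram_carrier: "B \<in> carrier_mat r c \<Longrightarrow> mat_adjoint B * B \<in> carrier_mat c c"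
  by (intro carrier_matI) auto

lemma index_gram:
  assumes "B \<in> carrier_mat r c" "i < c" "j < c"
  shows "(mat_adjoint B * B) $$ (i, j) = (\<Sum>a<r. cnj (B $$ (a, i)) * B $$ (a, j))"
  using assms by (auto simp: scalar_prod_def lessThan_atLeast0 index_mat_adjoint intro!: sum.cong)

lemma gram_det_eq_det:
  assumes B: "B \<in> carrier_mat r n"
  shows "gram_det n (\<lambda>a j. B $$ (a, j)) {..<r} z = det (z \<cdot>\<^sub>m 1\<^sub>m n - mat_adjoint B * B)"
  unfolding gram_det_def using B
  by (intro arg_cong[of _ _ det] eq_matI) (auto simp: index_gram[OF B] simp del: index_mult_mat(1))

lemma poly_char_poly_gram:
  assumes B: "B \<in> carrier_mat r n"
  shows "poly (char_poly (mat_adjoint B * B)) z = gram_det n (\<lambda>a j. B $$ (a, j)) {..<r} z"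
proof -
  have G: "mat_adjoint B * B \<in> carrier_mat n n" by (rule gram_carrier[OF B])
  have "- char_matrix (mat_adjoint B * B) z = z \<cdot>\<^sub>m 1\<^sub>m n - mat_adjoint B * B"
    using G by (intro eq_matI) (auto simp: char_matrix_def)
  then show ?thesis by (simp add: char_poly_matrix[OF G] gram_det_eq_det[OF B])
qed

text \<open>For an eigenvector \<open>v\<close> the squared norm of \<open>B v\<close> is
  \<open>e\<close> times that of \<open>v\<close>. These squared norms are the numbers
  \<open>t\<close> and \<open>s\<close> below, and \<open>s\<close> is positive.\<close>

lemma eigenvalue_gram:
  assumes B: "B \<in> carrier_mat r n" and ev: "eigenvalue (mat_adjoint B * B) e"
  shows "e = of_real (Re e)" "0 \<le> Re e"
proof -
  have G: "mat_adjoint B * B \<in> carrier_mat n n" by (rule gram_carrier[OF B])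
  obtain v where v: "v \<in> carrier_vec n" "v \<noteq> 0\<^sub>v n" "(mat_adjoint B * B) *\<^sub>v v = e \<cdot>\<^sub>v v"
    using ev G unfolding eigenvalue_def eigenvector_def by auto
  define s where "s = (\<Sum>i<n. (cmod (v $ i))\<^sup>2)"
  define t where "t = (\<Sum>a<r. (cmod (\<Sum>j<n. B $$ (a, j) * v $ j))\<^sup>2)"
  have row: "(\<Sum>j<n. (\<Sum>a<r. cnj (B $$ (a, i)) * B $$ (a, j)) * v $ j) = e * v $ i" if "i < n" for i
  proof -
    have "((mat_adjoint B * B) *\<^sub>v v) $ i = (\<Sum>j<n. (mat_adjoint B * B) $$ (i, j) * v $ j)"
      using that G v(1) by (auto simp: scalar_prod_def lessThan_atLeast0 intro!: sum.cong)
    then show ?thesis using v that index_gram[OF B that] by simp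
  qed
  have "of_real t = (\<Sum>a<r. cnj (\<Sum>i<n. B $$ (a, i) * v $ i) * (\<Sum>j<n. B $$ (a, j) * v $ j))"
    unfolding t_def of_real_sum by (simp only: complex_norm_square mult.commute)
  also have "\<dots> = (\<Sum>a<r. \<Sum>i<n. \<Sum>j<n. cnj (v $ i) * (cnj (B $$ (a, i)) * B $$ (a, j) * v $ j))"
    unfolding cnj_sum sum_product complex_cnj_mult by (simp only: mult_ac)
  also have "\<dots> = (\<Sum>i<n. \<Sum>a<r. \<Sum>j<n. cnj (v $ i) * (cnj (B $$ (a, i)) * B $$ (a, j) * v $ j))"
    by (rule sum.swap)
  also have "\<dots> = (\<Sum>i<n. cnj (v $ i) * (\<Sum>j<n. (\<Sum>a<r. cnj (B $$ (a, i)) * B $$ (a, j)) * v $ j))"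
    unfolding sum_distrib_left sum_distrib_right by (rule sum.cong[OF refl], rule sum.swap)
  also have "\<dots> = (\<Sum>i<n. cnj (v $ i) * (e * v $ i))"
    using row by (intro sum.cong) auto
  also have "\<dots> = e * of_real s"
    unfolding s_def of_real_sum sum_distrib_left
    by (rule sum.cong[OF refl]) (simp only: complex_norm_square mult_ac)
  finally have te: "of_real t = e * of_real s" .
  have "\<exists>i<n. v $ i \<noteq> 0" using v(1,2) by (auto simp: vec_eq_iff)
  then have "s > 0" unfolding s_def by (auto intro!: sum_pos2)
  moreover have "t \<ge> 0" unfolding t_def by (intro sum_nonneg) auto
  moreover have "e = of_real (t / s)" using te \<open>s > 0\<close> by (simp add: field_simps)
  ultimately show "e = of_real (Re e)" "0 \<le> Re e" by auto
qed

lemma mset_sq_sing_vals: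
  "mset (sq_sing_vals X) = image_mset Re (proots (char_poly (mat_adjoint X * X)))"
  by (simp add: sq_sing_vals_def)

text \<open>As the eigenvalues are real, the \<open>Re\<close> in \<open>sq_sing_vals\<close> loses
  nothing, and the list recovers the whole characteristic polynomial.\<close>

lemma sq_sing_vals:
  assumes X: "X \<in> carrier_mat r n"
  shows "length (sq_sing_vals X) = n" "\<And>x. x \<in> set (sq_sing_vals X) \<Longrightarrow> 0 \<le> x"
    and "char_poly (mat_adjoint X * X) = (\<Prod>x\<leftarrow>sq_sing_vals X. [:- of_real x, 1:])"
proof -
  let ?p = "char_poly (mat_adjoint X * X)"
  have G: "mat_adjoint X * X \<in> carrier_mat n n" by (rule gram_carrier[OF X])
  have p: "degree ?p = n" "coeff ?p n = 1" using degree_monic_char_poly[OF G] by auto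
  then have "?p \<noteq> 0" by auto
  have ev: "e = of_real (Re e) \<and> 0 \<le> Re e" if "e \<in># proots ?p" for e
    using that \<open>?p \<noteq> 0\<close> eigenvalue_gram[OF X] eigenvalue_root_char_poly[OF G] by auto
  show "length (sq_sing_vals X) = n"
    using size_proots_complex[of ?p] p by (simp add: mset_sq_sing_vals flip: size_mset)
  show "0 \<le> x" if "x \<in> set (sq_sing_vals X)" for x
    using that ev by (auto simp: mset_sq_sing_vals simp flip: set_mset_mset)
  obtain as where as: "?p = (\<Prod>a\<leftarrow>as. [:- a, 1:])" using char_poly_factorized[OF G] by blast
  have "proots ?p = mset as"
    unfolding as
  proof (induction as)
    case (Cons a as)
    have "(\<Prod>a\<leftarrow>as. [:- a, 1:]) \<noteq> 0" by (auto simp: prod_list_zero_iff)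
    then have "proots ([:- a, 1:] * (\<Prod>a\<leftarrow>as. [:- a, 1:])) = proots [:- a, 1:] + proots (\<Prod>a\<leftarrow>as. [:- a, 1:])"
      by (intro proots_mult) auto
    with Cons.IH show ?case by simp
  qed simp
  have "(\<Prod>x\<leftarrow>sq_sing_vals X. [:- complex_of_real x, 1:]) =
    (\<Prod>x\<in>#mset (sq_sing_vals X). [:- of_real x, 1:])" by (simp add: prod_mset_prod_list flip: mset_map)
  also have "\<dots> = (\<Prod>e\<in>#proots ?p. [:- of_real (Re e), 1:])"
    by (simp add: mset_sq_sing_vals multiset.map_comp o_def)
  also have "\<dots> = (\<Prod>e\<in>#proots ?p. [:- e, 1:])"
    using ev by (intro arg_cong[of _ _ prod_mset] image_mset_cong) auto
  also have "\<dots> = ?p" unfolding \<open>proots ?p = mset as\<close> by (subst as) (simp add: prod_mset_prod_list flip: mset_map)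
  finally show "?p = (\<Prod>x\<leftarrow>sq_sing_vals X. [:- of_real x, 1:])" ..
qed

text \<open>Setting the rows outside \<open>S\<close> to zero yields a matrix with all
  \<open>m\<close> rows and the same Gram matrix, so the facts on singular values apply without
  renumbering rows.\<close>

lemma gram_det_subset_linear_factors:
  assumes "S \<subseteq> {..<m}"
  obtains ys where "length ys = n" "\<And>y. y \<in> set ys \<Longrightarrow> 0 \<le> y" "\<And>z. gram_det n A S z = (\<Prod>y\<leftarrow>ys. z - of_real y)"
proof -
  define B where "B = mat m n (\<lambda>(r, j). if r \<in> S then A r j else 0)"
  have B: "B \<in> carrier_mat m n" by (simp add: B_def)
  have "(\<Sum>r\<in>S. cnj (A r i) * A r j) = (\<Sum>r<m. cnj (B $$ (r, i)) * B $$ (r, j))" if "i < n" "j < n" for i j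
    by (rule sum.mono_neutral_cong_left) (use that assms in \<open>auto simp: B_def\<close>)
  then have "gram_det n A S z = gram_det n (\<lambda>a j. B $$ (a, j)) {..<m} z" for z
    unfolding gram_det_def by (intro arg_cong[of _ _ det] eq_matI) auto
  then have "gram_det n A S z = (\<Prod>y\<leftarrow>sq_sing_vals B. z - of_real y)" for z
    by (simp add: poly_char_poly_gram[OF B, symmetric] sq_sing_vals(3)[OF B] poly_prod_list o_def)
  with sq_sing_vals(1,2)[OF B] show thesis by (rule that)
qed

text \<open>All roots are nonnegative, so at \<open>- norm z\<close> the factors have one common
  sign and modulus \<open>norm z + y\<close>, the largest possible on the circle through
  \<open>z\<close>. The right-hand side is real-linear in the determinant, unlike a norm, and can
  therefore be summed over \<open>S\<close>.\<close>

lemma norm_gram_det_le: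
  assumes "S \<subseteq> {..<m}"
  shows "norm (gram_det n A S z) \<le> Re ((- 1) ^ n * gram_det n A S (- of_real (norm z)))"
proof -
  from gram_det_subset_linear_factors[OF assms, of n A] obtain ys where ys: "length ys = n"
    "\<And>y. y \<in> set ys \<Longrightarrow> 0 \<le> y" "\<And>z. gram_det n A S z = (\<Prod>y\<leftarrow>ys. z - of_real y)" by blast
  have "norm (\<Prod>y\<leftarrow>ys. z - of_real y) \<le> (\<Prod>y\<leftarrow>ys. norm z + y) \<and> 0 \<le> (\<Prod>y\<leftarrow>ys. norm z + y)"
    using ys(2)
  proof (induction ys)
    case (Cons y ys)
    have "norm (z - of_real y) \<le> norm z + y"
      using norm_triangle_ineq4[of z "of_real y"] Cons.prems[of y] by simp
    then show ?case using Cons by (auto simp: norm_mult intro!: mult_mono)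
  qed simp
  moreover have "(- 1) ^ length ys * (\<Prod>y\<leftarrow>ys. - of_real (norm z) - of_real y) = complex_of_real (\<Prod>y\<leftarrow>ys. norm z + y)"
    by (induction ys) (auto simp: algebra_simps)
  ultimately show ?thesis using ys(1,3) by simp
qed

text \<open>A coefficient of the longer product combines two neighbouring ones of the shorter with
  weights \<open>\<bar>x\<bar>\<close> and 1, so each factor costs at most
  \<open>1 + \<bar>x\<bar>\<close>.\<close>

lemma norm_coeff_linear_factors_le:
  "norm (coeff (\<Prod>x\<leftarrow>xs. [:- complex_of_real x, 1:]) j) \<le> (\<Prod>x\<leftarrow>xs. 1 + \<bar>x\<bar>)"
proof (induction xs arbitrary: j)
  case (Cons x xs)
  let ?q = "\<Prod>x\<leftarrow>xs. [:- complex_of_real x, 1:]" and ?B = "\<Prod>x\<leftarrow>xs. 1 + \<bar>x\<bar>"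
  have "norm (coeff ([:- complex_of_real x, 1:] * ?q) j) \<le> \<bar>x\<bar> * norm (coeff ?q j) + (case j of 0 \<Rightarrow> 0 | Suc i \<Rightarrow> norm (coeff ?q i))"
    by (cases j) (auto simp: norm_mult coeff_pCons intro: order_trans[OF norm_triangle_ineq4] order_trans[OF norm_triangle_ineq])
  also have "\<dots> \<le> \<bar>x\<bar> * ?B + ?B"
    using Cons.IH order_trans[OF norm_ge_zero Cons.IH] by (intro add_mono mult_left_mono) (auto split: nat.split)
  finally show ?case by (simp add: algebra_simps)
qed simp

section \<open>Haar unitary matrices\<close>

text \<open>With the cut-off \<open>l\<close> in the formula the definition serves both
  \<open>U\<close> and its truncation: passing to the truncation only restricts the row index
  \<open>r\<close>.\<close>

definition mult_rows :: "nat \<Rightarrow> complex mat \<Rightarrow> complex mat \<Rightarrow> nat \<Rightarrow> nat \<Rightarrow> complex" where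
  "mult_rows l U Y r j = (\<Sum>c<l. U $$ (r, c) * Y $$ (c, j))"

lemma gram_det_cong:
  assumes "\<And>r j. r \<in> S \<Longrightarrow> j < n \<Longrightarrow> A r j = B r j"
  shows "gram_det n A S z = gram_det n B S z"
  unfolding gram_det_def using assms by (intro arg_cong[of _ _ det] eq_matI) (auto intro!: sum.cong)

text \<open>The first \<open>l\<close> columns of \<open>U\<close> are orthonormal, so the Gram
  matrix of all \<open>m\<close> rows forgets \<open>U\<close>.\<close>

lemma gram_det_unitary:
  assumes U: "U \<in> unitary_group m" and lm: "l \<le> m"
  shows "gram_det n (mult_rows l U Y) {..<m} z = gram_det n (\<lambda>c j. Y $$ (c, j)) {..<l} z"
proof -
  have Uc: "U \<in> carrier_mat m m" and UU: "mat_adjoint U * U = 1\<^sub>m m"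
    using U by (auto simp: unitary_group_def)
  have orth: "(\<Sum>r<m. cnj (U $$ (r, c)) * U $$ (r, d)) = (if c = d then 1 else 0)" if "c < l" "d < l" for c d
    using index_gram[OF Uc, of c d] that lm by (simp add: UU)
  have "(\<Sum>r<m. cnj (mult_rows l U Y r i) * mult_rows l U Y r j) = (\<Sum>c<l. cnj (Y $$ (c, i)) * Y $$ (c, j))" for i j
  proof -
    have "(\<Sum>r<m. cnj (mult_rows l U Y r i) * mult_rows l U Y r j) =
      (\<Sum>r<m. \<Sum>c<l. \<Sum>d<l. cnj (Y $$ (c, i)) * Y $$ (d, j) * (cnj (U $$ (r, c)) * U $$ (r, d)))"
      unfolding mult_rows_def cnj_sum sum_product complex_cnj_mult by (simp only: mult_ac)
    also have "\<dots> = (\<Sum>c<l. \<Sum>r<m. \<Sum>d<l. cnj (Y $$ (c, i)) * Y $$ (d, j) * (cnj (U $$ (r, c)) * U $$ (r, d)))"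
      by (rule sum.swap)
    also have "\<dots> = (\<Sum>c<l. \<Sum>d<l. cnj (Y $$ (c, i)) * Y $$ (d, j) * (\<Sum>r<m. cnj (U $$ (r, c)) * U $$ (r, d)))"
      unfolding sum_distrib_left by (rule sum.cong[OF refl], rule sum.swap)
    also have "\<dots> = (\<Sum>c<l. \<Sum>d<l. if c = d then cnj (Y $$ (c, i)) * Y $$ (d, j) else 0)"
      by (rule sum.cong[OF refl], rule sum.cong[OF refl]) (simp add: orth)
    finally show ?thesis by simp
  qed
  then show ?thesis unfolding gram_det_def by (simp only:)
qed

text \<open>The coefficients \<open>w\<close> are identified from the case \<open>N = m\<close>,
  where there is only one row set and its determinant is the characteristic polynomial. They are
  therefore independent of \<open>U\<close>.\<close>

lemma sum_gram_det_unitary: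
  assumes U: "U \<in> unitary_group m" and lm: "l \<le> m" and Y: "Y \<in> carrier_mat l n" and N: "n \<le> N" "N \<le> m"
  shows "(\<Sum>S | S \<subseteq> {..<m} \<and> card S = N. gram_det n (mult_rows l U Y) S z) =
    (\<Sum>j\<le>n. of_nat ((m - n + j) choose (N - n + j)) * coeff (char_poly (mat_adjoint Y * Y)) j * z ^ j)"
proof -
  let ?p = "char_poly (mat_adjoint Y * Y)"
  from sum_gram_det_subsets[of n m "mult_rows l U Y"] obtain w where
    w: "\<And>N z. n \<le> N \<Longrightarrow> N \<le> m \<Longrightarrow> (\<Sum>S | S \<subseteq> {..<m} \<and> card S = N. gram_det n (mult_rows l U Y) S z) =
      (\<Sum>k\<le>n. of_nat ((m - k) choose (N - k)) * w k * z ^ (n - k))" by blast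
  have nm: "n \<le> m" using N by simp
  have full: "{S. S \<subseteq> {..<m} \<and> card S = m} = {{..<m}}"
    using card_subset_eq[of "{..<m}"] by auto
  have "poly ?p z = poly (\<Sum>k\<le>n. monom (w k) (n - k)) z" for z
    using w[of m z] nm full
    by (simp add: gram_det_unitary[OF U lm] poly_char_poly_gram[OF Y] poly_sum poly_monom)
  then have p: "?p = (\<Sum>k\<le>n. monom (w k) (n - k))" by (simp add: poly_eq_poly_eq_iff[symmetric] fun_eq_iff)
  have coeff: "coeff ?p j = w (n - j)" if "j \<le> n" for j
  proof -
    have "coeff ?p j = (\<Sum>k\<le>n. if k = n - j then w k else 0)"
      unfolding p coeff_sum using that by (intro sum.cong) auto
    then show ?thesis by simp
  qed
  have "(\<Sum>S | S \<subseteq> {..<m} \<and> card S = N. gram_det n (mult_rows l U Y) S z) =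
      (\<Sum>k\<le>n. of_nat ((m - k) choose (N - k)) * w k * z ^ (n - k))" by (rule w[OF N])
  also have "\<dots> = (\<Sum>j\<le>n. of_nat ((m - n + j) choose (N - n + j)) * coeff ?p j * z ^ j)"
    using N by (intro sum.reindex_bij_witness[of _ "\<lambda>j. n - j" "\<lambda>k. n - k"]) (auto simp: coeff)
  finally show ?thesis .
qed

text \<open>At the point \<open>- norm z\<close> all row sets contribute nonnegative terms up to the
  sign \<open>(- 1) ^ n\<close>, so one of them is at most the sum. The bound is free of
  \<open>U\<close>; it gives integrability over \<open>U\<close> for fixed \<open>Y\<close> as well
  as joint integrability.\<close>

lemma norm_gram_det_unitary_le:
  assumes U: "U \<in> unitary_group m" and lm: "l \<le> m" and Y: "Y \<in> carrier_mat l n" and N: "n \<le> N" "N \<le> m"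
    and S: "S \<subseteq> {..<m}" "card S = N"
  shows "norm (gram_det n (mult_rows l U Y) S z) \<le>
    (\<Sum>j\<le>n. real ((m - n + j) choose (N - n + j)) * norm (coeff (char_poly (mat_adjoint Y * Y)) j) * norm z ^ j)"
proof -
  let ?g = "\<lambda>S. (- 1) ^ n * gram_det n (mult_rows l U Y) S (- of_real (norm z))"
  let ?SS = "{S. S \<subseteq> {..<m} \<and> card S = N}"
  have fin: "finite ?SS" by (rule finite_subset[of _ "Pow {..<m}"]) auto
  have "norm (gram_det n (mult_rows l U Y) S z) \<le> Re (?g S)" by (rule norm_gram_det_le[OF S(1)])
  also have "\<dots> \<le> (\<Sum>S\<in>?SS. Re (?g S))"
  proof (rule member_le_sum[OF _ _ fin])
    fix S' assume "S' \<in> ?SS - {S}"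
    then show "0 \<le> Re (?g S')"
      using norm_gram_det_le[of S' m n "mult_rows l U Y" z] by (auto intro: order_trans[OF norm_ge_zero])
  qed (use S in auto)
  also have "\<dots> = Re ((- 1) ^ n * (\<Sum>S\<in>?SS. gram_det n (mult_rows l U Y) S (- of_real (norm z))))"
    by (simp only: Re_sum sum_distrib_left)
  also have "\<dots> \<le> norm ((- 1) ^ n * (\<Sum>S\<in>?SS. gram_det n (mult_rows l U Y) S (- of_real (norm z))))"
    by (rule complex_Re_le_cmod)
  also have "\<dots> = norm (\<Sum>j\<le>n. of_nat ((m - n + j) choose (N - n + j)) *
      coeff (char_poly (mat_adjoint Y * Y)) j * (- complex_of_real (norm z)) ^ j)"
    unfolding sum_gram_det_unitary[OF U lm Y N] by (simp add: norm_mult norm_power)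
  also have "\<dots> \<le> (\<Sum>j\<le>n. real ((m - n + j) choose (N - n + j)) * norm (coeff (char_poly (mat_adjoint Y * Y)) j) * norm z ^ j)"
    by (rule order_trans[OF norm_sum]) (simp add: norm_mult norm_power)
  finally show ?thesis .
qed

lemma mat_adjoint_mult:
  fixes A B :: "complex mat"
  assumes "A \<in> carrier_mat a b" "B \<in> carrier_mat b c"
  shows "mat_adjoint (A * B) = mat_adjoint B * mat_adjoint A"
  using assms by (intro eq_matI) (auto simp: index_mat_adjoint scalar_prod_def mult.commute intro!: sum.cong)

lemma gram_det_mult_rows:
  assumes T: "T \<in> carrier_mat N l" and Y: "Y \<in> carrier_mat l n"
  shows "gram_det n (mult_rows l T Y) {..<N} z =
    det (z \<cdot>\<^sub>m 1\<^sub>m n - mat_adjoint Y * mat_adjoint T * T * Y)"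
proof -
  have TY: "T * Y \<in> carrier_mat N n" using T Y by simp
  have "gram_det n (mult_rows l T Y) {..<N} z = gram_det n (\<lambda>r j. (T * Y) $$ (r, j)) {..<N} z"
    using T Y by (intro gram_det_cong) (auto simp: mult_rows_def scalar_prod_def lessThan_atLeast0 intro!: sum.cong)
  also have "\<dots> = det (z \<cdot>\<^sub>m 1\<^sub>m n - mat_adjoint (T * Y) * (T * Y))" by (rule gram_det_eq_det[OF TY])
  also have "mat_adjoint (T * Y) * (T * Y) = mat_adjoint Y * mat_adjoint T * T * Y"
  proof -
    have "mat_adjoint Y * mat_adjoint T \<in> carrier_mat n N" using T Y by (intro carrier_matI) auto
    then show ?thesis using assoc_mult_mat[of "mat_adjoint Y * mat_adjoint T" n N T l Y n] T Y
      by (simp add: mat_adjoint_mult[OF T Y])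
  qed
  finally show ?thesis .
qed

section \<open>Measurability of matrix functions\<close>

lemma space_mat_borel: "space (mat_borel r c) = carrier_mat r c"
  by (simp add: mat_borel_def)

lemma measurable_mat_borel_index [measurable]:
  assumes "i < r" "j < c"
  shows "(\<lambda>A. A $$ (i, j)) \<in> borel_measurable (mat_borel r c)"
proof -
  have "(\<lambda>A. \<lambda>ij\<in>{..<r} \<times> {..<c}. A $$ ij) \<in> measurable (mat_borel r c) (PiM ({..<r} \<times> {..<c}) (\<lambda>_. borel))"
    unfolding mat_borel_def by (rule measurable_vimage_algebra1) (auto simp: space_PiM)
  from measurable_compose[OF this measurable_component_singleton[of "(i, j)"]] show ?thesis
    using assms by simp
qed

lemma measurable_mat_borelI:
  assumes "\<And>\<omega>. \<omega> \<in> space M \<Longrightarrow> A \<omega> \<in> carrier_mat r c"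
    and "\<And>i j. i < r \<Longrightarrow> j < c \<Longrightarrow> (\<lambda>\<omega>. A \<omega> $$ (i, j)) \<in> borel_measurable M"
  shows "A \<in> measurable M (mat_borel r c)"
  unfolding mat_borel_def
  by (rule measurable_vimage_algebra2) (use assms in \<open>auto intro!: measurable_restrict\<close>)

lemma borel_measurable_gram_det:
  assumes "finite S" "\<And>r j. r \<in> S \<Longrightarrow> j < n \<Longrightarrow> (\<lambda>x. A x r j) \<in> borel_measurable M"
  shows "(\<lambda>x. gram_det n (A x) S z) \<in> borel_measurable M"
  unfolding gram_det_def
proof (rule borel_measurable_det, unfold prod.case)
  have cnj: "(\<lambda>x. cnj (A x r j)) \<in> borel_measurable M" if "r \<in> S" "j < n" for r j
    by (rule measurable_compose[OF assms(2)[OF that] borel_measurable_continuous_onI]) (intro continuous_intros)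
  fix i j assume ij: "i < n" "j < n"
  then show "(\<lambda>x. (if i = j then z else 0) - (\<Sum>r\<in>S. cnj (A x r i) * A x r j)) \<in> borel_measurable M"
    by (intro borel_measurable_diff borel_measurable_const borel_measurable_sum borel_measurable_times
        cnj assms(2)) auto
qed

section \<open>Permutation matrices and the exchange of rows\<close>

lemma unitary_permutation_matrix:
  assumes \<pi>: "\<pi> permutes {..<m}"
  defines "V \<equiv> mat m m (\<lambda>(i, j). if j = \<pi> i then 1 else 0)"
  shows "V \<in> unitary_group m"
    and "\<And>U i j. U \<in> carrier_mat m c \<Longrightarrow> i < m \<Longrightarrow> j < c \<Longrightarrow> (V * U) $$ (i, j) = U $$ (\<pi> i, j)"
proof -
  have V: "V \<in> carrier_mat m m" by (simp add: V_def)
  have \<pi>_less: "\<pi> i < m" if "i < m" for i using permutes_in_image[OF \<pi>, of i] that by simp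
  show *: "(V * U) $$ (i, j) = U $$ (\<pi> i, j)" if "U \<in> carrier_mat m c" "i < m" "j < c" for U c i j
  proof -
    have "(V * U) $$ (i, j) = (\<Sum>k<m. (if k = \<pi> i then 1 else 0) * U $$ (k, j))"
      using that by (auto simp: V_def scalar_prod_def lessThan_atLeast0 intro!: sum.cong)
    also have "\<dots> = (\<Sum>k<m. if k = \<pi> i then U $$ (k, j) else 0)" by (intro sum.cong) auto
    finally show ?thesis using \<pi>_less[OF that(2)] by simp
  qed
  have VV: "V * mat_adjoint V = 1\<^sub>m m"
  proof (rule eq_matI)
    fix i j assume ij: "i < dim_row (1\<^sub>m m)" "j < dim_col (1\<^sub>m m)"
    have "mat_adjoint V \<in> carrier_mat m m" using V by (intro carrier_matI) auto
    then have "(V * mat_adjoint V) $$ (i, j) = mat_adjoint V $$ (\<pi> i, j)" using * ij by simp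
    also have "\<dots> = (if i = j then 1 else 0)"
      using ij \<pi>_less permutes_inj[OF \<pi>] by (auto simp: index_mat_adjoint V_def inj_eq)
    finally show "(V * mat_adjoint V) $$ (i, j) = 1\<^sub>m m $$ (i, j)" using ij by simp
  qed (use V in auto)
  moreover have "mat_adjoint V * V = 1\<^sub>m m"
    by (rule mat_mult_left_right_inverse[OF V _ VV]) (use V in \<open>auto intro!: carrier_matI\<close>)
  ultimately show "V \<in> unitary_group m" using V by (simp add: unitary_group_def)
qed

lemma mult_unitary_group:
  assumes "V \<in> unitary_group m" "U \<in> unitary_group m"
  shows "V * U \<in> unitary_group m"
proof -
  have c: "V \<in> carrier_mat m m" "U \<in> carrier_mat m m" "mat_adjoint V \<in> carrier_mat m m" "mat_adjoint U \<in> carrier_mat m m"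
    using assms by (auto simp: unitary_group_def intro!: carrier_matI)
  have "mat_adjoint U * mat_adjoint V * (V * U) = mat_adjoint U * (mat_adjoint V * V) * U"
    using c by (simp add: assoc_mult_mat[of _ m m _ m _ m])
  moreover have "V * U * (mat_adjoint U * mat_adjoint V) = V * (U * mat_adjoint U) * mat_adjoint V"
    using c by (simp add: assoc_mult_mat[of _ m m _ m _ m])
  ultimately show ?thesis
    using assms c by (simp add: unitary_group_def mat_adjoint_mult[OF c(1,2)])
qed

text \<open>A bijection onto \<open>S\<close> extends to a permutation because the number of its
  extensions, \<open>fact (m - N)\<close>, is not zero.\<close>

lemma ex_permutes_image_lessThan:
  assumes "S \<subseteq> {..<m :: nat}" "card S = N"
  obtains \<pi> where "\<pi> permutes {..<m}" "\<pi> ` {..<N} = S"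
proof -
  have fS: "finite S" using assms(1) finite_subset by blast
  obtain h where h: "bij_betw h {..<N} S"
    using finite_same_card_bij[of "{..<N}" S] fS assms(2) by auto
  define \<phi> where "\<phi> = restrict h {..<N}"
  have \<phi>: "\<phi> \<in> {..<N} \<rightarrow>\<^sub>E {..<m}" "inj_on \<phi> {..<N}" "\<phi> ` {..<N} = S"
    using h assms(1) by (auto simp: \<phi>_def bij_betw_def inj_on_def)
  have "card {\<sigma>. \<sigma> permutes {..<m} \<and> restrict \<sigma> {..<N} = \<phi>} \<noteq> 0"
    unfolding card_permutes_extending[OF \<phi>(1,2)] by simp
  then have "{\<sigma>. \<sigma> permutes {..<m} \<and> restrict \<sigma> {..<N} = \<phi>} \<noteq> {}" by force
  then obtain \<sigma> where \<sigma>: "\<sigma> permutes {..<m}" "restrict \<sigma> {..<N} = \<phi>" by auto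
  then have "\<sigma> ` {..<N} = S" using \<phi>(3) by auto
  with \<sigma>(1) show thesis by (rule that)
qed

lemma haar_measurable_index:
  assumes "haar_distributed M m U" "i < m" "j < m"
  shows "(\<lambda>\<omega>. U \<omega> $$ (i, j)) \<in> borel_measurable M"
proof -
  have "(\<lambda>A. A $$ (i, j)) \<in> borel_measurable (unitary_space m)"
    unfolding unitary_space_def using assms by (intro measurable_restrict_space1 measurable_mat_borel_index) auto
  from measurable_compose[OF _ this, of U M] show ?thesis using assms(1) unfolding haar_distributed_def by blast
qed

lemma haar_in_unitary_group:
  assumes "haar_distributed M m U" "\<omega> \<in> space M"
  shows "U \<omega> \<in> unitary_group m"
  using assms measurable_space[of U M "unitary_space m" \<omega>]
  by (auto simp: haar_distributed_def unitary_space_def space_restrict_space)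

lemma haar_integral_gram_det_rows:
  assumes U: "haar_distributed M m U" and lm: "l \<le> m" and S: "S \<subseteq> {..<m}" "card S = N"
  shows "(LINT \<omega>|M. gram_det n (mult_rows l (U \<omega>) Y) S z) =
         (LINT \<omega>|M. gram_det n (mult_rows l (U \<omega>) Y) {..<N} z)"
proof -
  let ?US = "unitary_space m"
  from ex_permutes_image_lessThan[OF S] obtain \<pi> where \<pi>: "\<pi> permutes {..<m}" "\<pi> ` {..<N} = S" .
  define V where "V = mat m m (\<lambda>(i, j). if j = \<pi> i then 1 else 0 :: complex)"
  have V: "V \<in> unitary_group m"
    and VU: "\<And>W i j. W \<in> carrier_mat m m \<Longrightarrow> i < m \<Longrightarrow> j < m \<Longrightarrow> (V * W) $$ (i, j) = W $$ (\<pi> i, j)"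
    unfolding V_def by (rule unitary_permutation_matrix[OF \<pi>(1)])+
  define h where "h W = gram_det n (mult_rows l W Y) {..<N} z" for W
  have Nm: "N \<le> m" using S card_mono[of "{..<m}" S] by simp
  have Um: "U \<in> measurable M ?US" and inv: "distr M ?US (\<lambda>\<omega>. V * U \<omega>) = distr M ?US U"
    using U V by (auto simp: haar_distributed_def)
  have carrier: "U \<omega> \<in> carrier_mat m m" if "\<omega> \<in> space M" for \<omega>
    using haar_in_unitary_group[OF U that] by (simp add: unitary_group_def)
  have VUm: "(\<lambda>\<omega>. V * U \<omega>) \<in> measurable M ?US"
    unfolding unitary_space_def
  proof (rule measurable_restrict_space2)
    show "(\<lambda>\<omega>. V * U \<omega>) \<in> space M \<rightarrow> unitary_group m"
      using mult_unitary_group[OF V haar_in_unitary_group[OF U]] by auto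
    show "(\<lambda>\<omega>. V * U \<omega>) \<in> measurable M (mat_borel m m)"
    proof (rule measurable_mat_borelI)
      show "V * U \<omega> \<in> carrier_mat m m" if "\<omega> \<in> space M" for \<omega>
        using carrier[OF that] V by (auto simp: unitary_group_def)
      fix i j assume ij: "i < m" "j < m"
      then have "(\<lambda>\<omega>. U \<omega> $$ (\<pi> i, j)) \<in> borel_measurable M"
        using permutes_in_image[OF \<pi>(1), of i] by (intro haar_measurable_index[OF U]) auto
      then show "(\<lambda>\<omega>. (V * U \<omega>) $$ (i, j)) \<in> borel_measurable M"
        by (rule measurable_cong[THEN iffD2, rotated]) (use VU carrier ij in auto)
    qed
  qed
  have hm: "h \<in> borel_measurable ?US"
    unfolding h_def mult_rows_def unitary_space_def
    by (intro measurable_restrict_space1 borel_measurable_gram_det borel_measurable_sum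
        borel_measurable_times measurable_mat_borel_index) (use Nm lm in auto)
  \<comment> \<open>Row \<open>r\<close> of \<open>V * U \<omega>\<close> is row
    \<open>\<pi> r\<close> of \<open>U \<omega>\<close>, and \<open>\<pi>\<close> maps the first
    \<open>N\<close> indices bijectively onto \<open>S\<close>.\<close>
  have "gram_det n (mult_rows l (U \<omega>) Y) S z = h (V * U \<omega>)" if "\<omega> \<in> space M" for \<omega>
  proof -
    have "(\<Sum>r\<in>S. cnj (mult_rows l (U \<omega>) Y r i) * mult_rows l (U \<omega>) Y r j) =
      (\<Sum>r<N. cnj (mult_rows l (V * U \<omega>) Y r i) * mult_rows l (V * U \<omega>) Y r j)" for i j
    proof -
      have "mult_rows l (V * U \<omega>) Y r j = mult_rows l (U \<omega>) Y (\<pi> r) j" if "r < N" for r j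
        unfolding mult_rows_def using that VU[OF carrier[OF \<open>\<omega> \<in> space M\<close>]] Nm lm by (intro sum.cong) auto
      then show ?thesis
        unfolding \<pi>(2)[symmetric] using permutes_inj[OF \<pi>(1)]
        by (subst sum.reindex) (auto intro: inj_on_subset)
    qed
    then show ?thesis unfolding h_def gram_det_def by (simp only:)
  qed
  then have "(LINT \<omega>|M. gram_det n (mult_rows l (U \<omega>) Y) S z) = (LINT \<omega>|M. h (V * U \<omega>))"
    by (intro Bochner_Integration.integral_cong) auto
  also have "\<dots> = (LINT W|distr M ?US U. h W)"
    unfolding inv[symmetric] by (rule integral_distr[OF VUm hm, symmetric])
  also have "\<dots> = (LINT \<omega>|M. h (U \<omega>))" by (rule integral_distr[OF Um hm])
  finally show ?thesis by (simp add: h_def)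
qed

lemma haar_integral_gram_det:
  assumes U: "haar_distributed M m U" and lm: "l \<le> m" and Y: "Y \<in> carrier_mat l n" and N: "n \<le> N" "N \<le> m"
  shows "of_nat (m choose N) * (LINT \<omega>|M. gram_det n (mult_rows l (U \<omega>) Y) {..<N} z) =
    (\<Sum>j\<le>n. of_nat ((m - n + j) choose (N - n + j)) * coeff (char_poly (mat_adjoint Y * Y)) j * z ^ j)"
proof -
  interpret prob_space M using U by (simp add: haar_distributed_def)
  let ?SS = "{S. S \<subseteq> {..<m} \<and> card S = N}"
  have int: "integrable M (\<lambda>\<omega>. gram_det n (mult_rows l (U \<omega>) Y) S z)" if S: "S \<in> ?SS" for S
  proof (rule integrable_const_bound)
    show "AE \<omega> in M. norm (gram_det n (mult_rows l (U \<omega>) Y) S z) \<le>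
      (\<Sum>j\<le>n. real ((m - n + j) choose (N - n + j)) * norm (coeff (char_poly (mat_adjoint Y * Y)) j) * norm z ^ j)"
      using S by (intro AE_I2 norm_gram_det_unitary_le haar_in_unitary_group[OF U] lm Y N) auto
    have "finite S" using S finite_subset[of S "{..<m}"] by auto
    then show "(\<lambda>\<omega>. gram_det n (mult_rows l (U \<omega>) Y) S z) \<in> borel_measurable M"
      unfolding mult_rows_def using S lm
      by (intro borel_measurable_gram_det borel_measurable_sum borel_measurable_times
          haar_measurable_index[OF U]) auto
  qed
  have "of_nat (m choose N) * (LINT \<omega>|M. gram_det n (mult_rows l (U \<omega>) Y) {..<N} z) =
      (\<Sum>S\<in>?SS. LINT \<omega>|M. gram_det n (mult_rows l (U \<omega>) Y) {..<N} z)"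
    by (simp add: n_subsets)
  also have "\<dots> = (\<Sum>S\<in>?SS. LINT \<omega>|M. gram_det n (mult_rows l (U \<omega>) Y) S z)"
    by (rule sum.cong[OF refl], rule haar_integral_gram_det_rows[OF U lm, symmetric]) auto
  also have "\<dots> = (LINT \<omega>|M. (\<Sum>S\<in>?SS. gram_det n (mult_rows l (U \<omega>) Y) S z))"
    by (rule Bochner_Integration.integral_sum[OF int, symmetric])
  \<comment> \<open>Summed over all row sets, the integrand has the same value for every unitary
    matrix, so this is the expectation of a constant.\<close>
  also have "\<dots> = (LINT \<omega>|M. (\<Sum>j\<le>n. of_nat ((m - n + j) choose (N - n + j)) * coeff (char_poly (mat_adjoint Y * Y)) j * z ^ j))"
    by (rule Bochner_Integration.integral_cong[OF refl])
      (rule sum_gram_det_unitary[OF haar_in_unitary_group[OF U] lm Y N])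
  finally show ?thesis by (simp add: prob_space)
qed

section \<open>Averaging over both random matrices\<close>

lemma borel_measurable_coeff_linear_factors:
  fixes a :: "nat \<Rightarrow> 'a \<Rightarrow> real"
  assumes "\<And>i. i < n \<Longrightarrow> a i \<in> borel_measurable M"
  shows "(\<lambda>\<omega>. coeff (\<Prod>i<n. [:- complex_of_real (a i \<omega>), 1:]) j) \<in> borel_measurable M"
  using assms
proof (induction n arbitrary: j)
  case (Suc n)
  have IH: "(\<lambda>\<omega>. coeff (\<Prod>i<n. [:- complex_of_real (a i \<omega>), 1:]) j) \<in> borel_measurable M" for j
    by (rule Suc.IH) (simp add: Suc.prems)
  define Q where "Q \<omega> = (\<Prod>i<n. [:- complex_of_real (a i \<omega>), 1:])" for \<omega>
  have [measurable]: "(\<lambda>\<omega>. coeff (Q \<omega>) j) \<in> borel_measurable M" for j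
    unfolding Q_def by (rule IH)
  have [measurable]: "a n \<in> borel_measurable M" by (rule Suc.prems) simp
  have eq: "coeff (\<Prod>i<Suc n. [:- complex_of_real (a i \<omega>), 1:]) j =
    - complex_of_real (a n \<omega>) * coeff (Q \<omega>) j + (if j = 0 then 0 else coeff (Q \<omega>) (j - 1))" for \<omega>
  proof -
    have "(\<Prod>i<Suc n. [:- complex_of_real (a i \<omega>), 1:]) = [:- complex_of_real (a n \<omega>), 1:] * Q \<omega>"
      unfolding prod.lessThan_Suc Q_def[symmetric] by (rule mult.commute)
    then show ?thesis by (cases j) (simp_all add: coeff_pCons)
  qed
  show ?case unfolding eq by measurable
qed simp

text \<open>Measurability is obtained from the points, which are measurable by the definition of the
  ensemble: the coefficients are polynomial expressions in them.\<close>

lemma sq_sing_vals_coeff_integrable: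
  assumes M: "prob_space M" and f: "ensemble_weights n f"
    and X: "X \<in> measurable M (mat_borel l n)"
    and follows: "follows_polynomial_ensemble M n (\<lambda>\<omega>. sq_sing_vals (X \<omega>)) f Z"
  shows "integrable M (\<lambda>\<omega>. coeff (char_poly (mat_adjoint (X \<omega>) * X \<omega>)) j)"
proof (rule Bochner_Integration.integrable_bound)
  have Xc: "X \<omega> \<in> carrier_mat l n" if "\<omega> \<in> space M" for \<omega>
    using measurable_space[OF X that] by (simp add: space_mat_borel)
  have fm: "f k \<in> borel_measurable borel" if "k < n" for k
    using f that by (simp add: ensemble_weights_def)
  let ?x = "\<lambda>\<omega> i. sq_sing_vals (X \<omega>) ! i"
  show "integrable M (\<lambda>\<omega>. \<Prod>i<n. 1 + \<bar>?x \<omega> i\<bar>)"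
    by (rule integrable_polynomial_ensemble_points[OF M f follows])
  have nth: "prod_list (map g (sq_sing_vals (X \<omega>))) = (\<Prod>i<n. g (?x \<omega> i))" if "\<omega> \<in> space M"
    for \<omega> and g :: "real \<Rightarrow> 'b :: comm_monoid_mult"
    by (simp add: prod.list_conv_set_nth sq_sing_vals(1)[OF Xc[OF that]] lessThan_atLeast0)
  have poly: "char_poly (mat_adjoint (X \<omega>) * X \<omega>) = (\<Prod>i<n. [:- complex_of_real (?x \<omega> i), 1:])"
    if "\<omega> \<in> space M" for \<omega>
    using sq_sing_vals(3)[OF Xc[OF that]] nth[OF that] by simp
  show "(\<lambda>\<omega>. coeff (char_poly (mat_adjoint (X \<omega>) * X \<omega>)) j) \<in> borel_measurable M"
    by (rule measurable_cong[THEN iffD2, OF _ borel_measurable_coeff_linear_factors])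
      (use poly follows_nth_measurable[OF M fm follows] in auto)
  show "AE \<omega> in M. norm (coeff (char_poly (mat_adjoint (X \<omega>) * X \<omega>)) j) \<le> norm (\<Prod>i<n. 1 + \<bar>?x \<omega> i\<bar>)"
  proof (rule AE_I2)
    fix \<omega> assume \<omega>: "\<omega> \<in> space M"
    have "norm (coeff (char_poly (mat_adjoint (X \<omega>) * X \<omega>)) j) \<le> (\<Prod>x\<leftarrow>sq_sing_vals (X \<omega>). 1 + \<bar>x\<bar>)"
      unfolding sq_sing_vals(3)[OF Xc[OF \<omega>]] by (rule norm_coeff_linear_factors_le)
    also have "\<dots> = (\<Prod>i<n. 1 + \<bar>?x \<omega> i\<bar>)" by (rule nth[OF \<omega>])
    also have "\<dots> \<le> norm (\<Prod>i<n. 1 + \<bar>?x \<omega> i\<bar>)" by simp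
    finally show "norm (coeff (char_poly (mat_adjoint (X \<omega>) * X \<omega>)) j) \<le> norm (\<Prod>i<n. 1 + \<bar>?x \<omega> i\<bar>)" .
  qed
qed

text \<open>By independence the joint law is a product, so \<open>T\<close> can be integrated first
  with \<open>X\<close> frozen, which is the Haar integral already known. Its value is linear in the
  coefficients of the characteristic polynomial, and only their expectations survive the outer
  integral.\<close>

lemma average_char_poly_truncated:
  assumes M: "prob_space M" and f: "ensemble_weights n f"
    and lm: "l \<le> m" and N: "n \<le> N" "N \<le> m"
    and U: "haar_distributed M m U"
    and X: "X \<in> measurable M (mat_borel l n)"
    and follows: "follows_polynomial_ensemble M n (\<lambda>\<omega>. sq_sing_vals (X \<omega>)) f Z"
    and T: "T = (\<lambda>\<omega>. truncation N l (U \<omega>))"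
    and indep: "prob_space.indep_var M (mat_borel N l) T (mat_borel l n) X"
  shows "integrable M (\<lambda>\<omega>. det (z \<cdot>\<^sub>m 1\<^sub>m n - mat_adjoint (X \<omega>) * mat_adjoint (T \<omega>) * T \<omega> * X \<omega>))"
    and "of_nat (m choose N) *
      (LINT \<omega>|M. det (z \<cdot>\<^sub>m 1\<^sub>m n - mat_adjoint (X \<omega>) * mat_adjoint (T \<omega>) * T \<omega> * X \<omega>)) =
      (\<Sum>j\<le>n. of_nat ((m - n + j) choose (N - n + j)) *
         (LINT \<omega>|M. coeff (char_poly (mat_adjoint (X \<omega>) * X \<omega>)) j) * z ^ j)"
proof -
  interpret prob_space M by (rule M)
  let ?TT = "mat_borel N l" and ?XX = "mat_borel l n"
  let ?c = "\<lambda>\<omega> j. coeff (char_poly (mat_adjoint (X \<omega>) * X \<omega>)) j"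
  let ?b = "\<lambda>j. (m - n + j) choose (N - n + j)"
  define \<Psi> where "\<Psi> t y = gram_det n (mult_rows l t y) {..<N} z" for t y
  have Tm: "T \<in> measurable M ?TT"
    and joint: "distr M ?TT T \<Otimes>\<^sub>M distr M ?XX X = distr M (?TT \<Otimes>\<^sub>M ?XX) (\<lambda>\<omega>. (T \<omega>, X \<omega>))"
    using indep unfolding indep_var_distribution_eq by auto
  have Xc: "X \<omega> \<in> carrier_mat l n" and Tc: "T \<omega> \<in> carrier_mat N l" if "\<omega> \<in> space M" for \<omega>
    using measurable_space[OF X that] measurable_space[OF Tm that] by (simp_all add: space_mat_borel)
  have \<Psi>_det: "\<Psi> (T \<omega>) (X \<omega>) = det (z \<cdot>\<^sub>m 1\<^sub>m n - mat_adjoint (X \<omega>) * mat_adjoint (T \<omega>) * T \<omega> * X \<omega>)"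
    if "\<omega> \<in> space M" for \<omega>
    unfolding \<Psi>_def by (rule gram_det_mult_rows[OF Tc[OF that] Xc[OF that]])
  \<comment> \<open>Only rows below \<open>N\<close> and columns below \<open>l\<close> are read,
    where \<open>T \<omega>\<close> and \<open>U \<omega>\<close> have the same entries.\<close>
  have \<Psi>_U: "\<Psi> (T \<omega>) y = gram_det n (mult_rows l (U \<omega>) y) {..<N} z" for \<omega> y
    unfolding \<Psi>_def T mult_rows_def truncation_def by (intro gram_det_cong sum.cong) auto
  have c_int: "integrable M (\<lambda>\<omega>. ?c \<omega> j)" for j
    by (rule sq_sing_vals_coeff_integrable[OF M f X follows])
  have \<Psi>m: "(\<lambda>(t, y). \<Psi> t y) \<in> borel_measurable (?TT \<Otimes>\<^sub>M ?XX)"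
    unfolding \<Psi>_def case_prod_unfold mult_rows_def
    by (intro borel_measurable_gram_det borel_measurable_sum borel_measurable_times
        measurable_compose[OF measurable_fst measurable_mat_borel_index]
        measurable_compose[OF measurable_snd measurable_mat_borel_index]) auto
  have TXm: "(\<lambda>\<omega>. (T \<omega>, X \<omega>)) \<in> measurable M (?TT \<Otimes>\<^sub>M ?XX)" using Tm X by simp
  have \<Psi>_int: "integrable M (\<lambda>\<omega>. \<Psi> (T \<omega>) (X \<omega>))"
  proof (rule Bochner_Integration.integrable_bound)
    show "integrable M (\<lambda>\<omega>. \<Sum>j\<le>n. real (?b j) * norm (?c \<omega> j) * norm z ^ j)"
      by (intro Bochner_Integration.integrable_sum integrable_mult_left integrable_mult_right integrable_norm c_int)
    show "(\<lambda>\<omega>. \<Psi> (T \<omega>) (X \<omega>)) \<in> borel_measurable M"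
      using measurable_compose[OF TXm \<Psi>m] by simp
    show "AE \<omega> in M. norm (\<Psi> (T \<omega>) (X \<omega>)) \<le> norm (\<Sum>j\<le>n. real (?b j) * norm (?c \<omega> j) * norm z ^ j)"
    proof (rule AE_I2)
      fix \<omega> assume \<omega>: "\<omega> \<in> space M"
      have "norm (\<Psi> (T \<omega>) (X \<omega>)) \<le> (\<Sum>j\<le>n. real (?b j) * norm (?c \<omega> j) * norm z ^ j)"
        unfolding \<Psi>_U
        by (rule norm_gram_det_unitary_le[OF haar_in_unitary_group[OF U \<omega>] lm Xc[OF \<omega>] N]) (use N in auto)
      then show "norm (\<Psi> (T \<omega>) (X \<omega>)) \<le> norm (\<Sum>j\<le>n. real (?b j) * norm (?c \<omega> j) * norm z ^ j)" by simp
    qed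
  qed
  then show "integrable M (\<lambda>\<omega>. det (z \<cdot>\<^sub>m 1\<^sub>m n - mat_adjoint (X \<omega>) * mat_adjoint (T \<omega>) * T \<omega> * X \<omega>))"
    by (rule Bochner_Integration.integrable_cong[THEN iffD1, rotated 2]) (use \<Psi>_det in auto)
  interpret T: prob_space "distr M ?TT T" by (rule prob_space_distr[OF Tm])
  interpret X: prob_space "distr M ?XX X" by (rule prob_space_distr[OF X])
  interpret TX: pair_sigma_finite "distr M ?TT T" "distr M ?XX X" ..
  have prod_int: "integrable (distr M ?TT T \<Otimes>\<^sub>M distr M ?XX X) (\<lambda>(t, y). \<Psi> t y)"
    unfolding joint using \<Psi>_int by (subst integrable_distr_eq[OF TXm \<Psi>m]) simp
  have \<Psi>1: "(\<lambda>t. \<Psi> t y) \<in> borel_measurable ?TT" if "y \<in> carrier_mat l n" for y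
    using measurable_compose[OF measurable_Pair2'[of y ?XX ?TT] \<Psi>m] that by (simp add: space_mat_borel)
  have inner: "of_nat (m choose N) * (LINT t|distr M ?TT T. \<Psi> t (X \<omega>)) = (\<Sum>j\<le>n. of_nat (?b j) * ?c \<omega> j * z ^ j)"
    if "\<omega> \<in> space M" for \<omega>
    using haar_integral_gram_det[OF U lm Xc[OF that] N, of z]
    by (simp add: integral_distr[OF Tm \<Psi>1[OF Xc[OF that]]] \<Psi>_U)
  have "(LINT \<omega>|M. \<Psi> (T \<omega>) (X \<omega>)) = (LINT (t, y)|(distr M ?TT T \<Otimes>\<^sub>M distr M ?XX X). \<Psi> t y)"
    unfolding joint by (subst integral_distr[OF TXm \<Psi>m]) simp
  also have "\<dots> = (LINT y|distr M ?XX X. LINT t|distr M ?TT T. \<Psi> t y)"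
    by (rule TX.integral_snd[OF prod_int, symmetric])
  also have "\<dots> = (LINT \<omega>|M. LINT t|distr M ?TT T. \<Psi> t (X \<omega>))"
  proof (rule integral_distr[OF X])
    have "(\<lambda>y. LINT t|distr M ?TT T. \<Psi> t y) \<in> borel_measurable (distr M ?XX X)"
      by (rule borel_measurable_integrable[OF TX.integrable_snd[OF prod_int]])
    then show "(\<lambda>y. LINT t|distr M ?TT T. \<Psi> t y) \<in> borel_measurable ?XX" by simp
  qed
  finally have "of_nat (m choose N) * (LINT \<omega>|M. \<Psi> (T \<omega>) (X \<omega>)) =
      (LINT \<omega>|M. of_nat (m choose N) * (LINT t|distr M ?TT T. \<Psi> t (X \<omega>)))" by simp
  also have "\<dots> = (LINT \<omega>|M. (\<Sum>j\<le>n. of_nat (?b j) * ?c \<omega> j * z ^ j))"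
    by (rule Bochner_Integration.integral_cong[OF refl inner])
  also have "\<dots> = (\<Sum>j\<le>n. of_nat (?b j) * (LINT \<omega>|M. ?c \<omega> j) * z ^ j)"
    using c_int by (subst Bochner_Integration.integral_sum) (auto intro!: integrable_mult_left integrable_mult_right)
  also have "(LINT \<omega>|M. \<Psi> (T \<omega>) (X \<omega>)) =
      (LINT \<omega>|M. det (z \<cdot>\<^sub>m 1\<^sub>m n - mat_adjoint (X \<omega>) * mat_adjoint (T \<omega>) * T \<omega> * X \<omega>))"
    by (rule Bochner_Integration.integral_cong[OF refl \<Psi>_det])
  finally show "of_nat (m choose N) *
      (LINT \<omega>|M. det (z \<cdot>\<^sub>m 1\<^sub>m n - mat_adjoint (X \<omega>) * mat_adjoint (T \<omega>) * T \<omega> * X \<omega>)) =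
      (\<Sum>j\<le>n. of_nat (?b j) * (LINT \<omega>|M. ?c \<omega> j) * z ^ j)" .
qed

section \<open>The product ensemble\<close>

text \<open>The action of the contour integral on polynomials. The factor \<open>\<mu>\<close> is
  kept out because it belongs to the biorthogonal polynomials only; the average characteristic
  polynomial is normalised by the reciprocal of \<open>m choose (n + \<nu>)\<close> instead.\<close>

definition binomial_scale :: "nat \<Rightarrow> nat \<Rightarrow> complex poly \<Rightarrow> complex poly" where
  "binomial_scale \<nu> \<mu> r = (\<Sum>i\<le>degree r. monom (of_nat ((\<nu> + i + \<mu>) choose \<mu>) * coeff r i) i)"

lemma coeff_binomial_scale:
  "coeff (binomial_scale \<nu> \<mu> r) i = of_nat ((\<nu> + i + \<mu>) choose \<mu>) * coeff r i"
  by (auto simp: binomial_scale_def coeff_sum coeff_eq_0)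

lemma degree_binomial_scale [simp]: "degree (binomial_scale \<nu> \<mu> r) = degree r"
proof (rule antisym)
  show "degree (binomial_scale \<nu> \<mu> r) \<le> degree r"
    by (rule degree_le) (simp add: coeff_binomial_scale coeff_eq_0)
  show "degree r \<le> degree (binomial_scale \<nu> \<mu> r)"
  proof (cases "r = 0")
    case False
    then have "coeff (binomial_scale \<nu> \<mu> r) (degree r) \<noteq> 0"
      by (simp add: coeff_binomial_scale binomial_eq_0_iff)
    then show ?thesis by (rule le_degree)
  qed simp
qed

lemma has_contour_integral_binomial_scale:
  assumes "admissible_contour \<gamma>"
  shows "((\<lambda>s. s powi (- int \<nu>) * (1 - s) powi (- int \<mu> - 1) * poly r (x / s) * (1 / s))
           has_contour_integral 2 * of_real pi * \<i> * poly (binomial_scale \<nu> \<mu> r) x) \<gamma>"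
  using has_contour_integral_mult_convolution_poly[OF assms, of \<nu> \<mu> r x]
  by (simp add: poly_altdef[of "binomial_scale \<nu> \<mu> r"] coeff_binomial_scale mult_ac)

text \<open>The factor \<open>\<mu>\<close> in front of the contour integral completes the
  \<open>fact (\<mu> - 1)\<close> of the beta integral to the \<open>fact \<mu>\<close> in the
  binomial.\<close>

lemma beta_moment_binomial:
  assumes "1 \<le> \<mu>"
  shows "real \<mu> * real ((\<nu> + i + \<mu>) choose \<mu>) * (fact (\<nu> + i) * fact (\<mu> - 1) / fact (\<nu> + i + \<mu>)) = 1"
proof -
  have "fact \<mu> = real \<mu> * fact (\<mu> - 1)" using assms by (simp add: fact_reduce)
  moreover have "real ((\<nu> + i + \<mu>) choose \<mu>) = fact (\<nu> + i + \<mu>) / (fact \<mu> * fact (\<nu> + i))"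
    by (simp add: binomial_fact)
  ultimately show ?thesis using assms by (simp add: field_simps)
qed

theorem theorem2p12:
  fixes M :: "'w measure"
    and n m l \<nu> \<mu> :: nat
    and U T X :: "'w \<Rightarrow> complex mat"
    and f F :: "nat \<Rightarrow> real \<Rightarrow> real"
    and Z :: real
    and p P :: "nat \<Rightarrow> complex \<Rightarrow> complex"
    and q Q :: "nat \<Rightarrow> real \<Rightarrow> complex"
    and k\<^sub>n K\<^sub>n :: "complex \<Rightarrow> real \<Rightarrow> complex"
    and p\<^sub>n :: "complex \<Rightarrow> complex"
    and \<Sigma> :: "real \<Rightarrow> complex"
  assumes "prob_space M"
    and "1 \<le> \<nu>" and "l \<le> m" and "n \<le> l" and "m = n + \<nu> + \<mu>" and "1 \<le> \<mu>"
    and "haar_distributed M m U"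
    and "T = (\<lambda>\<omega>. truncation (n + \<nu>) l (U \<omega>))"
    and "X \<in> measurable M (mat_borel l n)"
    and "prob_space.indep_var M (mat_borel (n + \<nu>) l) T (mat_borel l n) X"
    and "ensemble_weights n f"
    and "follows_polynomial_ensemble M n (\<lambda>\<omega>. sq_sing_vals (X \<omega>)) f Z"
    and "biorthogonal_system n f p q"
    and "k\<^sub>n = correlation_kernel n p q"
    and "p\<^sub>n = (\<lambda>z. LINT \<omega>|M. (\<Prod>x\<leftarrow>sq_sing_vals (X \<omega>). z - of_real x))"
    and "admissible_contour \<Sigma>"
    and "F = (\<lambda>k. mellin_convolution \<nu> \<mu> (f k))"
    and "P = (\<lambda>k x. of_nat \<mu> / (2 * of_real pi * \<i>) *
           contour_integral \<Sigma> (\<lambda>s. s powi (- int \<nu>) * (1 - s) powi (- int \<mu> - 1) *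
             p k (x / s) * (1 / s)))"
    and "Q = (\<lambda>k. mellin_convolution \<nu> \<mu> (q k))"
    and "K\<^sub>n = (\<lambda>x y. of_nat \<mu> / (2 * of_real pi * \<i>) *
           contour_integral \<Sigma> (\<lambda>s. 1 / s *
             (LINT t:{0<..<1}|lborel. 1 / of_real t * (of_real t / s) ^ \<nu> *
                k\<^sub>n (x / s) (y / t) * (1 - s) powi (- int \<mu> - 1) * (1 - of_real t) ^ (\<mu> - 1))))"
  shows
    "biorthogonal_system n F P Q \<and>
     ((\<forall>x. \<forall>y>0. K\<^sub>n x y = correlation_kernel n P Q x y) \<and>
      (\<forall>Z'. follows_polynomial_ensemble M n (\<lambda>\<omega>. sq_sing_vals (T \<omega> * X \<omega>)) F Z' \<longrightarrow>
            determinantal M n (\<lambda>\<omega>. sq_sing_vals (T \<omega> * X \<omega>)) K\<^sub>n)) \<and>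
     (\<forall>x. integrable M
            (\<lambda>\<omega>. det (x \<cdot>\<^sub>m 1\<^sub>m n - mat_adjoint (X \<omega>) * mat_adjoint (T \<omega>) * T \<omega> * X \<omega>)) \<and>
          (LINT \<omega>|M. det (x \<cdot>\<^sub>m 1\<^sub>m n - mat_adjoint (X \<omega>) * mat_adjoint (T \<omega>) * T \<omega> * X \<omega>)) =
            fact \<mu> * fact (n + \<nu>) / (2 * of_real pi * \<i> * fact (n + \<nu> + \<mu>)) *
            contour_integral \<Sigma> (\<lambda>s. s powi (- int \<nu>) * (1 - s) powi (- int \<mu> - 1) *
              p\<^sub>n (x / s) * (1 / s)))"
proof -
  note M = assms(1) and \<nu> = assms(2) and lm = assms(3) and nl = assms(4) and m = assms(5) and \<mu> = assms(6)
    and U = assms(7) and T = assms(8) and X = assms(9) and indep = assms(10) and f = assms(11)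
    and follows = assms(12) and bio = assms(13) and kn = assms(14) and pn = assms(15) and adm = assms(16)
    and F = assms(17) and P = assms(18) and Q = assms(19) and Kn = assms(20)
  interpret prob_space M by (rule M)
  have fm: "f k \<in> borel_measurable borel" and fneg: "\<And>x. x < 0 \<Longrightarrow> f k x = 0"
    and fmom: "\<And>a. a \<le> n \<Longrightarrow> integrable lborel (\<lambda>x. x ^ a * f k x)" if "k < n" for k
    using f that by (auto simp: ensemble_weights_def)
  have fint: "integrable lborel (f k)" if "k < n" for k using fmom[OF that, of 0] by simp
  have Fm: "F k \<in> borel_measurable borel" if "k < n" for k
    unfolding F by (rule borel_measurable_mellin_convolution[OF fm[OF that]])
  have Fmom: "integrable lborel (\<lambda>x. x ^ a * F k x)"
    "(LINT x|lborel. x ^ a * F k x) =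
      fact (\<nu> + a) * fact (\<mu> - 1) / fact (\<nu> + a + \<mu>) * (LINT x|lborel. x ^ a * f k x)" if "k < n" "a \<le> n" for k a
    unfolding F by (intro moment_mellin_convolution fm fmom that \<nu> \<mu>)+
  obtain r where r: "\<And>j. j < n \<Longrightarrow> degree (r j) = j" "\<And>j z. j < n \<Longrightarrow> p j z = poly (r j) z"
    using bio unfolding biorthogonal_system_def by metis
  obtain c where c: "\<And>j x. j < n \<Longrightarrow> q j x = (\<Sum>i<n. c j i * complex_of_real (f i x))"
    using bio unfolding biorthogonal_system_def by metis
  have q_eq: "q j = (\<lambda>x. \<Sum>i<n. c j i * complex_of_real (f i x))" if "j < n" for j
    using c[OF that] by (rule ext)
  define R where "R j = Polynomial.smult (of_nat \<mu>) (binomial_scale \<nu> \<mu> (r j))" for j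
  have degR: "degree (R j) = j" if "j < n" for j using r(1)[OF that] \<mu> by (simp add: R_def)
  have P_contour: "((\<lambda>s. s powi (- int \<nu>) * (1 - s) powi (- int \<mu> - 1) * p j (x / s) * (1 / s))
      has_contour_integral 2 * of_real pi * \<i> * poly (binomial_scale \<nu> \<mu> (r j)) x) \<Sigma>" if "j < n" for j x
    using has_contour_integral_binomial_scale[OF adm, of \<nu> \<mu> "r j" x] r(2)[OF that] by simp
  have cancel: "a / (2 * of_real pi * \<i> * b) * (2 * of_real pi * \<i> * z) = a / b * z" for a b z :: complex
  proof -
    have "a / (w * b) * (w * z) = a / b * z" if "w \<noteq> 0" for w :: complex using that by simp
    from this[of "2 * of_real pi * \<i>"] show ?thesis by simp
  qed
  have P_eq: "P j x = poly (R j) x" if "j < n" for j x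
    unfolding P contour_integral_unique[OF P_contour[OF that]]
    using cancel[of "of_nat \<mu>" 1] by (simp only: R_def poly_smult mult_1_right div_by_1)
  have Q_eq: "Q j x = (\<Sum>i<n. c j i * complex_of_real (F i x))" if "j < n" for j x
    unfolding Q F q_eq[OF that] by (rule mellin_convolution_span(2)[OF fm fint fneg \<nu>])

  \<comment> \<open>Part (a): the transformed biorthogonal system\<close>
  have bioF: "biorthogonal_system n F P Q"
    unfolding biorthogonal_system_def
  proof (intro conjI allI impI)
    fix j assume "j < n"
    then show "\<exists>r. degree r = j \<and> (\<forall>z. P j z = poly r z)" using degR P_eq by blast
    show "\<exists>c. \<forall>x. Q j x = (\<Sum>i<n. c i * complex_of_real (F i x))" using Q_eq[OF \<open>j < n\<close>] by blast
  next
    fix j k assume jk: "j < n" "k < n"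
    have PQ: "P j (of_real x) * Q k x = poly (R j) (of_real x) * (\<Sum>i<n. c k i * complex_of_real (F i x))" for x
      by (simp only: P_eq[OF jk(1)] Q_eq[OF jk(2)])
    \<comment> \<open>\<open>R j\<close> has degree \<open>j < n\<close>, so only moments provided
      by \<open>ensemble_weights\<close> occur.\<close>
    have FR: "integrable lborel (\<lambda>x. x ^ a * F i x)" if "i < n" "a \<le> degree (R j)" for i a
      using that jk degR[OF jk(1)] by (intro Fmom) auto
    show "integrable lborel (\<lambda>x. P j (of_real x) * Q k x)"
      unfolding PQ by (rule integral_poly_times_span(1)[OF FR])
    have "(LINT x|lborel. P j (of_real x) * Q k x) =
        (\<Sum>a\<le>j. \<Sum>i<n. coeff (R j) a * c k i * complex_of_real (LINT x|lborel. x ^ a * F i x))"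
      using integral_poly_times_span(2)[where f = F and n = n and r = "R j" and c = "c k", OF FR]
      unfolding PQ by (simp only: degR[OF jk(1)])
    \<comment> \<open>The multiplier of the coefficient of order \<open>a\<close> cancels that of
      the moment of order \<open>a\<close>, which leaves the original pairing.\<close>
    also have "\<dots> = (\<Sum>a\<le>j. \<Sum>i<n. coeff (r j) a * c k i * complex_of_real (LINT x|lborel. x ^ a * f i x))"
    proof (rule sum.cong[OF refl], rule sum.cong[OF refl])
      fix a i assume ai: "a \<in> {..j}" "i \<in> {..<n}"
      let ?I = "LINT x|lborel. x ^ a * f i x" and ?B = "fact (\<nu> + a) * fact (\<mu> - 1) / fact (\<nu> + a + \<mu>) :: real"
      have FI: "(LINT x|lborel. x ^ a * F i x) = ?B * ?I" using ai jk by (intro Fmom(2)) auto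
      have "coeff (R j) a * c k i * complex_of_real (LINT x|lborel. x ^ a * F i x) =
        complex_of_real (real \<mu> * real ((\<nu> + a + \<mu>) choose \<mu>) * ?B) * (coeff (r j) a * c k i * complex_of_real ?I)"
        unfolding FI by (simp add: R_def coeff_binomial_scale mult_ac)
      also have "\<dots> = coeff (r j) a * c k i * complex_of_real ?I"
        unfolding beta_moment_binomial[OF \<mu>] by simp
      finally show "coeff (R j) a * c k i * complex_of_real (LINT x|lborel. x ^ a * F i x) =
        coeff (r j) a * c k i * complex_of_real ?I" .
    qed
    also have "\<dots> = (LINT x|lborel. p j (of_real x) * q k x)"
      unfolding r(2)[OF jk(1)] c[OF jk(2)]
      by (subst integral_poly_times_span(2)) (use r(1)[OF jk(1)] fmom jk in auto)
    also have "\<dots> = (if j = k then 1 else 0)"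
      using bio jk unfolding biorthogonal_system_def by blast
    finally show "(LINT x|lborel. P j (of_real x) * Q k x) = (if j = k then 1 else 0)" .
  qed

  \<comment> \<open>Part (b): the correlation kernel\<close>
  have K_eq: "K\<^sub>n x y = correlation_kernel n P Q x y" for x y
  proof -
    \<comment> \<open>This holds for all \<open>s\<close>, even for \<open>s = 0\<close> with the
      inverse of 0 being 0, so the integrand can be rewritten as a function and not only on the
      path. The factor \<open>(of_real t / s) ^ \<nu>\<close> supplies the power of \<open>t\<close>
      for \<open>Q\<close> and that of \<open>s\<close> for \<open>P\<close>.\<close>
    have inner: "(LINT t:{0<..<1}|lborel. 1 / of_real t * (of_real t / s) ^ \<nu> *
                k\<^sub>n (x / s) (y / t) * (1 - s) powi (- int \<mu> - 1) * (1 - of_real t) ^ (\<mu> - 1)) =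
      (\<Sum>j<n. s powi (- int \<nu>) * (1 - s) powi (- int \<mu> - 1) * p j (x / s) * Q j y)" for s
    proof -
      have "has_bochner_integral lborel
        (\<lambda>t. \<Sum>j<n. s powi (- int \<nu>) * (1 - s) powi (- int \<mu> - 1) * p j (x / s) *
           (indicator {0<..<1} t *\<^sub>R (beta_weight \<nu> \<mu> t *\<^sub>R q j (y / t))))
        (\<Sum>j<n. s powi (- int \<nu>) * (1 - s) powi (- int \<mu> - 1) * p j (x / s) * Q j y)"
      proof (intro has_bochner_integral_sum has_bochner_integral_mult_right)
        fix j assume "j \<in> {..<n}"
        then have "j < n" by simp
        have "set_integrable lborel {0<..<1} (\<lambda>t. beta_weight \<nu> \<mu> t *\<^sub>R q j (y / t))"
          unfolding q_eq[OF \<open>j < n\<close>] by (rule mellin_convolution_span(1)[OF fm fint fneg \<nu>])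
        then show "has_bochner_integral lborel
            (\<lambda>t. indicator {0<..<1} t *\<^sub>R (beta_weight \<nu> \<mu> t *\<^sub>R q j (y / t))) (Q j y)"
          unfolding Q mellin_convolution_def beta_weight_def set_integrable_def set_lebesgue_integral_def
          by (rule has_bochner_integral_integrable)
      qed
      moreover have "indicator {0<..<1} t *\<^sub>R (1 / of_real t * (of_real t / s) ^ \<nu> *
                k\<^sub>n (x / s) (y / t) * (1 - s) powi (- int \<mu> - 1) * (1 - of_real t) ^ (\<mu> - 1)) =
        (\<Sum>j<n. s powi (- int \<nu>) * (1 - s) powi (- int \<mu> - 1) * p j (x / s) *
           (indicator {0<..<1} t *\<^sub>R (beta_weight \<nu> \<mu> t *\<^sub>R q j (y / t))))" for t :: real
        unfolding kn correlation_kernel_def sum_distrib_left sum_distrib_right scaleR_sum_right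
        by (rule sum.cong[OF refl])
          (simp add: beta_weight_def scaleR_conv_of_real power_int_minus divide_inverse power_mult_distrib power_inverse mult_ac)
      ultimately show ?thesis
        unfolding set_lebesgue_integral_def by (simp only: has_bochner_integral_integral_eq)
    qed
    have "((\<lambda>s. \<Sum>j<n. Q j y * (s powi (- int \<nu>) * (1 - s) powi (- int \<mu> - 1) * p j (x / s) * (1 / s)))
        has_contour_integral (\<Sum>j<n. Q j y * (2 * of_real pi * \<i> * poly (binomial_scale \<nu> \<mu> (r j)) x))) \<Sigma>"
      by (intro has_contour_integral_sum has_contour_integral_lmul P_contour) auto
    moreover have "1 / s * (\<Sum>j<n. s powi (- int \<nu>) * (1 - s) powi (- int \<mu> - 1) * p j (x / s) * Q j y) =
      (\<Sum>j<n. Q j y * (s powi (- int \<nu>) * (1 - s) powi (- int \<mu> - 1) * p j (x / s) * (1 / s)))" for s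
      unfolding sum_distrib_left by (rule sum.cong[OF refl]) (simp only: mult_ac)
    ultimately have "K\<^sub>n x y = of_nat \<mu> / (2 * of_real pi * \<i>) *
        (\<Sum>j<n. Q j y * (2 * of_real pi * \<i> * poly (binomial_scale \<nu> \<mu> (r j)) x))"
      unfolding Kn inner by (simp only: contour_integral_unique)
    also have "\<dots> = (\<Sum>j<n. P j x * Q j y)"
      unfolding sum_distrib_left using cancel[of "of_nat \<mu>" 1]
      by (intro sum.cong[OF refl])
        (simp only: P_eq lessThan_iff R_def poly_smult mult_1_right div_by_1 mult.left_commute[of _ "Q _ y"] mult.commute[of _ "Q _ y"])
    finally show ?thesis by (simp add: correlation_kernel_def)
  qed
  then have K_fun: "K\<^sub>n = correlation_kernel n P Q" by (intro ext)

  \<comment> \<open>Part (c): the average characteristic polynomial\<close>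
  let ?c = "\<lambda>j. LINT \<omega>|M. coeff (char_poly (mat_adjoint (X \<omega>) * X \<omega>)) j"
  \<comment> \<open>The expectation is taken coefficientwise, so that the contour formula for
    polynomials applies to \<open>p\<^sub>n\<close>.\<close>
  define r\<^sub>n where "r\<^sub>n = (\<Sum>j\<le>n. monom (?c j) j)"
  have coeff_rn: "coeff r\<^sub>n j = (if j \<le> n then ?c j else 0)" for j
    by (simp add: r\<^sub>n_def coeff_sum)
  have deg_rn: "degree r\<^sub>n \<le> n" by (rule degree_le) (simp add: coeff_rn)
  have pn_poly: "p\<^sub>n z = poly r\<^sub>n z" for z
  proof -
    have "(\<Prod>x\<leftarrow>sq_sing_vals (X \<omega>). z - of_real x) =
      (\<Sum>j\<le>n. coeff (char_poly (mat_adjoint (X \<omega>) * X \<omega>)) j * z ^ j)" if "\<omega> \<in> space M" for \<omega>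
    proof -
      have Xc: "X \<omega> \<in> carrier_mat l n" using measurable_space[OF X that] by (simp add: space_mat_borel)
      have "(\<Prod>x\<leftarrow>sq_sing_vals (X \<omega>). z - of_real x) = poly (char_poly (mat_adjoint (X \<omega>) * X \<omega>)) z"
        by (simp add: sq_sing_vals(3)[OF Xc] poly_prod_list o_def)
      then show ?thesis
        using degree_monic_char_poly[OF gram_carrier[OF Xc]] by (simp add: poly_altdef)
    qed
    then have "p\<^sub>n z = (LINT \<omega>|M. (\<Sum>j\<le>n. coeff (char_poly (mat_adjoint (X \<omega>) * X \<omega>)) j * z ^ j))"
      unfolding pn by (intro Bochner_Integration.integral_cong) auto
    also have "\<dots> = (\<Sum>j\<le>n. ?c j * z ^ j)"
      using sq_sing_vals_coeff_integrable[OF M f X follows] by simp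
    finally show ?thesis by (simp add: r\<^sub>n_def poly_sum poly_monom)
  qed
  have nN: "n \<le> n + \<nu>" and Nm: "n + \<nu> \<le> m" using m by auto
  note avg = average_char_poly_truncated[OF M f lm nN Nm U X follows T indep]
  have "(LINT \<omega>|M. det (x \<cdot>\<^sub>m 1\<^sub>m n - mat_adjoint (X \<omega>) * mat_adjoint (T \<omega>) * T \<omega> * X \<omega>)) =
            fact \<mu> * fact (n + \<nu>) / (2 * of_real pi * \<i> * fact (n + \<nu> + \<mu>)) *
            contour_integral \<Sigma> (\<lambda>s. s powi (- int \<nu>) * (1 - s) powi (- int \<mu> - 1) *
              p\<^sub>n (x / s) * (1 / s))" (is "?E = ?C") for x
  proof -
    \<comment> \<open>Since \<open>m = n + \<nu> + \<mu>\<close>, the reciprocal of this binomial is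
      the constant in (c), apart from 2 pi i.\<close>
    have choose: "of_nat (m choose (n + \<nu>)) = (fact m / (fact (n + \<nu>) * fact \<mu>) :: complex)"
      using m by (subst binomial_fact) auto
    have "(of_nat (m choose (n + \<nu>)) :: complex) * ?E =
        (\<Sum>j\<le>n. of_nat ((m - n + j) choose (n + \<nu> - n + j)) * ?c j * x ^ j)"
      by (rule avg(2))
    also have "\<dots> = (\<Sum>j\<le>n. of_nat ((\<nu> + j + \<mu>) choose \<mu>) * coeff r\<^sub>n j * x ^ j)"
    proof (rule sum.cong[OF refl])
      fix j assume "j \<in> {..n}"
      \<comment> \<open>Here \<open>m - n\<close> is \<open>\<nu> + \<mu>\<close>, and symmetry
        identifies the multiplier from the row average with that of the contour integral.\<close>
      have "(m - n + j) choose (n + \<nu> - n + j) = (\<nu> + j + \<mu>) choose \<mu>"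
        using m binomial_symmetric[of \<mu> "\<nu> + j + \<mu>"] by (simp add: add_ac)
      then show "of_nat ((m - n + j) choose (n + \<nu> - n + j)) * ?c j * x ^ j =
        of_nat ((\<nu> + j + \<mu>) choose \<mu>) * coeff r\<^sub>n j * x ^ j"
        using \<open>j \<in> {..n}\<close> by (simp add: coeff_rn)
    qed
    also have "\<dots> = poly (binomial_scale \<nu> \<mu> r\<^sub>n) x"
      \<comment> \<open>The sum runs to \<open>n\<close>, while \<open>r\<^sub>n\<close> is only
        shown to have degree at most \<open>n\<close>; surplus terms have coefficient zero.\<close>
      unfolding poly_altdef coeff_binomial_scale degree_binomial_scale
      using deg_rn by (intro sum.mono_neutral_right) (auto simp: coeff_eq_0)
    finally have "?E = fact (n + \<nu>) * fact \<mu> / fact m * poly (binomial_scale \<nu> \<mu> r\<^sub>n) x"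
      unfolding choose by (simp add: field_simps)
    also have "\<dots> = ?C"
      unfolding pn_poly contour_integral_unique[OF has_contour_integral_binomial_scale[OF adm]]
      unfolding cancel using m by (simp add: mult_ac)
    finally show ?thesis .
  qed
  \<comment> \<open>The law of \<open>T X\<close> enters here alone, as the premise with
    \<open>Z'\<close> under which the kernel is determinantal.\<close>
  with bioF K_eq K_fun determinantal_biorthogonal[where f = F, OF M Fm _ bioF] avg(1) show ?thesis by blast
qed

end
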